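(* The monomial factors of $$\Gamma_0=\prod_{i=1}^{n-2}\xi_i^{e_i},\qquad e_i=q^{m-\lceil i/2\rceil}-1,$$ that is, the elements $\prod_{i=1}^{n-2}\xi_i^{a_i}$ with $0\le a_i\le e_i$, form a basis for $S_m^{P_m}$ as a free module over $\mathbb{F}_q[\mathcal{H}_0]$, where $\mathcal{H}_0=\{N(y_1),\ldots,N(y_m),N(x_1),\ldots,N(x_m)\}$ and $\mathbb{F}_q[\mathcal{H}_0]$ is the $\mathbb{F}_q$-subalgebra it generates.
   Context: Let $q$ be a power of an odd prime $p$, let $m\ge 1$ and $n=2m$. Let $S_m=\mathbb{F}_q[y_m,\ldots,y_1,x_1,\ldots,x_m]$ be the polynomial ring in $n$ variables with its standard grading. The group $\mathrm{GL}_n(\mathbb{F}_q)$ acts on the right on $S_m$ by $\mathbb{F}_q$-algebra automorphisms: identify a linear form with its row vector of coefficients with respect to the ordered basis $[y_m,\ldots,y_1,x_1,\ldots,x_m]$, and let $g$ act by right multiplication. Put $\xi_1=\sum_{k=1}^m y_kx_k$ and, for $i\ge2$, $\xi_i=\sum_{k=1}^m\bigl(y_k^{q^{i-1}}x_k+y_kx_k^{q^{i-1}}\bigr)$. Let $G_m=\mathrm{O}^+_{2m}(\mathbb{F}_q)=\{g\in\mathrm{GL}_n(\mathbb{F}_q)\mid \xi_1\cdot g=\xi_1\}$. Let $P_m$ be the group of upper triangular unipotent matrices in $G_m$ (a Sylow $p$-subgroup of $G_m$), and $S_m^{P_m}$ its ring of invariants. For a linear form $v$, let $N(v)$ be the product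 of the distinct elements of the $P_m$-orbit of $v$. *)

theory Defs
  imports
    Complex_Main
    "HOL-Library.Cardinality"
    "HOL-Library.FuncSet"
    "HOL-Library.Poly_Mapping"
    "HOL-Computational_Algebra.Primes"
    "Jordan_Normal_Form.Matrix"
begin

section \<open>Multivariate polynomials\<close>

text \<open>
  A polynomial is a finitely supported map from monomials to coefficients, a monomial a finitely
  supported map from variable indices to exponents; multiplication is the convolution product of
  \<^theory>\<open>HOL-Library.Poly_Mapping\<close>.
\<close>

type_synonym 'a mpoly = "(nat \<Rightarrow>\<^sub>0 nat) \<Rightarrow>\<^sub>0 'a"

definition mconst :: "'a::zero \<Rightarrow> 'a mpoly" where
  "mconst c = Poly_Mapping.single 0 c"

definition mvar :: "nat \<Rightarrow> 'a::zero_neq_one mpoly" where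
  "mvar i = Poly_Mapping.single (Poly_Mapping.single i 1) 1"

definition substitute :: "(nat \<Rightarrow> 'a mpoly) \<Rightarrow> 'a mpoly \<Rightarrow> 'a::comm_ring_1 mpoly" where
  "substitute \<sigma> f = (\<Sum>t\<in>Poly_Mapping.keys f. mconst (Poly_Mapping.lookup f t) *
     (\<Prod>i\<in>Poly_Mapping.keys t. \<sigma> i ^ Poly_Mapping.lookup t i))"

section \<open>Generated subalgebras and free bases\<close>

definition is_subalgebra :: "'a::comm_ring_1 mpoly set \<Rightarrow> bool" where
  "is_subalgebra A \<longleftrightarrow> range mconst \<subseteq> A \<and>
     (\<forall>f\<in>A. \<forall>g\<in>A. f + g \<in> A) \<and> (\<forall>f\<in>A. \<forall>g\<in>A. f * g \<in> A)"

definition generated_subalgebra :: "'a::comm_ring_1 mpoly set \<Rightarrow> 'a mpoly set" where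
  "generated_subalgebra H = is_subalgebra hull H"

definition is_submodule :: "'r::comm_ring_1 set \<Rightarrow> 'r set \<Rightarrow> bool" where
  "is_submodule A M \<longleftrightarrow> 0 \<in> M \<and>
     (\<forall>f\<in>M. \<forall>g\<in>M. f + g \<in> M) \<and> (\<forall>a\<in>A. \<forall>f\<in>M. a * f \<in> M)"

text \<open>
  The family \<open>b\<close>, indexed by \<open>I\<close>, is a basis of \<open>M\<close> as a free module over the subring \<open>A\<close> of the
  ambient ring.  Independence is that of the family, so in particular its members are distinct.
\<close>

definition is_free_basis ::
  "'r::comm_ring_1 set \<Rightarrow> 'r set \<Rightarrow> 'i set \<Rightarrow> ('i \<Rightarrow> 'r) \<Rightarrow> bool" where
  "is_free_basis A M I b \<longleftrightarrow>
     is_submodule A M \<and> b ` I \<subseteq> M \<and>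
     (\<forall>f\<in>M. \<exists>J c. finite J \<and> J \<subseteq> I \<and> c \<in> J \<rightarrow> A \<and> f = (\<Sum>j\<in>J. c j * b j)) \<and>
     (\<forall>J c. finite J \<and> J \<subseteq> I \<and> c \<in> J \<rightarrow> A \<and> (\<Sum>j\<in>J. c j * b j) = 0 \<longrightarrow> (\<forall>j\<in>J. c j = 0))"

section \<open>The polynomial ring and the linear action\<close>

text \<open>
  The variables of \<open>S m\<close> are numbered \<open>0, \<dots>, 2m - 1\<close> by their position in the ordered basis
  \<open>[y\<^sub>m, \<dots>, y\<^sub>1, x\<^sub>1, \<dots>, x\<^sub>m]\<close>, matching the row and column indices of matrices.
  \<open>Y m k\<close> and \<open>X m k\<close> are only meaningful for \<open>1 \<le> k \<le> m\<close>.
\<close>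

definition S :: "nat \<Rightarrow> 'a::zero mpoly set" where
  "S m = {f. \<forall>t\<in>Poly_Mapping.keys f. Poly_Mapping.keys t \<subseteq> {..<2 * m}}"

definition Y :: "nat \<Rightarrow> nat \<Rightarrow> 'a::zero_neq_one mpoly" where
  "Y m k = mvar (m - k)"

definition X :: "nat \<Rightarrow> nat \<Rightarrow> 'a::zero_neq_one mpoly" where
  "X m k = mvar (m + k - 1)"

text \<open>
  The right action \<open>f \<cdot> g\<close>.  The row vector of the \<open>i\<close>-th variable is the \<open>i\<close>-th unit vector, whose
  product with \<open>g\<close> is the \<open>i\<close>-th row of \<open>g\<close>.
\<close>

definition act :: "'a::comm_ring_1 mpoly \<Rightarrow> 'a mat \<Rightarrow> 'a mpoly" where
  "act f g = substitute (\<lambda>i. \<Sum>j<dim_col g. mconst (g $$ (i, j)) * mvar j) f"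

section \<open>The orthogonal group of plus type and its unipotent subgroup\<close>

text \<open>\<open>CARD('a)\<close> is the order \<open>q\<close> of the ground field.\<close>

definition xi :: "nat \<Rightarrow> nat \<Rightarrow> 'a::{field,finite} mpoly" where
  "xi m i = (if i = 1 then (\<Sum>k=1..m. Y m k * X m k)
     else (\<Sum>k=1..m. Y m k ^ (CARD('a) ^ (i - 1)) * X m k + Y m k * X m k ^ (CARD('a) ^ (i - 1))))"

definition G :: "nat \<Rightarrow> 'a::{field,finite} mat set" where
  "G m = {g \<in> carrier_mat (2 * m) (2 * m). invertible_mat g \<and> act (xi m 1) g = xi m 1}"

definition P :: "nat \<Rightarrow> 'a::{field,finite} mat set" where
  "P m = {g \<in> G m. upper_triangular g \<and> (\<forall>i<2 * m. g $$ (i, i) = 1)}"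

definition invariants :: "nat \<Rightarrow> 'a::{field,finite} mpoly set" where
  "invariants m = {f \<in> S m. \<forall>g\<in>P m. act f g = f}"

definition N :: "nat \<Rightarrow> 'a::{field,finite} mpoly \<Rightarrow> 'a mpoly" where
  "N m v = \<Prod>(act v ` P m)"

definition H0 :: "nat \<Rightarrow> 'a::{field,finite} mpoly set" where
  "H0 m = (\<lambda>k. N m (Y m k)) ` {1..m} \<union> (\<lambda>k. N m (X m k)) ` {1..m}"

definition e :: "nat \<Rightarrow> nat \<Rightarrow> nat \<Rightarrow> nat" where
  "e q m i = q ^ (m - nat \<lceil>real i / 2\<rceil>) - 1"

end

theory Submission
  imports
    Defs
    "HOL-Computational_Algebra.Computational_Algebra"
    "Jordan_Normal_Form.Char_Poly"
begin

text \<open>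
  Induction on \<open>m\<close>. Write \<open>z = x\<^bsub>m+1\<^esub>\<close>, \<open>y = y\<^bsub>m+1\<^esub>\<close>, and \<open>u\<close> for the remaining \<open>2m\<close> variables of rank
  \<open>m + 1\<close>. The substitution \<open>u \<mapsto> u\<^sup>q - u z\<^sup>q\<^sup>-\<^sup>1\<close> maps the invariants of rank \<open>m\<close> to invariants of rank
  \<open>m + 1\<close>, sends \<open>N(u)\<close> to \<open>N(u)\<close>, reduces to the \<open>q\<close>-th power map modulo \<open>z\<close>, and together with \<open>z\<close> its image
  exhausts the invariants free of \<open>y\<close>, since these are invariant under all \<open>u \<mapsto> u + c z\<close>.

  Let \<open>\<zeta>\<^sub>b\<close> be the product of the \<open>\<xi>\<^sub>i\<close> to the powers \<open>b\<^sub>i mod q\<close> and of the images of the \<open>\<xi>\<^sub>i\<close> of rank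
  \<open>m\<close> to the powers \<open>b\<^sub>i div q\<close>; it agrees with the monomial \<open>\<xi>\<^sup>b\<close> modulo \<open>z\<close>. As polynomials in \<open>y\<close>, the products
  \<open>N(y)\<^sup>k \<Prod>\<xi>\<^sub>i\<^bsup>c\<^sub>i\<^esup>\<close> with digits \<open>c\<^sub>i < q\<close> realize every degree, with a power of \<open>z\<close> as leading coefficient, so every
  invariant multiplied by a power of \<open>z\<close> is a combination of the \<open>\<zeta>\<^sub>b\<close>. The power of \<open>z\<close> can be cancelled because
  the \<open>\<xi>\<^sup>b\<close> of rank \<open>m\<close> satisfy no relation modulo \<open>z\<close>: the monomials in the \<open>\<xi>\<^sub>i\<close>, \<open>i \<le> 2m\<close>, with exponents
  below \<open>q\<close> are independent over the \<open>q\<close>-th powers, as the Jacobian of the \<open>\<xi>\<^sub>i\<close> is a Moore determinant, and the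
  inner relation is the \<open>q\<close>-th power of one in rank \<open>m\<close>. Finally \<open>\<zeta>\<^sub>b\<close> is replaced by \<open>\<xi>\<^sup>b\<close> by induction on
  the degree, and the same reduction modulo \<open>z\<close> gives independence.
\<close>

section \<open>Evaluation homomorphisms\<close>

text \<open>The exponent bounds come from base q expansions. \<open>e q (Suc m) i\<close> is
  \<open>q * e q m i + (q - 1)\<close> for i <= 2m-2 and q-1 for the new indices 2m-1 and 2m, so an
  exponent vector of rank m+1 is q times one of rank m plus an arbitrary vector of 2m digits below
  q. The digits account for the degree in y: the i-th form has degree q^(i-1) there, so digits
  realize each degree below q^(2m), and N(y) has degree at most q^(2m). That bound on the orbit of y
  is where odd characteristic enters. The other part of the exponents comes from the coefficients,
  which are supplied by rank m. The obstacle is that the substitution takes a form of rank m to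
  something only congruent modulo z to the q-th power of the form of rank m+1. Expansion in y
  therefore yields \<open>zeta\<close> and not monomials in the forms, and modulo z the coefficients
  taken from rank m turn into q-th powers. This is why independence is needed over q-th
  powers.\<close>

definition mono_eval :: "(nat \<Rightarrow> 'b::comm_ring_1) \<Rightarrow> (nat \<Rightarrow>\<^sub>0 nat) \<Rightarrow> 'b" where
  "mono_eval \<sigma> t = (\<Prod>i\<in>Poly_Mapping.keys t. \<sigma> i ^ Poly_Mapping.lookup t i)"

text \<open>The target ring is arbitrary so that \<open>substitute\<close>, \<open>as_poly\<close>,
  \<open>graded\<close>, \<open>translate\<close> and \<open>reduce\<close> are all instances, and
  one proof makes them homomorphisms.\<close>

definition eval_at :: "('a::comm_ring_1 \<Rightarrow> 'b::comm_ring_1) \<Rightarrow> (nat \<Rightarrow> 'b) \<Rightarrow> 'a mpoly \<Rightarrow> 'b" where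
  "eval_at \<phi> \<sigma> f = (\<Sum>t\<in>Poly_Mapping.keys f. \<phi> (Poly_Mapping.lookup f t) * mono_eval \<sigma> t)"

lemma substitute_eq_eval_at: "substitute \<sigma> = eval_at mconst \<sigma>"
  by (intro ext) (simp add: substitute_def eval_at_def mono_eval_def)

lemma mono_eval_superset:
  assumes "finite I" "Poly_Mapping.keys t \<subseteq> I"
  shows "mono_eval \<sigma> t = (\<Prod>i\<in>I. \<sigma> i ^ Poly_Mapping.lookup t i)"
  unfolding mono_eval_def
  by (rule prod.mono_neutral_left) (use assms in \<open>auto simp: in_keys_iff\<close>)

lemma mono_eval_zero [simp]: "mono_eval \<sigma> 0 = 1"
  by (simp add: mono_eval_def)

lemma mono_eval_single [simp]: "mono_eval \<sigma> (Poly_Mapping.single i k) = \<sigma> i ^ k"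
  by (cases "k = 0") (simp_all add: mono_eval_def)

lemma mono_eval_add: "mono_eval \<sigma> (s + t) = mono_eval \<sigma> s * mono_eval \<sigma> t"
proof -
  let ?I = "Poly_Mapping.keys s \<union> Poly_Mapping.keys t"
  have "Poly_Mapping.keys (s + t) \<subseteq> ?I" by (rule Poly_Mapping.keys_add)
  then show ?thesis
    by (simp add: mono_eval_superset[of ?I] lookup_add power_add prod.distrib)
qed

context
  fixes \<phi> :: "'a::comm_ring_1 \<Rightarrow> 'b::comm_ring_1" and \<sigma> :: "nat \<Rightarrow> 'b"
  assumes hom: "comm_ring_hom \<phi>"
begin

interpretation \<phi>: comm_ring_hom \<phi> by (rule hom)

lemma eval_at_superset:
  assumes "finite T" "Poly_Mapping.keys f \<subseteq> T"
  shows "eval_at \<phi> \<sigma> f = (\<Sum>t\<in>T. \<phi> (Poly_Mapping.lookup f t) * mono_eval \<sigma> t)"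
  unfolding eval_at_def
  by (rule sum.mono_neutral_left) (use assms in \<open>auto simp: in_keys_iff\<close>)

lemma eval_at_single [simp]: "eval_at \<phi> \<sigma> (Poly_Mapping.single t c) = \<phi> c * mono_eval \<sigma> t"
  by (simp add: eval_at_def)

lemma eval_at_add: "eval_at \<phi> \<sigma> (f + g) = eval_at \<phi> \<sigma> f + eval_at \<phi> \<sigma> g"
proof -
  let ?T = "Poly_Mapping.keys f \<union> Poly_Mapping.keys g"
  have "Poly_Mapping.keys (f + g) \<subseteq> ?T" by (rule Poly_Mapping.keys_add)
  then show ?thesis
    by (simp add: eval_at_superset[of ?T] lookup_add sum.distrib \<phi>.hom_add algebra_simps)
qed

lemma eval_at_sum: "eval_at \<phi> \<sigma> (\<Sum>i\<in>I. f i) = (\<Sum>i\<in>I. eval_at \<phi> \<sigma> (f i))"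
  by (induction I rule: infinite_finite_induct) (auto simp: eval_at_add, auto simp: eval_at_def)

end

lemma poly_mapping_sum_single:
  "(\<Sum>t\<in>Poly_Mapping.keys f. Poly_Mapping.single t (Poly_Mapping.lookup f t)) = f"
  by (rule poly_mapping_eqI)
    (auto simp: lookup_sum lookup_single when_def in_keys_iff sum.delta if_distrib cong: if_cong)

lemma comm_ring_hom_eval_at:
  assumes "comm_ring_hom \<phi>"
  shows "comm_ring_hom (eval_at \<phi> \<sigma>)"
proof -
  interpret \<phi>: comm_ring_hom \<phi> by (rule assms)
  have mult: "eval_at \<phi> \<sigma> (f * g) = eval_at \<phi> \<sigma> f * eval_at \<phi> \<sigma> g" for f g
  proof -
    have "f * g = (\<Sum>s\<in>Poly_Mapping.keys f. \<Sum>t\<in>Poly_Mapping.keys g.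
        Poly_Mapping.single (s + t) (Poly_Mapping.lookup f s * Poly_Mapping.lookup g t))"
    proof -
      have "f * g = (\<Sum>s\<in>Poly_Mapping.keys f. Poly_Mapping.single s (Poly_Mapping.lookup f s)) *
          (\<Sum>t\<in>Poly_Mapping.keys g. Poly_Mapping.single t (Poly_Mapping.lookup g t))"
        by (simp only: poly_mapping_sum_single)
      then show ?thesis by (simp add: sum_product mult_single)
    qed
    then have "eval_at \<phi> \<sigma> (f * g) = (\<Sum>s\<in>Poly_Mapping.keys f. \<Sum>t\<in>Poly_Mapping.keys g.
        \<phi> (Poly_Mapping.lookup f s * Poly_Mapping.lookup g t) * mono_eval \<sigma> (s + t))"
      by (simp add: eval_at_sum[OF assms] eval_at_single[OF assms])
    then show ?thesis
      by (simp add: eval_at_def sum_product mono_eval_add \<phi>.hom_mult algebra_simps)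
  qed
  have "eval_at \<phi> \<sigma> 1 = 1"
    by (simp flip: single_one add: eval_at_single[OF assms])
  with mult show ?thesis
    by unfold_locales (simp_all add: eval_at_add[OF assms], simp add: eval_at_def)
qed

lemma mconst_hom: "comm_ring_hom (mconst :: 'a::comm_ring_1 \<Rightarrow> 'a mpoly)"
  by unfold_locales (simp_all add: mconst_def single_add mult_single)

lemma mconst_poly_hom: "comm_ring_hom (\<lambda>c::'a::comm_ring_1. [:mconst c:])"
proof -
  interpret mconst: comm_ring_hom "mconst :: 'a \<Rightarrow> 'a mpoly" by (rule mconst_hom)
  show ?thesis
    by unfold_locales (simp_all add: mconst.hom_add mconst.hom_mult)
qed

lemma eval_at_mconst [simp]:
  "comm_ring_hom \<phi> \<Longrightarrow> eval_at \<phi> \<sigma> (mconst c) = \<phi> c"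
  by (simp add: mconst_def eval_at_single)

lemma eval_at_mvar [simp]:
  assumes "comm_ring_hom \<phi>" shows "eval_at \<phi> \<sigma> (mvar i) = \<sigma> i"
proof -
  interpret \<phi>: comm_ring_hom \<phi> by (rule assms)
  show ?thesis by (simp add: mvar_def eval_at_single[OF assms])
qed

lemma mvar_power: "(mvar i :: 'a::comm_ring_1 mpoly) ^ k = Poly_Mapping.single (Poly_Mapping.single i k) 1"
  by (induction k) (simp_all add: mvar_def mult_single flip: single_add)

lemma mono_eval_mvar: "mono_eval (mvar :: nat \<Rightarrow> 'a::comm_ring_1 mpoly) t = Poly_Mapping.single t 1"
proof -
  have "(\<Prod>i\<in>I. Poly_Mapping.single (g i) (1::'a)) = Poly_Mapping.single (sum g I) 1"
    if "finite I" for I :: "nat set" and g :: "nat \<Rightarrow> nat \<Rightarrow>\<^sub>0 nat"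
    using that by induction (simp_all add: mult_single)
  then show ?thesis
    by (simp add: mono_eval_def mvar_power poly_mapping_sum_single)
qed

lemma eval_at_mvar_self: "eval_at mconst mvar f = (f :: 'a::comm_ring_1 mpoly)"
  by (simp add: eval_at_def mono_eval_mvar mconst_def mult_single poly_mapping_sum_single)

subsection \<open>Polynomials in a given set of variables\<close>

definition polys_in :: "nat set \<Rightarrow> 'a::zero mpoly set" where
  "polys_in V = {f. \<forall>t\<in>Poly_Mapping.keys f. Poly_Mapping.keys t \<subseteq> V}"

lemma polys_inD: "f \<in> polys_in V \<Longrightarrow> t \<in> Poly_Mapping.keys f \<Longrightarrow> i \<in> Poly_Mapping.keys t \<Longrightarrow> i \<in> V"
  unfolding polys_in_def by blast

lemma S_eq_polys_in: "S m = polys_in {..<2 * m}"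
  by (simp add: S_def polys_in_def)

lemma polys_in_mono: "V \<subseteq> W \<Longrightarrow> f \<in> polys_in V \<Longrightarrow> f \<in> polys_in W"
  by (auto simp: polys_in_def)

lemma polys_in_UNIV [simp]: "f \<in> polys_in UNIV"
  by (simp add: polys_in_def)

lemma polys_in_0 [simp]: "0 \<in> polys_in V"
  and polys_in_1 [simp]: "1 \<in> polys_in V"
  and polys_in_mconst [simp]: "mconst c \<in> polys_in V"
  by (simp_all add: polys_in_def mconst_def)

lemma polys_in_mvar [simp]: "(mvar i :: 'a::zero_neq_one mpoly) \<in> polys_in V \<longleftrightarrow> i \<in> V"
  by (simp add: polys_in_def mvar_def)

lemma polys_in_add: "f \<in> polys_in V \<Longrightarrow> g \<in> polys_in V \<Longrightarrow> f + g \<in> polys_in V"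
  unfolding polys_in_def using Poly_Mapping.keys_add[of f g] by blast

lemma polys_in_uminus: "f \<in> polys_in V \<Longrightarrow> - (f :: 'a::comm_ring_1 mpoly) \<in> polys_in V"
  by (simp add: polys_in_def)

lemma polys_in_diff:
  "f \<in> polys_in V \<Longrightarrow> g \<in> polys_in V \<Longrightarrow> f - (g :: 'a::comm_ring_1 mpoly) \<in> polys_in V"
  using polys_in_add[of f V "- g"] polys_in_uminus[of g V] by simp

lemma polys_in_mult:
  assumes "f \<in> polys_in V" "g \<in> polys_in V" shows "f * (g :: 'a::comm_ring_1 mpoly) \<in> polys_in V"
  unfolding polys_in_def
proof (intro CollectI ballI)
  fix t assume "t \<in> Poly_Mapping.keys (f * g)"
  then obtain a b where "t = a + b" "a \<in> Poly_Mapping.keys f" "b \<in> Poly_Mapping.keys g"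
    using Poly_Mapping.keys_mult[of f g] by blast
  then show "Poly_Mapping.keys t \<subseteq> V"
    using assms Poly_Mapping.keys_add[of a b] unfolding polys_in_def by blast
qed

lemma polys_in_power: "f \<in> polys_in V \<Longrightarrow> (f :: 'a::comm_ring_1 mpoly) ^ k \<in> polys_in V"
  by (induction k) (auto intro: polys_in_mult)

lemma polys_in_sum: "(\<And>i. i \<in> I \<Longrightarrow> f i \<in> polys_in V) \<Longrightarrow> (\<Sum>i\<in>I. f i) \<in> polys_in V"
  by (induction I rule: infinite_finite_induct) (auto intro: polys_in_add)

lemma polys_in_prod:
  "(\<And>i. i \<in> I \<Longrightarrow> f i \<in> polys_in V) \<Longrightarrow> (\<Prod>i\<in>I. f i :: 'a::comm_ring_1 mpoly) \<in> polys_in V"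
  by (induction I rule: infinite_finite_induct) (auto intro: polys_in_mult)

lemma eval_at_in_polys_in:
  assumes "f \<in> polys_in W" "\<And>i. i \<in> W \<Longrightarrow> \<sigma> i \<in> polys_in V"
  shows "eval_at mconst \<sigma> f \<in> polys_in V"
  using assms unfolding eval_at_def mono_eval_def
  by (intro polys_in_sum polys_in_mult polys_in_prod polys_in_power) (auto dest: polys_inD)

text \<open>Constants and variables generate all polynomials. Most identities between substitutions
  below are checked through this on variables alone, instead of by induction on polynomials.\<close>

lemma hom_eq_on_polys_in:
  fixes F G :: "'a::comm_ring_1 mpoly \<Rightarrow> 'b::comm_ring_1"
  assumes "comm_ring_hom F" "comm_ring_hom G"
    and "f \<in> polys_in V"
    and "\<And>c. F (mconst c) = G (mconst c)" "\<And>i. i \<in> V \<Longrightarrow> F (mvar i) = G (mvar i)"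
  shows "F f = G f"
proof -
  interpret F: comm_ring_hom F by fact
  interpret G: comm_ring_hom G by fact
  have "F f = F (eval_at mconst mvar f)" by (simp add: eval_at_mvar_self)
  also have "\<dots> = G (eval_at mconst mvar f)"
    unfolding eval_at_def mono_eval_def F.hom_sum G.hom_sum F.hom_mult G.hom_mult F.hom_prod G.hom_prod
      F.hom_power G.hom_power assms(4)
    using assms(3,5) by (intro sum.cong arg_cong2[of _ _ _ _ "(*)"] prod.cong) (auto dest: polys_inD)
  finally show ?thesis by (simp add: eval_at_mvar_self)
qed

lemmas hom_eq = hom_eq_on_polys_in[OF _ _ polys_in_UNIV]

lemma comm_ring_homI:
  assumes "F 0 = 0" "F 1 = 1" "\<And>x y. F (x + y) = F x + F y" "\<And>x y. F (x * y) = F x * F y"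
  shows "comm_ring_hom F"
  by unfold_locales (use assms in auto)

lemma comm_ring_hom_comp:
  assumes "comm_ring_hom f" "comm_ring_hom g" shows "comm_ring_hom (\<lambda>x. f (g x))"
proof -
  interpret f: comm_ring_hom f by fact
  interpret g: comm_ring_hom g by fact
  show ?thesis
    by (rule comm_ring_homI) (simp_all add: f.hom_add g.hom_add f.hom_mult g.hom_mult)
qed

lemma eval_at_cong_polys_in:
  assumes "f \<in> polys_in V" "\<And>i. i \<in> V \<Longrightarrow> \<sigma> i = \<tau> i"
  shows "eval_at \<phi> \<sigma> f = eval_at \<phi> \<tau> f"
  using assms unfolding eval_at_def mono_eval_def
  by (intro sum.cong arg_cong2[of _ _ _ _ "(*)"] prod.cong) (auto dest: polys_inD)

lemma substitute_hom: "comm_ring_hom (substitute \<sigma>)"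
  unfolding substitute_eq_eval_at by (rule comm_ring_hom_eval_at[OF mconst_hom])

interpretation mconst: comm_ring_hom "mconst :: 'a::comm_ring_1 \<Rightarrow> 'a mpoly"
  by (rule mconst_hom)

interpretation substitute: comm_ring_hom "substitute \<sigma>" for \<sigma> :: "nat \<Rightarrow> 'a::comm_ring_1 mpoly"
  by (rule substitute_hom)

lemma substitute_mconst [simp]: "substitute \<sigma> (mconst c) = mconst c"
  and substitute_mvar [simp]: "substitute \<sigma> (mvar i) = \<sigma> i"
  by (simp_all add: substitute_eq_eval_at mconst_hom)

lemma substitute_in_polys_in:
  "f \<in> polys_in W \<Longrightarrow> (\<And>i. i \<in> W \<Longrightarrow> \<sigma> i \<in> polys_in V) \<Longrightarrow> substitute \<sigma> f \<in> polys_in V"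
  unfolding substitute_eq_eval_at by (rule eval_at_in_polys_in)

lemma substitute_cong:
  "f \<in> polys_in V \<Longrightarrow> (\<And>i. i \<in> V \<Longrightarrow> \<sigma> i = \<tau> i) \<Longrightarrow> substitute \<sigma> f = substitute \<tau> f"
  unfolding substitute_eq_eval_at by (rule eval_at_cong_polys_in)

lemma substitute_substitute:
  "substitute \<sigma> (substitute \<tau> f) = substitute (\<lambda>i. substitute \<sigma> (\<tau> i)) f"
  by (rule hom_eq[where f = f]) (auto intro: comm_ring_hom_comp substitute_hom)

lemma substitute_id: "(\<And>i. i \<in> V \<Longrightarrow> \<sigma> i = mvar i) \<Longrightarrow> f \<in> polys_in V \<Longrightarrow> substitute \<sigma> f = f"
  using substitute_cong[of f V \<sigma> mvar] by (simp add: substitute_eq_eval_at eval_at_mvar_self)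

lemma mconst_eq_iff [simp]: "mconst c = mconst d \<longleftrightarrow> c = d"
  unfolding mconst_def by (metis lookup_single_eq)

lemma mconst_eq_0_iff [simp]: "mconst c = 0 \<longleftrightarrow> c = 0"
  unfolding mconst_def by (metis lookup_single_eq lookup_zero single_zero)

lemma mvar_neq_0 [simp]: "(mvar i :: 'a::zero_neq_one mpoly) \<noteq> 0"
  unfolding mvar_def by (metis lookup_single_eq lookup_zero zero_neq_one)

lemma mconst_sum_mvar_eq_iff:
  assumes "finite I" "(\<Sum>j\<in>I. mconst (a j) * mvar j) = (\<Sum>j\<in>I. mconst (b j) * (mvar j :: 'a::comm_ring_1 mpoly))"
    and "i \<in> I"
  shows "a i = b i"
proof -
  have *: "Poly_Mapping.lookup (\<Sum>j\<in>I. mconst (c j) * (mvar j :: 'a mpoly)) (Poly_Mapping.single i 1) = c i" for c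
  proof -
    have "Poly_Mapping.lookup (mconst (c j) * (mvar j :: 'a mpoly)) (Poly_Mapping.single i 1) =
        (if j = i then c i else 0)" for j
    proof (cases "j = i")
      case False
      then have "Poly_Mapping.single j (1::nat) \<noteq> Poly_Mapping.single i 1"
        by (metis lookup_single_eq lookup_single_not_eq zero_neq_one)
      with False show ?thesis by (simp add: mconst_def mvar_def mult_single lookup_single)
    qed (simp add: mconst_def mvar_def mult_single)
    then show ?thesis using assms(1,3) by (simp add: lookup_sum)
  qed
  from assms(2) show ?thesis using *[of a] *[of b] by simp
qed

subsection \<open>Polynomials as univariate polynomials in one variable\<close>

text \<open>The coefficients keep the type \<open>'a mpoly\<close>; that variable i is absent from
  them is the content of \<open>coeff_as_poly_in_polys_in\<close>.\<close>

definition as_poly :: "nat \<Rightarrow> 'a::comm_ring_1 mpoly \<Rightarrow> 'a mpoly poly" where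
  "as_poly i = eval_at (\<lambda>c. [:mconst c:]) (\<lambda>j. if j = i then [:0, 1:] else [:mvar j:])"

interpretation as_poly: comm_ring_hom "as_poly i :: 'a::comm_ring_1 mpoly \<Rightarrow> 'a mpoly poly" for i
  unfolding as_poly_def by (rule comm_ring_hom_eval_at[OF mconst_poly_hom])

lemma as_poly_mconst [simp]: "as_poly i (mconst c) = [:mconst c:]"
  and as_poly_mvar: "as_poly i (mvar j) = (if j = i then [:0, 1:] else [:mvar j:])"
  by (simp_all add: as_poly_def mconst_poly_hom)

lemma poly_hom: "comm_ring_hom (\<lambda>p. poly p (x :: 'a::comm_ring_1))"
  by (rule comm_ring_homI) auto

lemma map_poly_hom:
  assumes "comm_ring_hom F" shows "comm_ring_hom (map_poly F)"
proof -
  interpret F: comm_ring_hom F by fact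
  interpret F': map_poly_comm_ring_hom F ..
  show ?thesis by (rule F'.comm_ring_hom_axioms)
qed

lemma poly_map_poly_hom:
  "comm_ring_hom F \<Longrightarrow> comm_ring_hom (\<lambda>p. poly (map_poly F p) (x :: 'a::comm_ring_1))"
  by (rule comm_ring_hom_comp[OF poly_hom map_poly_hom])

lemma pcompose_hom: "comm_ring_hom (\<lambda>p. pcompose p (x :: 'a::comm_ring_1 poly))"
  by (rule comm_ring_homI) (auto simp: pcompose_add pcompose_mult pcompose_1)

lemma poly_map_poly_as_poly:
  "poly (map_poly (substitute \<sigma>) (as_poly i f)) x = substitute (\<sigma>(i := x)) f"
  by (rule hom_eq[where f = f])
    (auto intro!: comm_ring_hom_comp[OF poly_map_poly_hom] substitute_hom as_poly.comm_ring_hom_axioms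
      simp: as_poly_mvar Polynomial.map_poly_pCons substitute.hom_zero substitute.hom_one)

lemma poly_as_poly: "poly (as_poly i f) x = substitute (mvar(i := x)) f"
  by (rule hom_eq[where f = f])
    (auto intro!: comm_ring_hom_comp[OF poly_hom] substitute_hom as_poly.comm_ring_hom_axioms
      simp: as_poly_mvar)

lemma poly_as_poly_self [simp]: "poly (as_poly i f) (mvar i) = f"
  unfolding poly_as_poly by (rule substitute_id[of UNIV]) auto

lemma as_poly_eq_iff: "as_poly i f = as_poly i g \<longleftrightarrow> f = g"
  by (metis poly_as_poly_self)

lemma as_poly_const: "f \<in> polys_in V \<Longrightarrow> i \<notin> V \<Longrightarrow> as_poly i f = [:f:]"
  by (rule hom_eq_on_polys_in[where V = V])
    (auto simp: as_poly_mvar intro!: comm_ring_homI as_poly.comm_ring_hom_axioms)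

lemma coeff_as_poly_in_polys_in:
  assumes "f \<in> polys_in V" shows "coeff (as_poly i f) k \<in> polys_in (V - {i})"
proof -
  let ?C = "{p :: 'a mpoly poly. \<forall>k. coeff p k \<in> polys_in (V - {i})}"
  have mult: "p * q \<in> ?C" if "p \<in> ?C" "q \<in> ?C" for p q
    using that by (auto simp: coeff_mult intro!: polys_in_sum polys_in_mult)
  have one: "1 \<in> ?C" by (auto simp: coeff_1)
  have power: "p ^ n \<in> ?C" if "p \<in> ?C" for p n
    using that by (induction n) (use one mult in auto)
  have prod: "(\<Prod>j\<in>J. h j) \<in> ?C" if "\<And>j. j \<in> J \<Longrightarrow> h j \<in> ?C" for J and h :: "nat \<Rightarrow> 'a mpoly poly"
    using that by (induction J rule: infinite_finite_induct) (use one mult in auto)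
  have const: "[:a:] \<in> ?C" if "a \<in> polys_in (V - {i})" for a :: "'a mpoly"
    using that by (auto simp: coeff_pCons split: nat.splits)
  have X: "coeff [:0, 1:] k \<in> polys_in (V - {i})" for k by (auto simp: coeff_pCons split: nat.splits)
  have "[:mconst c:] * mono_eval (\<lambda>j. if j = i then [:0, 1:] else [:mvar j:]) t \<in> ?C"
    if "t \<in> Poly_Mapping.keys f" for t c
    unfolding mono_eval_def
    using that assms by (intro mult const prod power) (auto simp: X intro!: const[simplified] dest: polys_inD)
  then have "as_poly i f \<in> ?C"
    unfolding as_poly_def eval_at_def by (auto simp: coeff_sum intro!: polys_in_sum)
  then show ?thesis by blast
qed

text \<open>Zero is a root of \<open>as_poly i f\<close>, so X divides it; evaluating the quotient
  at the variable gives the cofactor.\<close>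

lemma dvd_mvarI:
  assumes "substitute (mvar(i := 0)) f = 0" shows "\<exists>g. f = mvar i * g"
proof -
  have "[:0, 1:] dvd as_poly i f"
    using assms unfolding poly_as_poly[symmetric] by (metis poly_eq_0_iff_dvd minus_zero)
  then obtain p where "as_poly i f = [:0, 1:] * p" by (elim dvdE)
  then have "poly (as_poly i f) (mvar i) = poly ([:0, 1:] * p) (mvar i)" by simp
  then show ?thesis by auto
qed

text \<open>Multiplication by a variable moves the monomials injectively and keeps their
  coefficients, so nothing cancels. This keeps quotients by z in the right variables.\<close>

lemma mvar_mult_in_polys_in:
  assumes "mvar i * f \<in> polys_in V" shows "(f :: 'a::comm_ring_1 mpoly) \<in> polys_in V"
  unfolding polys_in_def
proof (intro CollectI ballI)
  fix t assume t: "t \<in> Poly_Mapping.keys f"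
  have *: "Poly_Mapping.lookup (mvar i * f) (Poly_Mapping.single i 1 + t) = Poly_Mapping.lookup f t"
  proof -
    have "mvar i * f = (\<Sum>s\<in>Poly_Mapping.keys f. Poly_Mapping.single (Poly_Mapping.single i 1 + s) (Poly_Mapping.lookup f s))"
      by (subst (1) poly_mapping_sum_single[of f, symmetric])
        (simp add: mvar_def sum_distrib_left mult_single)
    then show ?thesis using t by (simp add: lookup_sum lookup_single when_def)
  qed
  then have "Poly_Mapping.single i 1 + t \<in> Poly_Mapping.keys (mvar i * f)"
    using t by (simp add: in_keys_iff)
  then have "Poly_Mapping.keys (Poly_Mapping.single i 1 + t) \<subseteq> V"
    using assms unfolding polys_in_def by blast
  then show "Poly_Mapping.keys t \<subseteq> V"
    by (auto simp: subset_iff in_keys_iff lookup_add)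
qed

subsection \<open>The grading\<close>

text \<open>Every variable is scaled by a new indeterminate T; the coefficient of T^d is then the
  homogeneous component of degree d.\<close>

definition graded :: "'a::comm_ring_1 mpoly \<Rightarrow> 'a mpoly poly" where
  "graded = eval_at (\<lambda>c. [:mconst c:]) (\<lambda>j. [:0, mvar j:])"

interpretation graded: comm_ring_hom "graded :: 'a::comm_ring_1 mpoly \<Rightarrow> 'a mpoly poly"
  unfolding graded_def by (rule comm_ring_hom_eval_at[OF mconst_poly_hom])

lemma graded_mconst [simp]: "graded (mconst c) = [:mconst c:]"
  and graded_mvar [simp]: "graded (mvar j) = [:0, mvar j:]"
  by (simp_all add: graded_def mconst_poly_hom)

lemma poly_graded_1 [simp]: "poly (graded f) 1 = f"
  by (rule hom_eq[where f = f])
    (auto intro!: comm_ring_hom_comp[OF poly_hom] graded.comm_ring_hom_axioms comm_ring_homI)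

definition homogeneous_of :: "nat \<Rightarrow> 'a::comm_ring_1 mpoly \<Rightarrow> bool" where
  "homogeneous_of d f \<longleftrightarrow> graded f = monom f d"

definition component :: "nat \<Rightarrow> 'a::comm_ring_1 mpoly \<Rightarrow> 'a mpoly" where
  "component d f = coeff (graded f) d"

lemma homogeneous_of_mconst: "homogeneous_of 0 (mconst c)"
  by (simp add: homogeneous_of_def monom_0)

lemma homogeneous_of_mvar: "homogeneous_of 1 (mvar i)"
  by (simp add: homogeneous_of_def monom_altdef)

lemma homogeneous_of_0: "homogeneous_of d 0"
  by (simp add: homogeneous_of_def)

lemma homogeneous_of_1: "homogeneous_of 0 1"
  by (simp add: homogeneous_of_def)

lemma homogeneous_of_add: "homogeneous_of d f \<Longrightarrow> homogeneous_of d g \<Longrightarrow> homogeneous_of d (f + g)"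
  by (simp add: homogeneous_of_def graded.hom_add add_monom)

lemma homogeneous_of_diff: "homogeneous_of d f \<Longrightarrow> homogeneous_of d g \<Longrightarrow> homogeneous_of d (f - g)"
  by (simp add: homogeneous_of_def graded.hom_minus diff_monom)

lemma homogeneous_of_sum:
  "(\<And>i. i \<in> I \<Longrightarrow> homogeneous_of d (f i)) \<Longrightarrow> homogeneous_of d (\<Sum>i\<in>I. f i)"
  by (induction I rule: infinite_finite_induct) (auto intro: homogeneous_of_0 homogeneous_of_add)

lemma homogeneous_of_mult:
  "homogeneous_of d f \<Longrightarrow> homogeneous_of d' g \<Longrightarrow> homogeneous_of (d + d') (f * g)"
  by (simp add: homogeneous_of_def graded.hom_mult mult_monom)

lemma homogeneous_of_power: "homogeneous_of d f \<Longrightarrow> homogeneous_of (k * d) (f ^ k)"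
  by (simp add: homogeneous_of_def graded.hom_power monom_power mult.commute)

lemma homogeneous_of_prod:
  "(\<And>i. i \<in> I \<Longrightarrow> homogeneous_of (d i) (f i)) \<Longrightarrow> homogeneous_of (\<Sum>i\<in>I. d i) (\<Prod>i\<in>I. f i)"
  by (induction I rule: infinite_finite_induct) (auto intro: homogeneous_of_1 homogeneous_of_mult)

lemma sum_component: "(\<Sum>d\<le>degree (graded f). component d f) = f"
  using poly_graded_1[of f] by (simp add: poly_altdef component_def)

lemma component_homogeneous: "homogeneous_of d f \<Longrightarrow> component k f = (if k = d then f else 0)"
  by (simp add: component_def homogeneous_of_def)

lemma component_add: "component d (f + g) = component d f + component d g"
  by (simp add: component_def graded.hom_add)

lemma component_sum: "component d (\<Sum>i\<in>I. f i) = (\<Sum>i\<in>I. component d (f i))"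
  by (simp add: component_def graded.hom_sum coeff_sum)

lemma component_mult: "component d (f * g) = (\<Sum>i\<le>d. component i f * component (d - i) g)"
  by (simp add: component_def graded.hom_mult coeff_mult)

lemma component_mult_homogeneous:
  assumes "homogeneous_of k g"
  shows "component d (f * g) = (if k \<le> d then component (d - k) f * g else 0)"
proof -
  have "component d (f * g) = (\<Sum>i\<le>d. if i = d - k \<and> k \<le> d then component i f * g else 0)"
    unfolding component_mult component_homogeneous[OF assms]
    by (rule sum.cong) auto
  then show ?thesis by simp
qed

text \<open>Scaling by T and then by U is scaling by TU. Comparing coefficients of T^d gives
  \<open>graded (component d f)\<close> on one side and U^d times the component on the
  other.\<close>

lemma homogeneous_component: "homogeneous_of d (component d f)"
proof -
  let ?h = "\<lambda>f. map_poly graded (graded f)"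
  have "map_poly graded (graded f) = (\<lambda>f. map_poly (\<lambda>a. [:a:]) (graded f) \<circ>\<^sub>p [:0, [:0, 1:]:]) f"
  proof (rule hom_eq[where f = f])
    show "comm_ring_hom (\<lambda>f :: 'a mpoly. map_poly graded (graded f))"
      by (rule comm_ring_hom_comp[OF map_poly_hom]) (rule graded.comm_ring_hom_axioms)+
    have "comm_ring_hom (\<lambda>a :: 'a mpoly. [:a:])" by (rule comm_ring_homI) auto
    then show "comm_ring_hom (\<lambda>f :: 'a mpoly. map_poly (\<lambda>a. [:a:]) (graded f) \<circ>\<^sub>p [:0, [:0, 1:]:])"
      by (intro comm_ring_hom_comp[OF pcompose_hom] comm_ring_hom_comp[OF map_poly_hom] graded.comm_ring_hom_axioms)
  qed (auto simp: Polynomial.map_poly_pCons pcompose_pCons)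
  then have "coeff (map_poly graded (graded f)) d = coeff (map_poly (\<lambda>a. [:a:]) (graded f) \<circ>\<^sub>p [:0, [:0, 1:]:]) d"
    by simp
  moreover have "[:0, [:0, 1:]:] = monom (monom 1 1 :: 'a mpoly poly) 1"
    by (simp add: monom_altdef)
  moreover have "coeff (p \<circ>\<^sub>p monom c 1) d = coeff p d * c ^ d" for p :: "'a mpoly poly poly" and c
    unfolding monom_altdef
    by (induction p arbitrary: d) (auto simp: pcompose_pCons coeff_pCons split: nat.splits)
  ultimately show ?thesis
    by (simp add: homogeneous_of_def component_def coeff_map_poly monom_power smult_monom)
qed

section \<open>The Frobenius endomorphism over a finite field\<close>

lemma power_card_eq_self:
  fixes x :: "'a::{field,finite}"
  shows "x ^ CARD('a) = x"
proof (cases "x = 0")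
  case False
  let ?U = "UNIV - {0 :: 'a}"
  have "bij_betw (\<lambda>y. x * y) ?U ?U"
    by (rule bij_betwI[of _ _ _ "\<lambda>y. y / x"]) (use False in auto)
  then have "\<Prod>?U = (\<Prod>y\<in>?U. x * y)"
    using prod.reindex_bij_betw[of "\<lambda>y. x * y" ?U ?U "\<lambda>y. y"] by simp
  also have "\<dots> = x ^ card ?U * \<Prod>?U" by (simp add: prod.distrib)
  finally have "x ^ card ?U * \<Prod>?U = 1 * \<Prod>?U" by (simp only: mult_1)
  then have *: "x ^ card ?U = 1"
    by (subst (asm) mult_cancel_right) auto
  have "CARD('a) = Suc (card ?U)"
    by (subst card.remove[of UNIV "0 :: 'a"]) auto
  then have "x ^ CARD('a) = x * x ^ card ?U" by (metis power_Suc)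
  then show ?thesis by (simp only: * mult_1_right)
qed (simp add: zero_power)

lemma power_card_power_eq_self: "(x :: 'a::{field,finite}) ^ (CARD('a) ^ k) = x"
  by (induction k) (simp_all add: power_card_eq_self power_mult)

lemma CHAR_mpoly [simp]: "CHAR('a::comm_ring_1 mpoly) = CHAR('a)"
proof (rule CHAR_eqI)
  have *: "of_nat n = (mconst (of_nat n) :: 'a mpoly)" for n
    by (simp add: mconst_def)
  show "of_nat CHAR('a) = (0 :: 'a mpoly)" by (simp add: *)
  show "CHAR('a) dvd n" if "of_nat n = (0 :: 'a mpoly)" for n
    using that by (simp add: * of_nat_eq_0_iff_char_dvd)
qed

text \<open>\<open>card_power\<close> makes q a power of the characteristic, so that q-th powers are
  additive; \<open>field_type\<close> ties the locale to the type \<open>'a\<close>.\<close>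

locale finite_field_card =
  fixes field_type :: "'a::{field,finite} itself" and q r :: nat
  assumes card_eq: "CARD('a) = q" and card_power: "q = CHAR('a) ^ r"
begin

lemma q_gt_1: "1 < q"
proof -
  have "card {0, 1 :: 'a} \<le> q" unfolding card_eq[symmetric] by (rule card_mono) auto
  then show ?thesis by simp
qed

lemma q_pos [simp]: "0 < q" using q_gt_1 by simp

lemma prime_CHAR: "prime CHAR('a)"
  by (rule prime_CHAR_semidom) (simp add: finite_imp_CHAR_pos)

lemma frobenius_add: "(f + g :: 'a mpoly) ^ (q ^ k) = f ^ (q ^ k) + g ^ (q ^ k)"
  by (rule freshmans_dream'[where n = "r * k"]) (simp_all only: prime_CHAR CHAR_mpoly semiring_char_poly card_power power_mult)

lemma frobenius_poly_add: "(f + g :: 'a mpoly poly) ^ (q ^ k) = f ^ (q ^ k) + g ^ (q ^ k)"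
  by (rule freshmans_dream'[where n = "r * k"]) (simp_all only: prime_CHAR CHAR_mpoly semiring_char_poly card_power power_mult)

lemma frobenius_hom: "comm_ring_hom (\<lambda>f :: 'a mpoly. f ^ (q ^ k))"
  by (rule comm_ring_homI) (simp_all only: frobenius_add power_mult_distrib power_one, simp add: zero_power)

lemma mconst_power_q: "mconst (c :: 'a) ^ (q ^ k) = mconst c"
  unfolding mconst.hom_power[symmetric] card_eq[symmetric] power_card_power_eq_self ..

subsection \<open>The Moore matrix\<close>

text \<open>The polynomial p = sum of g_i T^(q^i) is additive, so it vanishes on the whole F_q-span
  of the n variables. This span has q^n elements, while p has degree at most q^(n-1).\<close>

lemma moore_independent:
  fixes g :: "nat \<Rightarrow> 'a mpoly"
  assumes "\<And>k. k < n \<Longrightarrow> (\<Sum>i<n. g i * mvar k ^ (q ^ i)) = 0" and "i < n"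
  shows "g i = 0"
proof -
  define p where "p = (\<Sum>i<n. monom (g i) (q ^ i))"
  define root where "root a = (\<Sum>k<n. mconst (a k) * (mvar k :: 'a mpoly))" for a :: "nat \<Rightarrow> 'a"
  let ?A = "PiE {..<n} (\<lambda>_. UNIV :: 'a set)"
  have root: "poly p (root a) = 0" for a
  proof -
    have "root a ^ (q ^ i) = (\<Sum>k<n. mconst (a k) * mvar k ^ (q ^ i))" for i
    proof -
      interpret frob: comm_ring_hom "\<lambda>f :: 'a mpoly. f ^ (q ^ i)" by (rule frobenius_hom)
      show ?thesis by (simp add: root_def frob.hom_sum frob.hom_mult mconst_power_q)
    qed
    then have "poly p (root a) = (\<Sum>i<n. \<Sum>k<n. mconst (a k) * (g i * mvar k ^ (q ^ i)))"
      by (simp add: p_def poly_sum poly_monom sum_distrib_left algebra_simps)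
    also have "\<dots> = (\<Sum>k<n. mconst (a k) * (\<Sum>i<n. g i * mvar k ^ (q ^ i)))"
      by (subst sum.swap) (simp add: sum_distrib_left)
    finally show ?thesis using assms(1) by simp
  qed
  have "inj_on root ?A"
  proof (rule inj_onI)
    fix a b assume ab: "a \<in> ?A" "b \<in> ?A" "root a = root b"
    then have "a k = b k" if "k < n" for k
      using mconst_sum_mvar_eq_iff[of "{..<n}" a b k] that by (simp add: root_def)
    then show "a = b" using ab by (intro PiE_ext[of a _ _ b]) auto
  qed
  then have card: "card (root ` ?A) = q ^ n"
    by (simp add: card_image card_PiE card_eq)
  have le: "degree (monom (g i) (q ^ i)) \<le> q ^ (n - 1)" if "i \<in> {..<n}" for i
  proof -
    have "q ^ i \<le> q ^ (n - 1)" by (rule power_increasing) (use that q_gt_1 in auto)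
    then show ?thesis by (rule order_trans[OF degree_monom_le])
  qed
  have "degree p \<le> q ^ (n - 1)"
    unfolding p_def by (rule degree_sum_le) (simp, rule le)
  also have "q ^ (n - 1) < q ^ n"
    by (rule power_strict_increasing) (use assms(2) q_gt_1 in auto)
  finally have deg: "degree p < q ^ n" .
  have "degree (0 :: 'a mpoly poly) < q ^ n" by simp
  with deg have "p = 0"
    unfolding card[symmetric] by (rule poly_eqI_degree[rotated]) (use root in auto)
  then have "0 = coeff p (q ^ i)" by simp
  also have "\<dots> = (\<Sum>j<n. if j = i then g j else 0)"
    unfolding p_def coeff_sum using q_gt_1 by (intro sum.cong) (auto simp: coeff_monom)
  finally show ?thesis using assms(2) by simp
qed

text \<open>Take w as a column of the adjugate of the Moore matrix and L as its determinant, which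
  is nonzero by \<open>moore_independent\<close>. Such a w is a direction annihilated by all rows
  but one.\<close>

lemma moore_dual_vector:
  assumes "i < n"
  obtains w :: "nat \<Rightarrow> 'a mpoly" and L where "L \<noteq> 0"
    and "\<And>j. j < n \<Longrightarrow> (\<Sum>k<n. w k * mvar k ^ (q ^ j)) = (if j = i then L else 0)"
proof -
  define M :: "'a mpoly mat" where "M = mat n n (\<lambda>(j, k). mvar k ^ (q ^ j))"
  have M: "M \<in> carrier_mat n n" by (simp add: M_def)
  have "det M \<noteq> 0"
  proof
    assume "det M = 0"
    then have "det M\<^sup>T = 0" using M by (simp add: det_transpose)
    then obtain g where g: "g \<in> carrier_vec n" "g \<noteq> 0\<^sub>v n" "M\<^sup>T *\<^sub>v g = 0\<^sub>v n"
      using det_0_iff_vec_prod_zero[of "M\<^sup>T" n] M by auto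
    have "(\<Sum>i<n. g $ i * mvar k ^ (q ^ i)) = 0" if "k < n" for k
    proof -
      have "(M\<^sup>T *\<^sub>v g) $ k = (\<Sum>i<n. g $ i * mvar k ^ (q ^ i))"
        using that g(1) by (simp add: M_def scalar_prod_def lessThan_atLeast0 mult.commute)
      with g(3) that show ?thesis by simp
    qed
    then have "g $ i = 0" if "i < n" for i
      by (rule moore_independent[where g = "\<lambda>i. g $ i"]) (use that in auto)
    then have "g = 0\<^sub>v n" using g(1) by (intro eq_vecI) auto
    with g(2) show False by simp
  qed
  moreover have "(\<Sum>k<n. adj_mat M $$ (k, i) * mvar k ^ (q ^ j)) = (if j = i then det M else 0)"
    if "j < n" for j
  proof -
    have "(M * adj_mat M) $$ (j, i) = (det M \<cdot>\<^sub>m 1\<^sub>m n) $$ (j, i)"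
      using adj_mat(2)[OF M] by simp
    moreover have "(M * adj_mat M) $$ (j, i) = (\<Sum>k<n. adj_mat M $$ (k, i) * mvar k ^ (q ^ j))"
      using that assms adj_mat(1)[OF M] M
      by (auto simp: scalar_prod_def lessThan_atLeast0 mult.commute M_def intro!: sum.cong)
    ultimately show ?thesis using that assms by simp
  qed
  ultimately show ?thesis by (rule that)
qed

subsection \<open>Truncated substitution\<close>

text \<open>Recentre at a: if p is nonzero, h(T) = p(a + T) vanishes at 0 to an order l <= deg p <
  k. As u has a nonzero constant term, h(T u) vanishes to the same order l, and so is not divisible
  by T^k.\<close>

lemma pcompose_truncated_eq_0:
  fixes p u :: "'b::idom poly"
  assumes "monom 1 k dvd pcompose p ([:a:] + [:0, 1:] * u)" "degree p < k" "coeff u 0 \<noteq> 0"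
  shows "p = 0"
proof (rule ccontr)
  assume "p \<noteq> 0"
  define h where "h = pcompose p [:a, 1:]"
  define l where "l = order 0 h"
  have "h \<noteq> 0" using \<open>p \<noteq> 0\<close> pcompose_eq_0[of p "[:a, 1:]"] by (auto simp: h_def)
  have "l \<le> degree h" unfolding l_def using \<open>h \<noteq> 0\<close> by (rule order_degree)
  also have "\<dots> = degree p" by (simp add: h_def degree_pcompose)
  finally have "l < k" using assms(2) by simp
  obtain h1 where h1: "h = [:0, 1:] ^ l * h1" "\<not> [:0, 1:] dvd h1"
    using order_decomp[OF \<open>h \<noteq> 0\<close>, of 0] by (auto simp: l_def)
  have "pcompose p ([:a:] + [:0, 1:] * u) = pcompose h ([:0, 1:] * u)"
    unfolding h_def by (simp flip: pcompose_assoc add: pcompose_pCons)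
  also have "\<dots> = [:0, 1:] ^ l * (u ^ l * pcompose h1 ([:0, 1:] * u))"
  proof -
    have "pcompose [:0, 1:] v = v" for v :: "'b poly" by (simp add: pcompose_pCons)
    then show ?thesis
      by (simp only: h1(1) pcompose_mult pcompose_hom.hom_power power_mult_distrib mult.assoc)
  qed
  finally have "[:0, 1:] ^ l * [:0, 1:] ^ (k - l) dvd [:0, 1:] ^ l * (u ^ l * pcompose h1 ([:0, 1:] * u))"
    using assms(1) \<open>l < k\<close> by (simp add: monom_altdef flip: power_add)
  then have "[:0, 1:] ^ (k - l) dvd u ^ l * pcompose h1 ([:0, 1:] * u)"
    by (subst (asm) dvd_mult_cancel_left) auto
  moreover have "[:0, 1:] dvd ([:0, 1:] :: 'b poly) ^ (k - l)"
    using \<open>l < k\<close> by (intro dvd_power) auto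
  ultimately have "[:0, 1:] dvd u ^ l * pcompose h1 ([:0, 1:] * u)"
    by (rule dvd_trans[rotated])
  then have "poly (u ^ l * pcompose h1 ([:0, 1:] * u)) 0 = 0"
    by (metis poly_eq_0_iff_dvd minus_zero)
  moreover have "poly (u ^ l * pcompose h1 ([:0, 1:] * u)) 0 = poly u 0 ^ l * poly h1 0"
  proof -
    have "poly ([:0, 1:] * u) 0 = 0" by (simp only: poly_mult poly_pCons) simp
    then show ?thesis by (simp only: poly_mult poly_power poly_pcompose)
  qed
  moreover have "poly u 0 \<noteq> 0" using assms(3) by (simp only: poly_0_coeff_0 not_False_eq_True)
  ultimately have "poly h1 0 = 0" by (simp only: mult_eq_0_iff power_eq_0_iff) blast
  with h1(2) show False by (metis poly_eq_0_iff_dvd minus_zero)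
qed

text \<open>f(x + T w) as a polynomial in T: its linear coefficient is the derivative of f along
  w.\<close>

definition translate :: "(nat \<Rightarrow> 'a mpoly) \<Rightarrow> 'a mpoly \<Rightarrow> 'a mpoly poly" where
  "translate w = eval_at (\<lambda>c. [:mconst c:]) (\<lambda>k. [:mvar k, w k:])"

lemma translate_hom: "comm_ring_hom (translate w)"
  unfolding translate_def by (rule comm_ring_hom_eval_at[OF mconst_poly_hom])

lemma translate_mvar: "translate w (mvar k) = [:mvar k, w k:]"
  by (simp add: translate_def mconst_poly_hom)

lemma coeff_0_translate: "coeff (translate w f) 0 = f"
proof -
  have "poly (translate w f) 0 = f"
    by (rule hom_eq[where f = f])
      (auto intro!: comm_ring_hom_comp[OF poly_hom] translate_hom comm_ring_homI
        simp: translate_mvar, simp add: translate_def mconst_poly_hom)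
  then show ?thesis by (simp add: poly_0_coeff_0)
qed

text \<open>The modulus T^q is a compromise: q-th powers are constant modulo it, and it still
  detects a nonzero relation of degree below q in the form that moves.\<close>

definition trunc_eq :: "'a mpoly poly \<Rightarrow> 'a mpoly poly \<Rightarrow> bool" where
  "trunc_eq a b \<longleftrightarrow> monom 1 q dvd a - b"

lemma trunc_eq_refl [simp]: "trunc_eq a a" by (simp add: trunc_eq_def)

lemma trunc_eq_add:
  assumes "trunc_eq a b" "trunc_eq c d" shows "trunc_eq (a + c) (b + d)"
proof -
  have "a + c - (b + d) = (a - b) + (c - d)" by simp
  then show ?thesis using assms unfolding trunc_eq_def by (simp only: dvd_add)
qed

lemma trunc_eq_mult:
  assumes "trunc_eq a b" "trunc_eq c d" shows "trunc_eq (a * c) (b * d)"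
proof -
  have "a * c - b * d = (a - b) * c + b * (c - d)" by (simp only: left_diff_distrib right_diff_distrib) simp
  then show ?thesis using assms unfolding trunc_eq_def by (simp only: dvd_add dvd_mult dvd_mult2)
qed

lemma trunc_eq_sum: "(\<And>i. i \<in> I \<Longrightarrow> trunc_eq (f i) (g i)) \<Longrightarrow> trunc_eq (\<Sum>i\<in>I. f i) (\<Sum>i\<in>I. g i)"
  by (induction I rule: infinite_finite_induct) (auto intro: trunc_eq_add)

lemma trunc_eq_power: "trunc_eq a b \<Longrightarrow> trunc_eq (a ^ k) (b ^ k)"
  by (induction k) (auto intro: trunc_eq_mult)

lemma trunc_eq_prod: "(\<And>i. i \<in> I \<Longrightarrow> trunc_eq (f i) (g i)) \<Longrightarrow> trunc_eq (\<Prod>i\<in>I. f i) (\<Prod>i\<in>I. g i)"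
  by (induction I rule: infinite_finite_induct) (auto intro: trunc_eq_mult)

text \<open>For p = a + T p', additivity gives p^(q^k) = a^(q^k) + T^(q^k) p'^(q^k), and q <=
  q^k.\<close>

lemma trunc_eq_frobenius:
  assumes "1 \<le> k" shows "trunc_eq (p ^ (q ^ k)) [:coeff p 0 ^ (q ^ k):]"
proof -
  obtain a p' where p: "p = pCons a p'" by (cases p)
  then have p': "p = [:a:] + [:0, 1:] * p'" by simp
  have "p ^ (q ^ k) = [:a:] ^ (q ^ k) + ([:0, 1:] * p') ^ (q ^ k)"
    unfolding p' by (rule frobenius_poly_add)
  then have "p ^ (q ^ k) - [:a ^ (q ^ k):] = [:0, 1:] ^ (q ^ k) * p' ^ (q ^ k)"
    by (simp only: power_mult_distrib poly_const_pow add_diff_cancel_left')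
  moreover have "monom 1 q dvd [:0, 1 :: 'a mpoly:] ^ (q ^ k)"
    using assms q_gt_1 unfolding monom_altdef smult_1_left
    by (intro le_imp_power_dvd) (simp add: self_le_power)
  ultimately have "monom 1 q dvd p ^ (q ^ k) - [:a ^ (q ^ k):]" by (simp only: dvd_mult2)
  moreover have "coeff p 0 = a" by (simp add: p)
  ultimately show ?thesis unfolding trunc_eq_def by (simp only:)
qed

subsection \<open>The quadratic forms\<close>

text \<open>Position k is paired with position 2m-1-k: y_j stands at m-j and x_j at m+j-1.\<close>

lemma xi_1: "xi m (Suc 0) = (\<Sum>k<m. mvar k * (mvar (2 * m - 1 - k) :: 'a mpoly))"
proof -
  have "xi m (Suc 0) = (\<Sum>k=1..m. Y m k * (X m k :: 'a mpoly))" by (simp add: xi_def)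
  also have "\<dots> = (\<Sum>k<m. mvar k * mvar (2 * m - 1 - k))"
    unfolding Y_def X_def by (rule sum.reindex_bij_witness[of _ "\<lambda>k. m - k" "\<lambda>k. m - k"]) auto
  finally show ?thesis .
qed

lemma xi_ge_2:
  assumes "2 \<le> i"
  shows "xi m i = (\<Sum>k<m. mvar k ^ (q ^ (i - 1)) * (mvar (2 * m - 1 - k) :: 'a mpoly) +
    mvar k * mvar (2 * m - 1 - k) ^ (q ^ (i - 1)))"
proof -
  have "xi m i = (\<Sum>k=1..m. Y m k ^ (q ^ (i - 1)) * (X m k :: 'a mpoly) + Y m k * X m k ^ (q ^ (i - 1)))"
    unfolding xi_def card_eq using assms by simp
  also have "\<dots> = (\<Sum>k<m. mvar k ^ (q ^ (i - 1)) * mvar (2 * m - 1 - k) +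
      mvar k * mvar (2 * m - 1 - k) ^ (q ^ (i - 1)))"
    unfolding Y_def X_def by (rule sum.reindex_bij_witness[of _ "\<lambda>k. m - k" "\<lambda>k. m - k"]) auto
  finally show ?thesis .
qed

lemma sum_pairs: "(\<Sum>k<2 * m. f k) = (\<Sum>k<m. f k + f (2 * m - 1 - k) :: 'b::comm_monoid_add)" for m :: nat
proof -
  have "{..<2 * m} = {..<m} \<union> {m..<2 * m}" by auto
  then have "(\<Sum>k<2 * m. f k) = (\<Sum>k<m. f k) + (\<Sum>k\<in>{m..<2 * m}. f k)"
    by (simp add: sum.union_disjoint ivl_disj_int)
  also have "(\<Sum>k\<in>{m..<2 * m}. f k) = (\<Sum>k<m. f (2 * m - 1 - k))"
    by (rule sum.reindex_bij_witness[of _ "\<lambda>k. 2 * m - 1 - k" "\<lambda>k. 2 * m - 1 - k"]) auto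
  finally show ?thesis by (simp add: sum.distrib)
qed

text \<open>For i >= 2 each product has a factor that is a power with exponent at least q, constant
  modulo T^q; what remains is affine in T. The form for i = 1 also has a term in T^2, so only its
  slope is recorded. The reversal in \<open>w'\<close> reflects that the derivative of a pairing
  with respect to a variable is the paired variable.\<close>

lemma translate_xi:
  fixes w :: "nat \<Rightarrow> 'a mpoly" and m :: nat
  defines "w' \<equiv> \<lambda>k. w (2 * m - 1 - k)"
  defines "L \<equiv> \<lambda>i. \<Sum>k<2 * m. w' k * mvar k ^ (q ^ (i - 1))"
  shows "2 \<le> i \<Longrightarrow> trunc_eq (translate w (xi m i)) [:xi m i, L i:]"
    and "\<exists>u. translate w (xi m (Suc 0)) = [:xi m (Suc 0):] + [:0, 1:] * u \<and> coeff u 0 = L (Suc 0)"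
proof -
  interpret translate: comm_ring_hom "translate w" by (rule translate_hom)
  let ?d = "\<lambda>k. 2 * m - 1 - k"
  have dd: "?d (?d k) = k" if "k < m" for k using that by auto
  show "trunc_eq (translate w (xi m i)) [:xi m i, L i:]" if i: "2 \<le> i"
  proof -
    let ?Q = "q ^ (i - 1)"
    have "translate w (xi m i) = (\<Sum>k<m. [:mvar k, w k:] ^ ?Q * [:mvar (?d k), w (?d k):] +
        [:mvar k, w k:] * [:mvar (?d k), w (?d k):] ^ ?Q)"
      by (simp add: xi_ge_2[OF i] translate.hom_sum translate.hom_add translate.hom_mult
          translate.hom_power translate_mvar)
    moreover have "trunc_eq \<dots> (\<Sum>k<m. [:mvar k ^ ?Q:] * [:mvar (?d k), w (?d k):] +
        [:mvar k, w k:] * [:mvar (?d k) ^ ?Q:])"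
      using i by (intro trunc_eq_sum trunc_eq_add trunc_eq_mult trunc_eq_refl
          trunc_eq_frobenius[where p = "[:a, b:]" for a b, simplified]) auto
    moreover have "(\<Sum>k<m. [:mvar k ^ ?Q:] * [:mvar (?d k), w (?d k):] +
        [:mvar k, w k:] * [:mvar (?d k) ^ ?Q:]) = [:xi m i, L i:]"
    proof -
      have sum_pCons: "(\<Sum>k\<in>K. [:f k, g k:]) = [:\<Sum>k\<in>K. f k, \<Sum>k\<in>K. g k:]"
        for K :: "nat set" and f g :: "nat \<Rightarrow> 'a mpoly"
        by (induction K rule: infinite_finite_induct) auto
      have "L i = (\<Sum>k<m. w (?d k) * mvar k ^ ?Q + w k * mvar (?d k) ^ ?Q)"
        unfolding L_def w'_def sum_pairs by (rule sum.cong) (auto simp: dd)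
      then show ?thesis
        by (simp add: sum_pCons xi_ge_2[OF i] mult.commute)
    qed
    ultimately show ?thesis by simp
  qed
  show "\<exists>u. translate w (xi m (Suc 0)) = [:xi m (Suc 0):] + [:0, 1:] * u \<and> coeff u 0 = L (Suc 0)"
  proof -
    let ?p = "translate w (xi m (Suc 0))"
    obtain a u where u: "?p = pCons a u" by (cases ?p)
    have "a = xi m (Suc 0)" using coeff_0_translate[of w "xi m (Suc 0)"] u by simp
    moreover have "coeff ?p 1 = L (Suc 0)"
    proof -
      have "?p = (\<Sum>k<m. [:mvar k, w k:] * [:mvar (?d k), w (?d k):])"
        by (simp add: xi_1 translate.hom_sum translate.hom_mult translate_mvar)
      then have "coeff ?p 1 = (\<Sum>k<m. coeff ([:mvar k, w k:] * [:mvar (?d k), w (?d k):]) 1)"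
        by (simp only: coeff_sum)
      also have "\<dots> = (\<Sum>k<m. w (?d k) * mvar k + w k * mvar (?d k))"
        by (rule sum.cong) (auto simp: algebra_simps)
      also have "\<dots> = L (Suc 0)"
        unfolding L_def w'_def sum_pairs by (rule sum.cong) (auto simp: dd)
      finally show ?thesis .
    qed
    ultimately show ?thesis using u by auto
  qed
qed

text \<open>The differentials of the quadratic forms are the rows of the Moore matrix. Along a direction
  orthogonal to all later rows only one of the forms moves, and \<open>q\<close>-th powers are constant modulo
  \<open>X\<^sup>q\<close>, so the forms can be eliminated one after the other.\<close>
lemma xi_monomials_independent:
  fixes f :: "(nat \<Rightarrow> nat) \<Rightarrow> 'a mpoly"
  assumes "t \<le> 2 * m"
    and "(\<Sum>c\<in>PiE {t<..2 * m} (\<lambda>_. {..<q}). f c ^ q * (\<Prod>j\<in>{t<..2 * m}. xi m j ^ c j)) = 0"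
    and "c \<in> PiE {t<..2 * m} (\<lambda>_. {..<q})"
  shows "f c = 0"
  using assms
\<comment> \<open>The forms are eliminated from the smallest index upward: the step removes
  \<open>xi m (Suc t)\<close> from a relation whose other forms have larger index. So the form with
  index 1 never occurs among those that must stay fixed.\<close>
proof (induction t arbitrary: f c rule: inc_induct)
  case base
  then show ?case by simp
next
  case (step t)
  define I where "I = {Suc t<..2 * m}"
  have I: "{t<..2 * m} = insert (Suc t) I" "Suc t \<notin> I" "finite I"
    using step.hyps by (auto simp: I_def)
  let ?E = "PiE I (\<lambda>_. {..<q})"
  \<comment> \<open>The relation is collected by powers of \<open>xi m (Suc t)\<close>;
    \<open>g j\<close> is the coefficient of the j-th power.\<close>
  define g where "g j = (\<Sum>c\<in>?E. f (c(Suc t := j)) ^ q * (\<Prod>i\<in>I. xi m i ^ c i))" for j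
  have upd: "(\<Prod>i\<in>I. xi m i ^ (c(Suc t := j)) i) = (\<Prod>i\<in>I. (xi m i :: 'a mpoly) ^ c i)" for c j
    using I(2) by (intro prod.cong) auto
  have "(\<Sum>j<q. g j * xi m (Suc t) ^ j) =
      (\<Sum>(j, c)\<in>{..<q} \<times> ?E. f (c(Suc t := j)) ^ q * (\<Prod>i\<in>insert (Suc t) I. xi m i ^ (c(Suc t := j)) i))"
    unfolding g_def sum_distrib_right sum.cartesian_product[symmetric]
    unfolding prod.insert[OF I(3,2)] upd by (intro sum.cong refl) (simp add: mult_ac)
  also have "\<dots> = (\<Sum>c\<in>PiE (insert (Suc t) I) (\<lambda>_. {..<q}). f c ^ q * (\<Prod>j\<in>insert (Suc t) I. xi m j ^ c j))"
    unfolding PiE_insert_eq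
    by (subst sum.reindex) (use inj_combinator[OF I(2)] in \<open>auto simp: case_prod_unfold\<close>)
  finally have rel: "(\<Sum>j<q. g j * xi m (Suc t) ^ j) = 0"
    using step.prems(1) by (simp add: I(1))
  have "t < 2 * m" using step.hyps by simp
  from moore_dual_vector[OF this] obtain w L where L: "(L :: 'a mpoly) \<noteq> 0"
    and w: "\<And>j. j < 2 * m \<Longrightarrow> (\<Sum>k<2 * m. w k * mvar k ^ (q ^ j)) = (if j = t then L else 0)"
    by blast
  \<comment> \<open>\<open>translate_xi\<close> pairs the direction with the variables in reverse
    order, so the dual vector is reversed.\<close>
  define v where "v k = w (2 * m - 1 - k)" for k
  have v: "(\<Sum>k<2 * m. v (2 * m - 1 - k) * mvar k ^ (q ^ j)) = (if j = t then L else 0)" if "j < 2 * m" for j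
    using w[OF that] by (simp add: v_def)
  interpret translate: comm_ring_hom "translate v" by (rule translate_hom)
  have xi_I: "trunc_eq (translate v (xi m i)) [:xi m i:]" if "i \<in> I" for i
  proof -
    have "i - 1 \<noteq> t" "2 \<le> i" "i - 1 < 2 * m" using that by (auto simp: I_def)
    then show ?thesis using translate_xi(1)[of i v m] v[of "i - 1"] by simp
  qed
  have g: "trunc_eq (translate v (g j)) [:g j:]" for j
  proof -
    have c: "[:g j:] = (\<Sum>c\<in>?E. [:f (c(Suc t := j)):] ^ q * (\<Prod>i\<in>I. [:xi m i:] ^ c i))"
    proof -
      interpret c: comm_ring_hom "\<lambda>a :: 'a mpoly. [:a:]" by (rule comm_ring_homI) auto
      show ?thesis by (simp add: g_def c.hom_sum c.hom_mult c.hom_power c.hom_prod)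
    qed
    have "trunc_eq (translate v (h ^ q)) ([:h:] ^ q)" for h
      using trunc_eq_frobenius[of 1 "translate v h"]
      by (simp add: translate.hom_power coeff_0_translate poly_const_pow)
    then show ?thesis
      unfolding c unfolding g_def translate.hom_sum translate.hom_mult translate.hom_prod
      by (intro trunc_eq_sum trunc_eq_mult trunc_eq_prod)
        (use xi_I in \<open>auto simp: translate.hom_power intro!: trunc_eq_power\<close>)
  qed
  \<comment> \<open>For t = 0 this is the form with the quadratic term. It is enough that u has the
    nonzero constant term L, as \<open>pcompose_truncated_eq_0\<close> allows any such u.\<close>
  obtain u where u: "trunc_eq (translate v (xi m (Suc t))) ([:xi m (Suc t):] + [:0, 1:] * u)" "coeff u 0 = L"
  proof (cases "t = 0")
    case True
    from translate_xi(2)[of v m] obtain u where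
      u: "translate v (xi m (Suc 0)) = [:xi m (Suc 0):] + [:0, 1:] * u"
        "coeff u 0 = (\<Sum>k<2 * m. v (2 * m - 1 - k) * mvar k ^ (q ^ (Suc 0 - 1)))"
      by blast
    have L': "coeff u 0 = L" using u(2) v[of 0] True step.hyps by simp
    show ?thesis
      by (rule that[OF _ L']) (simp only: True u(1) trunc_eq_refl)
  next
    case False
    then show ?thesis
      using translate_xi(1)[of "Suc t" v m] v[of t] step.hyps that[of "[:L:]"] by auto
  qed
  define p where "p = (\<Sum>j<q. monom (g j) j)"
  have "trunc_eq 0 (pcompose p ([:xi m (Suc t):] + [:0, 1:] * u))"
  proof -
    have "0 = translate v (\<Sum>j<q. g j * xi m (Suc t) ^ j)" by (simp add: rel)
    also have "\<dots> = (\<Sum>j<q. translate v (g j) * translate v (xi m (Suc t)) ^ j)"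
      by (simp add: translate.hom_sum translate.hom_mult translate.hom_power)
    also have "trunc_eq \<dots> (\<Sum>j<q. [:g j:] * ([:xi m (Suc t):] + [:0, 1:] * u) ^ j)"
      by (intro trunc_eq_sum trunc_eq_mult trunc_eq_power g u)
    also have "(\<Sum>j<q. [:g j:] * ([:xi m (Suc t):] + [:0, 1:] * u) ^ j) =
        pcompose p ([:xi m (Suc t):] + [:0, 1:] * u)"
      unfolding p_def pcompose_hom.hom_sum monom_altdef
      by (simp add: pcompose_smult pcompose_hom.hom_power pcompose_pCons)
    finally show ?thesis .
  qed
  moreover have "degree p < q"
    unfolding p_def by (rule degree_sum_less) (auto intro: le_less_trans[OF degree_monom_le])
  ultimately have "p = 0"
    using u(2) L pcompose_truncated_eq_0[of q p "xi m (Suc t)" u] by (simp add: trunc_eq_def)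
  have "g j = 0" if "j < q" for j
  proof -
    have "coeff p j = (\<Sum>i<q. if i = j then g i else 0)"
      unfolding p_def coeff_sum by (intro sum.cong) (auto simp: coeff_monom)
    with \<open>p = 0\<close> that show ?thesis by simp
  qed
  moreover have c: "c (Suc t) < q" "restrict c I \<in> ?E"
    using step.prems(2) by (auto simp: I(1))
  ultimately have gz: "g (c (Suc t)) = 0" by simp
  have "f ((restrict c I)(Suc t := c (Suc t))) = 0"
    by (rule step.IH[of "\<lambda>d. f (d(Suc t := c (Suc t)))" "restrict c I"])
      (use gz c(2) in \<open>simp_all only: g_def I_def\<close>)
  moreover have "(restrict c I)(Suc t := c (Suc t)) = c"
    using step.prems(2) by (intro ext) (auto simp: I(1) PiE_def extensional_def)
  ultimately show ?case by simp
qed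

section \<open>Translations by multiples of a polynomial\<close>

text \<open>T^q - z^(q-1) T, the additive polynomial whose roots are the F_q-multiples of z.\<close>

definition shifted_power :: "'a mpoly \<Rightarrow> 'a mpoly poly" where
  "shifted_power z = monom 1 q - monom (z ^ (q - 1)) 1"

text \<open>Both sides are monic of degree q and vanish at the q multiples of z.\<close>

lemma shifted_power_eq_prod:
  assumes "z \<noteq> 0"
  shows "shifted_power z = (\<Prod>c\<in>(UNIV :: 'a set). [:mconst c * z, 1:])"
proof (rule poly_eqI_degree_lead_coeff)
  let ?p = "\<Prod>c\<in>(UNIV :: 'a set). [:mconst c * z, 1:]"
  have deg: "degree ?p = q"
    by (subst degree_prod_eq_sum_degree) (auto simp: card_eq)
  have "lead_coeff ?p = 1" by (simp add: lead_coeff_prod)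
  then show "coeff (shifted_power z) q = coeff ?p q"
    using q_gt_1 by (simp add: shifted_power_def deg)
  show "degree ?p \<le> q" by (simp add: deg)
  show "degree (shifted_power z) \<le> q"
    unfolding shifted_power_def using q_gt_1
    by (intro degree_diff_le order_trans[OF degree_monom_le]) auto
  have "inj (\<lambda>c :: 'a. mconst c * z)" using assms by (auto intro: injI)
  then show "q \<le> card (range (\<lambda>c :: 'a. mconst c * z))" by (simp add: card_image card_eq)
  fix y assume "y \<in> range (\<lambda>c :: 'a. mconst c * z)"
  then obtain c :: 'a where y: "y = mconst c * z" by auto
  have "poly [:mconst (- c) * z, 1:] y = 0"
    by (simp add: y mconst.hom_uminus)
  then have "poly ?p y = 0" unfolding poly_prod by (auto intro!: prod_zero)
  moreover have "z ^ q = z ^ (q - 1) * z" using q_gt_1 by (simp flip: power_Suc2)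
  then have "poly (shifted_power z) y = 0"
    using mconst_power_q[of c 1]
    by (simp add: shifted_power_def y poly_monom power_mult_distrib)
  ultimately show "poly (shifted_power z) y = poly ?p y" by simp
qed

lemma prod_translates:
  "(\<Prod>c\<in>(UNIV :: 'a set). v + mconst c * z) = v ^ q - v * (z :: 'a mpoly) ^ (q - 1)"
proof (cases "z = 0")
  case True
  then show ?thesis using q_gt_1 by (simp add: card_eq zero_power)
next
  case False
  have "(\<Prod>c\<in>(UNIV :: 'a set). v + mconst c * z) = poly (\<Prod>c\<in>(UNIV :: 'a set). [:mconst c * z, 1:]) v"
    by (simp add: poly_prod add.commute)
  then show ?thesis
    unfolding shifted_power_eq_prod[OF False, symmetric]
    by (simp add: shifted_power_def poly_monom mult.commute)
qed

lemma prod_linear_dvd: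
  fixes p :: "'b::idom poly"
  assumes "finite A" "\<And>a. a \<in> A \<Longrightarrow> poly p a = 0"
  shows "(\<Prod>a\<in>A. [:- a, 1:]) dvd p"
  using assms
proof (induction A rule: finite_induct)
  case (insert a A)
  then obtain p' where p': "p = (\<Prod>a\<in>A. [:- a, 1:]) * p'" by (auto elim!: dvdE)
  have "poly (\<Prod>a\<in>A. [:- a, 1:]) a \<noteq> 0"
    using insert.hyps by (auto simp: poly_prod)
  then have "[:- a, 1:] dvd p'"
    using insert.prems[of a] by (simp add: p' poly_eq_0_iff_dvd[symmetric])
  then show ?case
    unfolding p' prod.insert[OF insert.hyps] by (subst (2) mult.commute) (rule mult_dvd_mono, simp_all)
qed simp

text \<open>Invariance gives p(c z) = p(0) for all c, so p - p(0) is divisible by the product of the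
  corresponding linear factors. The quotient is invariant because that product is.\<close>

lemma translation_invariant_polyE:
  fixes p :: "'a mpoly poly"
  assumes "z \<noteq> 0" and inv: "\<And>c :: 'a. pcompose p [:mconst c * z, 1:] = p"
  obtains p' where "p = [:coeff p 0:] + shifted_power z * p'"
    and "\<And>c :: 'a. pcompose p' [:mconst c * z, 1:] = p'"
    and "p' \<noteq> 0 \<Longrightarrow> degree p' < degree p"
proof -
  have sp: "shifted_power z \<noteq> 0"
    unfolding shifted_power_eq_prod[OF assms(1)] by simp
  have root: "poly (p - [:coeff p 0:]) (mconst c * z) = 0" for c :: 'a
  proof -
    have "poly (pcompose p [:mconst c * z, 1:]) 0 = poly p (mconst c * z)" by (simp add: poly_pcompose)
    then show ?thesis by (simp add: inv poly_0_coeff_0)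
  qed
  have inj: "inj (\<lambda>c :: 'a. mconst c * z)" using assms(1) by (auto intro: injI)
  have "(\<Prod>a\<in>range (\<lambda>c :: 'a. mconst c * z). [:- a, 1:]) = (\<Prod>c\<in>(UNIV :: 'a set). [:- (mconst c * z), 1:])"
    by (simp add: prod.reindex[OF inj])
  also have "\<dots> = (\<Prod>c\<in>(UNIV :: 'a set). [:mconst c * z, 1:])"
    by (rule prod.reindex_bij_witness[of _ uminus uminus]) (auto simp: mconst.hom_uminus)
  finally have "shifted_power z dvd p - [:coeff p 0:]"
    using prod_linear_dvd[of "range (\<lambda>c :: 'a. mconst c * z)" "p - [:coeff p 0:]"] root
    by (auto simp: shifted_power_eq_prod[OF assms(1)])
  then obtain p' where p': "p - [:coeff p 0:] = shifted_power z * p'" by (elim dvdE)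
  show thesis
  proof (rule that[of p'])
    show eq: "p = [:coeff p 0:] + shifted_power z * p'" using p' by (simp add: algebra_simps)
    show "pcompose p' [:mconst c * z, 1:] = p'" for c :: 'a
    proof -
      have "pcompose (shifted_power z) [:mconst c * z, 1:] = (\<Prod>d\<in>(UNIV :: 'a set). [:mconst (c + d) * z, 1:])"
        unfolding shifted_power_eq_prod[OF assms(1)] pcompose_hom.hom_prod
        by (simp add: pcompose_pCons mconst.hom_add algebra_simps)
      also have "\<dots> = shifted_power z"
        unfolding shifted_power_eq_prod[OF assms(1)]
        by (rule prod.reindex_bij_witness[of _ "\<lambda>d. d - c" "\<lambda>d. c + d"]) auto
      finally have "shifted_power z * pcompose p' [:mconst c * z, 1:] = shifted_power z * p'"
        unfolding p'[symmetric] using inv[of c] p'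
        by (metis pcompose_const pcompose_diff pcompose_mult)
      then show ?thesis using sp by simp
    qed
    show "degree p' < degree p" if "p' \<noteq> 0"
    proof -
      have deg: "degree (shifted_power z) = q"
        unfolding shifted_power_eq_prod[OF assms(1)]
        by (subst degree_prod_eq_sum_degree) (auto simp: card_eq)
      have "degree (shifted_power z * p') = q + degree p'"
        using sp that by (simp add: degree_mult_eq deg)
      moreover have "degree (p - [:coeff p 0:]) \<le> degree p"
        by (rule degree_diff_le) auto
      ultimately show ?thesis using q_gt_1 by (simp add: p')
    qed
  qed
qed

end

section \<open>The unipotent group\<close>

definition unitriangular :: "nat \<Rightarrow> 'a::comm_ring_1 mat \<Rightarrow> bool" where
  "unitriangular n g \<longleftrightarrow> g \<in> carrier_mat n n \<and> upper_triangular g \<and> (\<forall>i<n. g $$ (i, i) = 1)"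

lemma unitriangular_invertible:
  assumes "unitriangular n g" shows "invertible_mat g"
proof -
  have g: "g \<in> carrier_mat n n" and ut: "upper_triangular g" and d: "\<And>i. i < n \<Longrightarrow> g $$ (i, i) = 1"
    using assms by (auto simp: unitriangular_def)
  have "diag_mat g = map (\<lambda>i. 1) [0..<n]"
    using g d by (auto simp: diag_mat_def)
  then have "det g = 1"
    using det_upper_triangular[OF ut g] by (simp add: map_replicate_const)
  then have "g * adj_mat g = 1\<^sub>m n" "adj_mat g * g = 1\<^sub>m n" "adj_mat g \<in> carrier_mat n n"
    using adj_mat[OF g] by (auto simp: smult_mat_def)
  then show ?thesis
    using g unfolding invertible_mat_def inverts_mat_def by (auto intro!: exI[of _ "adj_mat g"])
qed

lemma mat_mult_entry:
  "g \<in> carrier_mat n n \<Longrightarrow> h \<in> carrier_mat n n \<Longrightarrow> i < n \<Longrightarrow> j < n \<Longrightarrow>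
    (g * h) $$ (i, j) = (\<Sum>k<n. g $$ (i, k) * h $$ (k, j))"
  by (auto simp: scalar_prod_def lessThan_atLeast0 intro!: sum.cong)

lemma unitriangular_mult:
  assumes "unitriangular n g" "unitriangular n h" shows "unitriangular n (g * h)"
proof -
  have g: "g \<in> carrier_mat n n" "\<And>i j. j < i \<Longrightarrow> i < n \<Longrightarrow> g $$ (i, j) = 0" "\<And>i. i < n \<Longrightarrow> g $$ (i, i) = 1"
    and h: "h \<in> carrier_mat n n" "\<And>i j. j < i \<Longrightarrow> i < n \<Longrightarrow> h $$ (i, j) = 0" "\<And>i. i < n \<Longrightarrow> h $$ (i, i) = 1"
    using assms by (auto simp: unitriangular_def upper_triangular_def)
  have "(g * h) $$ (i, j) = 0" if "j < i" "i < n" for i j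
  proof -
    have "g $$ (i, k) * h $$ (k, j) = 0" if "k < n" for k
      using \<open>j < i\<close> \<open>i < n\<close> that g(2)[of k i] h(2)[of j k] by (cases "k < i") auto
    then show ?thesis using that mat_mult_entry[OF g(1) h(1), of i j] by simp
  qed
  moreover have "(g * h) $$ (i, i) = 1" if "i < n" for i
  proof -
    have "g $$ (i, k) * h $$ (k, i) = (if k = i then 1 else 0)" if "k < n" for k
      using \<open>i < n\<close> that g(2)[of k i] h(2)[of i k] g(3)[of i] h(3)[of i] by (cases k i rule: linorder_cases) auto
    then show ?thesis using that mat_mult_entry[OF g(1) h(1), of i i] by simp
  qed
  ultimately show ?thesis
    using g(1) h(1) unfolding unitriangular_def upper_triangular_def by auto
qed

definition row_form :: "'a::comm_ring_1 mat \<Rightarrow> nat \<Rightarrow> 'a mpoly" where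
  "row_form g i = (\<Sum>j<dim_col g. mconst (g $$ (i, j)) * mvar j)"

lemma act_eq: "act f g = substitute (row_form g) f"
  unfolding act_def row_form_def[abs_def] ..

lemma act_hom: "comm_ring_hom (\<lambda>f. act f g)"
  unfolding act_eq by (rule substitute_hom)

interpretation act: comm_ring_hom "\<lambda>f :: 'a::comm_ring_1 mpoly. act f g" for g
  by (rule act_hom)

lemma act_mconst [simp]: "act (mconst c) g = mconst c"
  and act_mvar [simp]: "act (mvar i) g = row_form g i"
  by (simp_all add: act_eq)

lemma row_form_in_polys_in: "dim_col g = n \<Longrightarrow> row_form g i \<in> polys_in {..<n}"
  unfolding row_form_def by (intro polys_in_sum polys_in_mult) auto

lemma act_in_S: "g \<in> carrier_mat (2 * m) (2 * m) \<Longrightarrow> f \<in> S m \<Longrightarrow> act f g \<in> S m"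
  unfolding S_eq_polys_in act_eq
  by (erule substitute_in_polys_in) (auto intro!: row_form_in_polys_in)

lemma act_act:
  assumes "g \<in> carrier_mat n n" "h \<in> carrier_mat n n" "f \<in> polys_in {..<n}"
  shows "act (act f g) h = act f (g * h)"
proof -
  have "substitute (row_form h) (row_form g i) = row_form (g * h) i" if "i < n" for i
  proof -
    have "substitute (row_form h) (row_form g i) =
        (\<Sum>j<n. \<Sum>k<n. mconst (g $$ (i, j)) * (mconst (h $$ (j, k)) * mvar k))"
      using assms(1,2) by (simp add: row_form_def[of g] substitute.hom_sum substitute.hom_mult)
        (simp add: row_form_def sum_distrib_left)
    also have "\<dots> = (\<Sum>k<n. \<Sum>j<n. mconst (g $$ (i, j) * h $$ (j, k)) * mvar k)"
      by (subst sum.swap) (simp add: mconst.hom_mult mult.assoc)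
    also have "\<dots> = row_form (g * h) i"
      unfolding row_form_def using assms(1,2) that
      by (simp add: mat_mult_entry mconst.hom_sum sum_distrib_right del: index_mult_mat(1))
    finally show ?thesis .
  qed
  then show ?thesis
    unfolding act_eq substitute_substitute by (intro substitute_cong[OF assms(3)]) auto
qed

lemma act_one: "f \<in> polys_in {..<n} \<Longrightarrow> act f (1\<^sub>m n) = f"
  unfolding act_eq
proof (rule substitute_id)
  fix i assume "i \<in> {..<n}"
  then have "row_form (1\<^sub>m n) i = (\<Sum>j<n. if j = i then mvar j else 0 :: 'a mpoly)"
    unfolding row_form_def by (intro sum.cong) auto
  then show "row_form (1\<^sub>m n) i = (mvar i :: 'a mpoly)" using \<open>i \<in> {..<n}\<close> by simp
qed

lemma act_inj_on:
  assumes "invertible_mat g" "g \<in> carrier_mat n n" shows "inj_on (\<lambda>f. act f g) (polys_in {..<n})"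
proof -
  obtain h where h: "g * h = 1\<^sub>m n" "h * g = 1\<^sub>m (dim_row h)"
    using assms unfolding invertible_mat_def inverts_mat_def by auto
  have "dim_col (g * h) = n" by (simp add: h)
  moreover have "dim_col (h * g) = dim_row h" by (simp add: h)
  ultimately have "h \<in> carrier_mat n n" using assms(2) by auto
  then have "act (act f g) h = f" if "f \<in> polys_in {..<n}" for f
    using act_act[OF assms(2) _ that] act_one[OF that] h(1) by simp
  then show ?thesis by (rule inj_on_inverseI)
qed

lemma P_iff:
  "g \<in> P m \<longleftrightarrow> unitriangular (2 * m) g \<and> act (xi m 1) g = (xi m 1 :: 'a::{field,finite} mpoly)"
  unfolding P_def G_def using unitriangular_invertible[of "2 * m" g] by (auto simp: unitriangular_def)

context finite_field_card
begin

section \<open>Orthogonality relations in the group and invariance of the forms\<close>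

lemma xi_in_polys_in: "1 \<le> i \<Longrightarrow> xi m i \<in> (polys_in {..<2 * m} :: 'a mpoly set)"
  using xi_1[of m] xi_ge_2[of i m]
  by (cases "i = 1") (auto intro!: polys_in_sum polys_in_add polys_in_mult polys_in_power)

lemma P_carrier: "g \<in> P m \<Longrightarrow> g \<in> carrier_mat (2 * m) (2 * m)"
  by (simp add: P_iff unitriangular_def)

lemma P_mult:
  assumes "g \<in> P m" "h \<in> (P m :: 'a mat set)" shows "g * h \<in> P m"
  using assms act_act[of g "2 * m" h "xi m 1"] xi_in_polys_in[of 1 m]
  unfolding P_iff by (auto simp: unitriangular_mult unitriangular_def[of _ g] unitriangular_def[of _ h])

text \<open>Evaluated at points of F_q^(2m), invariance of the quadratic form says Q(g a) = Q(a).
  Polarization transfers this to the bilinear form B, and the columns of g are the images of the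
  unit vectors.\<close>

lemma P_orthogonal:
  assumes "g \<in> (P m :: 'a mat set)" "l < 2 * m" "l' < 2 * m"
  shows "(\<Sum>i<2 * m. g $$ (i, l) * g $$ (2 * m - 1 - i, l')) = (if l' = 2 * m - 1 - l then 1 else 0)"
proof -
  have id: "comm_ring_hom (\<lambda>c :: 'a. c)" by (rule comm_ring_homI) auto
  define ev where "ev a = eval_at (\<lambda>c :: 'a. c) a" for a :: "nat \<Rightarrow> 'a"
  have ev: "comm_ring_hom (ev a)" for a
    unfolding ev_def by (rule comm_ring_hom_eval_at[OF id])
  interpret ev: comm_ring_hom "ev a" for a by (rule ev)
  have ev_mvar: "ev a (mvar i) = a i" and ev_mconst: "ev a (mconst c) = c" for a i c
    by (simp_all add: ev_def id)
  define gv where "gv a i = (\<Sum>j<2 * m. g $$ (i, j) * a j)" for a :: "nat \<Rightarrow> 'a" and i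
  define Q where "Q a = (\<Sum>k<m. a k * a (2 * m - 1 - k))" for a :: "nat \<Rightarrow> 'a"
  define B where "B a b = (\<Sum>k<2 * m. a k * b (2 * m - 1 - k))" for a b :: "nat \<Rightarrow> 'a"
  have "dim_col g = 2 * m" using P_carrier[OF assms(1)] by simp
  then have "ev a (act f g) = ev (gv a) f" for a f
    by (rule_tac hom_eq[OF comm_ring_hom_comp[OF ev act_hom] ev])
      (simp_all add: ev_mvar ev_mconst row_form_def ev.hom_sum ev.hom_mult gv_def)
  moreover have "ev a (xi m 1) = Q a" for a
    by (simp add: xi_1 ev.hom_sum ev.hom_mult ev_mvar Q_def)
  moreover have "act (xi m 1) g = xi m 1" using assms(1) by (simp add: P_iff)
  ultimately have Q: "Q (gv a) = Q a" for a by metis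
  have "B a b = Q (\<lambda>k. a k + b k) - Q a - Q b" for a b
  proof -
    have "B a b = (\<Sum>k<m. a k * b (2 * m - 1 - k) + a (2 * m - 1 - k) * b k)"
      unfolding B_def sum_pairs by (intro sum.cong) auto
    then show ?thesis
      by (simp add: Q_def algebra_simps sum.distrib)
  qed
  moreover have "gv (\<lambda>k. a k + b k) = (\<lambda>k. gv a k + gv b k)" for a b
    by (rule ext) (simp add: gv_def algebra_simps sum.distrib)
  ultimately have B: "B (gv a) (gv b) = B a b" for a b
    using Q[of "\<lambda>k. a k + b k"] by (simp add: Q)
  let ?e = "\<lambda>l k. if k = l then 1 else 0 :: 'a"
  have "gv (?e l) = (\<lambda>i. g $$ (i, l))" if "l < 2 * m" for l
    using that by (intro ext) (simp add: gv_def if_distrib cong: if_cong)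
  then have "B (gv (?e l)) (gv (?e l')) = (\<Sum>i<2 * m. g $$ (i, l) * g $$ (2 * m - 1 - i, l'))"
    using assms(2,3) by (simp add: B_def)
  moreover have "B (?e l) (?e l') = (\<Sum>k<2 * m. if k = l then (if l' = 2 * m - 1 - l then 1 else 0) else 0)"
    unfolding B_def by (intro sum.cong) auto
  ultimately show ?thesis using assms(2) by (simp add: B)
qed

text \<open>The column relations say that the reflection of g in the antidiagonal is a left inverse
  of g. For square matrices it is then a right inverse, which gives the relations between
  rows.\<close>

lemma P_orthogonal_rows:
  assumes "g \<in> (P m :: 'a mat set)" "i < 2 * m" "j < 2 * m"
  shows "(\<Sum>k<2 * m. g $$ (i, k) * g $$ (j, 2 * m - 1 - k)) = (if j = 2 * m - 1 - i then 1 else 0)"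
proof -
  define h where "h = mat (2 * m) (2 * m) (\<lambda>(k, i). g $$ (2 * m - 1 - i, 2 * m - 1 - k))"
  have g: "g \<in> carrier_mat (2 * m) (2 * m)" and h: "h \<in> carrier_mat (2 * m) (2 * m)"
    using assms(1) by (auto simp: P_carrier h_def)
  have "h * g = 1\<^sub>m (2 * m)"
  proof (rule eq_matI)
    fix k l assume "k < dim_row (1\<^sub>m (2 * m))" "l < dim_col (1\<^sub>m (2 * m))"
    then have kl: "k < 2 * m" "l < 2 * m" by auto
    have "(h * g) $$ (k, l) = (\<Sum>i<2 * m. g $$ (2 * m - 1 - i, 2 * m - 1 - k) * g $$ (i, l))"
      using kl mat_mult_entry[OF h g kl] by (simp add: h_def)
    also have "\<dots> = (\<Sum>i<2 * m. g $$ (i, l) * g $$ (2 * m - 1 - i, 2 * m - 1 - k))"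
      by (simp add: mult.commute)
    also have "\<dots> = 1\<^sub>m (2 * m) $$ (k, l)"
      using kl P_orthogonal[OF assms(1), of l "2 * m - 1 - k"] by auto
    finally show "(h * g) $$ (k, l) = 1\<^sub>m (2 * m) $$ (k, l)" .
  qed (use g h in auto)
  then have "g * h = 1\<^sub>m (2 * m)" by (rule mat_mult_left_right_inverse[OF h g])
  then have "(g * h) $$ (i, 2 * m - 1 - j) = 1\<^sub>m (2 * m) $$ (i, 2 * m - 1 - j)" by simp
  moreover have "(g * h) $$ (i, 2 * m - 1 - j) = (\<Sum>k<2 * m. g $$ (i, k) * g $$ (j, 2 * m - 1 - k))"
    using assms(2,3) mat_mult_entry[OF g h, of i "2 * m - 1 - j"] by (simp add: h_def)
  moreover have "1\<^sub>m (2 * m) $$ (i, 2 * m - 1 - j) = (if j = 2 * m - 1 - i then 1 else 0 :: 'a)"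
    using assms(2,3) by auto
  ultimately show ?thesis by simp
qed

lemma xi_ge_2_full:
  assumes "2 \<le> i"
  shows "xi m i = (\<Sum>k<2 * m. mvar k ^ (q ^ (i - 1)) * (mvar (2 * m - 1 - k) :: 'a mpoly))"
  unfolding xi_ge_2[OF assms] sum_pairs by (intro sum.cong) (auto simp: mult.commute)

lemma row_form_frobenius:
  "row_form g i ^ (q ^ k) = (\<Sum>j<dim_col g. mconst (g $$ (i, j)) * (mvar j :: 'a mpoly) ^ (q ^ k))"
proof -
  interpret frob: comm_ring_hom "\<lambda>f :: 'a mpoly. f ^ (q ^ k)" by (rule frobenius_hom)
  show ?thesis by (simp add: row_form_def frob.hom_sum frob.hom_mult mconst_power_q)
qed

text \<open>For i >= 2 the form is a bilinear pairing of x^Q with x, where Q = q^(i-1). The entries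
  of g lie in F_q, so g commutes with the Q-th power, and it suffices that g preserves the
  pairing.\<close>

lemma act_xi:
  assumes "g \<in> (P m :: 'a mat set)" "1 \<le> i"
  shows "act (xi m i) g = xi m i"
proof (cases "i = 1")
  case False
  then have i: "2 \<le> i" using assms(2) by simp
  have [simp]: "dim_col g = 2 * m" using P_carrier[OF assms(1)] by simp
  let ?n = "2 * m" and ?Q = "q ^ (i - 1)"
  have "act (xi m i) g = (\<Sum>k<?n. row_form g k ^ ?Q * row_form g (?n - 1 - k))"
    by (simp add: xi_ge_2_full[OF i] act.hom_sum act.hom_mult act.hom_power)
  also have "\<dots> = (\<Sum>k<?n. \<Sum>l<?n. \<Sum>l'<?n.
      mconst (g $$ (k, l) * g $$ (?n - 1 - k, l')) * (mvar l ^ ?Q * mvar l'))"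
    unfolding row_form_frobenius unfolding row_form_def sum_product
    by (simp add: mconst.hom_mult mult_ac)
  also have "\<dots> = (\<Sum>k<?n. \<Sum>l'<?n. \<Sum>l<?n.
      mconst (g $$ (k, l) * g $$ (?n - 1 - k, l')) * (mvar l ^ ?Q * mvar l'))"
    by (rule sum.cong[OF refl]) (rule sum.swap)
  also have "\<dots> = (\<Sum>l'<?n. \<Sum>l<?n. \<Sum>k<?n.
      mconst (g $$ (k, l) * g $$ (?n - 1 - k, l')) * (mvar l ^ ?Q * mvar l'))"
    by (rule trans[OF sum.swap]) (rule sum.cong[OF refl], rule sum.swap)
  also have "\<dots> = (\<Sum>l'<?n. \<Sum>l<?n.
      mconst (\<Sum>k<?n. g $$ (k, l) * g $$ (?n - 1 - k, l')) * (mvar l ^ ?Q * mvar l'))"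
    by (simp only: mconst.hom_sum sum_distrib_right)
  also have "\<dots> = (\<Sum>l'<?n. \<Sum>l<?n. if l' = ?n - 1 - l then mvar l ^ ?Q * mvar l' else 0)"
    by (intro sum.cong refl) (simp only: lessThan_iff P_orthogonal[OF assms(1)], simp)
  also have "\<dots> = (\<Sum>l<?n. \<Sum>l'<?n. if l' = ?n - 1 - l then mvar l ^ ?Q * mvar l' else 0)"
    by (rule sum.swap)
  also have "\<dots> = xi m i"
    unfolding xi_ge_2_full[OF i] by (intro sum.cong refl) auto
  finally show ?thesis .
qed (use assms in \<open>simp add: P_iff\<close>)

subsection \<open>Orbits\<close>

lemma finite_orbit:
  assumes "i < 2 * m" shows "finite (act (mvar i) ` (P m :: 'a mat set))"
proof (rule finite_subset)
  show "finite ((\<lambda>a :: nat \<Rightarrow> 'a. \<Sum>j<2 * m. mconst (a j) * mvar j) ` PiE {..<2 * m} (\<lambda>_. UNIV))"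
    by (intro finite_imageI finite_PiE) auto
  show "act (mvar i) ` P m \<subseteq> (\<lambda>a :: nat \<Rightarrow> 'a. \<Sum>j<2 * m. mconst (a j) * mvar j) ` PiE {..<2 * m} (\<lambda>_. UNIV)"
  proof
    fix x assume "x \<in> act (mvar i) ` (P m :: 'a mat set)"
    then obtain g where g: "g \<in> P m" "x = row_form g i" by auto
    have "x = (\<Sum>j<2 * m. mconst (restrict (\<lambda>j. g $$ (i, j)) {..<2 * m} j) * mvar j)"
      using P_carrier[OF g(1)] by (simp add: g(2) row_form_def)
    then show "x \<in> (\<lambda>a. \<Sum>j<2 * m. mconst (a j) * mvar j) ` PiE {..<2 * m} (\<lambda>_. UNIV)"
      by (intro image_eqI[where x = "restrict (\<lambda>j. g $$ (i, j)) {..<2 * m}"]) auto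
  qed
qed

lemma orbit_in_polys_in: "i < 2 * m \<Longrightarrow> x \<in> act (mvar i) ` (P m :: 'a mat set) \<Longrightarrow> x \<in> polys_in {..<2 * m}"
  using row_form_in_polys_in[where n = "2 * m" and 'a = 'a] P_carrier[of _ m] by auto

text \<open>The action of g is injective and maps the finite orbit into itself, so it permutes the
  factors.\<close>

lemma act_N:
  assumes "i < 2 * m" "g \<in> (P m :: 'a mat set)" shows "act (N m (mvar i)) g = N m (mvar i)"
proof -
  let ?O = "act (mvar i) ` (P m :: 'a mat set)"
  have "inj_on (\<lambda>f. act f g) (polys_in {..<2 * m})"
    using assms(2) P_carrier[of g m] unitriangular_invertible[of "2 * m" g]
    by (intro act_inj_on) (auto simp: P_iff)
  then have inj: "inj_on (\<lambda>f. act f g) ?O"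
    by (rule inj_on_subset) (use orbit_in_polys_in[OF assms(1)] in blast)
  have "(\<lambda>f. act f g) ` ?O \<subseteq> ?O"
  proof
    fix x assume "x \<in> (\<lambda>f. act f g) ` ?O"
    then obtain h where h: "h \<in> P m" "x = act (act (mvar i) h) g" by blast
    then have "x = act (mvar i) (h * g)"
      using act_act[of h "2 * m" g "mvar i"] assms P_carrier[of _ m] by auto
    then show "x \<in> ?O" using P_mult[OF h(1) assms(2)] by blast
  qed
  then have img: "(\<lambda>f. act f g) ` ?O = ?O"
    using endo_inj_surj[OF finite_orbit[OF assms(1)] _ inj] by blast
  have "act (N m (mvar i)) g = (\<Prod>x\<in>?O. act x g)"
    by (simp only: N_def act.hom_prod)
  also have "\<dots> = \<Prod>((\<lambda>f. act f g) ` ?O)"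
    by (simp only: prod.reindex[OF inj] comp_def)
  finally show ?thesis unfolding img by (simp add: N_def)
qed

lemma N_in_polys_in: "i < 2 * m \<Longrightarrow> N m (mvar i) \<in> (polys_in {..<2 * m} :: 'a mpoly set)"
  unfolding N_def using orbit_in_polys_in by (intro polys_in_prod) auto

lemma H0_eq: "H0 m = (\<lambda>i. N m (mvar i :: 'a mpoly)) ` {..<2 * m}"
proof -
  have "{..<2 * m} = (\<lambda>k. m - k) ` {1..m} \<union> (\<lambda>k. m + k - 1) ` {1..m}"
  proof (intro equalityI subsetI)
    fix i assume "i \<in> {..<2 * m}"
    then have "i = m - (m - i) \<and> m - i \<in> {1..m} \<or> i = m + (i + 1 - m) - 1 \<and> i + 1 - m \<in> {1..m}" by auto
    then show "i \<in> (\<lambda>k. m - k) ` {1..m} \<union> (\<lambda>k. m + k - 1) ` {1..m}" by blast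
  qed auto
  then show ?thesis
    unfolding H0_def Y_def X_def by (simp add: image_Un image_image)
qed

end

section \<open>Passing from rank m to rank m + 1\<close>

text \<open>In rank \<open>Suc m\<close> the variables \<open>0\<close> and \<open>2 * m + 1\<close> are \<open>y\<^bsub>m+1\<^esub>\<close> and \<open>x\<^bsub>m+1\<^esub>\<close>, and variable \<open>i\<close> of
  rank \<open>m\<close> becomes variable \<open>Suc i\<close>.\<close>

definition shift :: "'a::comm_ring_1 mpoly \<Rightarrow> 'a mpoly" where
  "shift = substitute (\<lambda>i. mvar (Suc i))"

abbreviation last_var :: "nat \<Rightarrow> 'a::comm_ring_1 mpoly" where
  "last_var m \<equiv> mvar (Suc (2 * m))"

text \<open>The quotient by z, identified with the polynomials in y over the ring of rank m; this is
  why the remaining variables are renumbered.\<close>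

definition reduce :: "nat \<Rightarrow> 'a::comm_ring_1 mpoly \<Rightarrow> 'a mpoly poly" where
  "reduce m = eval_at (\<lambda>c. [:mconst c:])
    (\<lambda>i. if i = 0 then [:0, 1:] else if i = Suc (2 * m) then 0 else [:mvar (i - 1):])"

interpretation shift: comm_ring_hom "shift :: 'a::comm_ring_1 mpoly \<Rightarrow> 'a mpoly"
  unfolding shift_def by (rule substitute_hom)

interpretation reduce: comm_ring_hom "reduce m :: 'a::comm_ring_1 mpoly \<Rightarrow> 'a mpoly poly" for m
  unfolding reduce_def by (rule comm_ring_hom_eval_at[OF mconst_poly_hom])

lemma shift_mvar [simp]: "shift (mvar i) = mvar (Suc i)"
  and shift_mconst [simp]: "shift (mconst c) = mconst c"
  by (simp_all add: shift_def)

lemma reduce_mconst [simp]: "reduce m (mconst c) = [:mconst c:]"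
  and reduce_mvar: "reduce m (mvar i) =
    (if i = 0 then [:0, 1:] else if i = Suc (2 * m) then 0 else [:mvar (i - 1):])"
  by (simp_all add: reduce_def mconst_poly_hom)

lemma shift_in_polys_in: "f \<in> polys_in {..<n} \<Longrightarrow> shift f \<in> polys_in {1..n}"
  unfolding shift_def by (erule substitute_in_polys_in) auto

lemma const_poly_hom: "comm_ring_hom (\<lambda>a :: 'b::comm_ring_1. [:a:])"
  by (rule comm_ring_homI) auto

lemma reduce_shift:
  assumes "f \<in> polys_in {..<2 * m}" shows "reduce m (shift f) = [:f:]"
  by (rule hom_eq_on_polys_in[OF comm_ring_hom_comp[OF reduce.comm_ring_hom_axioms shift.comm_ring_hom_axioms]
        const_poly_hom assms]) (auto simp: reduce_mvar)

text \<open>Undoing the renumbering and evaluating at y recovers f at z = 0, so f is divisible by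
  z.\<close>

lemma reduce_eq_0E:
  assumes "reduce m f = 0" obtains g where "f = last_var m * g"
proof -
  have "poly (map_poly shift (reduce m f)) (mvar 0) = substitute (mvar(Suc (2 * m) := 0)) f"
    by (rule hom_eq[OF comm_ring_hom_comp[OF poly_map_poly_hom[OF shift.comm_ring_hom_axioms]
            reduce.comm_ring_hom_axioms] substitute_hom])
      (auto simp: reduce_mvar Polynomial.map_poly_pCons)
  then have "substitute (mvar(Suc (2 * m) := 0)) f = 0" using assms by simp
  then show thesis using dvd_mvarI[of "Suc (2 * m)" f] that by blast
qed

context finite_field_card
begin

text \<open>By \<open>prod_translates\<close> a variable, once renumbered to v, is sent to the
  product of all v + c z with c in F_q.\<close>

definition hat :: "nat \<Rightarrow> 'a mpoly \<Rightarrow> 'a mpoly" where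
  "hat m = substitute (\<lambda>i. mvar (Suc i) ^ q - mvar (Suc i) * last_var m ^ (q - 1))"

lemma hat_hom: "comm_ring_hom (hat m)"
  unfolding hat_def by (rule substitute_hom)

lemma hat_mvar [simp]: "hat m (mvar i) = mvar (Suc i) ^ q - mvar (Suc i) * last_var m ^ (q - 1)"
  and hat_mconst [simp]: "hat m (mconst c) = mconst c"
  by (simp_all add: hat_def)

lemma frobenius_hom_1: "comm_ring_hom (\<lambda>f :: 'a mpoly. f ^ q)"
  using frobenius_hom[of 1] by simp

lemma reduce_hat:
  assumes "f \<in> polys_in {..<2 * m}" shows "reduce m (hat m f) = [:f ^ q:]"
proof (rule hom_eq_on_polys_in[OF comm_ring_hom_comp[OF reduce.comm_ring_hom_axioms hat_hom]
        comm_ring_hom_comp[OF const_poly_hom frobenius_hom_1] assms])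
  show "reduce m (hat m (mconst c)) = [:mconst c ^ q:]" for c
    using mconst_power_q[of c 1] by simp
  show "reduce m (hat m (mvar i)) = [:mvar i ^ q:]" if "i \<in> {..<2 * m}" for i
    using that q_gt_1
    by (simp add: reduce.hom_minus reduce.hom_mult reduce.hom_power reduce_mvar poly_const_pow zero_power)
qed

text \<open>The map from v to v^q - v z^(q-1) is F_q-linear, so linear forms are treated like
  variables. Hence \<open>hat\<close> is compatible with the linear actions of rank m.\<close>

lemma hat_linear:
  "hat m (\<Sum>j<n. mconst (a j) * mvar j) =
    shift (\<Sum>j<n. mconst (a j) * mvar j) ^ q - shift (\<Sum>j<n. mconst (a j) * mvar j) * last_var m ^ (q - 1)"
proof -
  interpret hat: comm_ring_hom "hat m" by (rule hat_hom)
  interpret frob: comm_ring_hom "\<lambda>f :: 'a mpoly. f ^ q" by (rule frobenius_hom_1)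
  have "mconst (a j) ^ q = mconst (a j)" for j using mconst_power_q[of "a j" 1] by simp
  then show ?thesis
    by (simp add: hat.hom_sum hat.hom_mult shift.hom_sum shift.hom_mult frob.hom_sum frob.hom_mult
        algebra_simps sum_distrib_left sum_distrib_right sum_subtractf)
qed

lemma hat_row_form:
  "hat m (row_form g i) = shift (row_form g i) ^ q - shift (row_form g i) * last_var m ^ (q - 1)"
  unfolding row_form_def by (rule hat_linear)

lemma hat_in_polys_in: "f \<in> polys_in {..<2 * m} \<Longrightarrow> hat m f \<in> polys_in {1..<2 * Suc m}"
  unfolding hat_def
  by (erule substitute_in_polys_in) (auto intro!: polys_in_diff polys_in_mult polys_in_power)

lemma xi_Suc_ge_2:
  assumes "2 \<le> i"
  shows "xi (Suc m) i = mvar 0 ^ (q ^ (i - 1)) * last_var m + mvar 0 * last_var m ^ (q ^ (i - 1))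
    + shift (xi m i :: 'a mpoly)"
  by (simp add: xi_ge_2[OF assms] sum.lessThan_Suc_shift shift.hom_sum shift.hom_mult shift.hom_add
      shift.hom_power Suc_diff_le del: sum.lessThan_Suc)

text \<open>The cofactor u is made explicit only for i = 1, where the invariance of the quadratic
  form has to be computed.\<close>

lemma xi_Suc:
  assumes "1 \<le> i"
  obtains u where "xi (Suc m) i = shift (xi m i) + last_var m * (u :: 'a mpoly)"
    and "i = 1 \<Longrightarrow> u = mvar 0"
proof (cases "i = 1")
  case True
  have "xi (Suc m) 1 = mvar 0 * last_var m + shift (xi m 1 :: 'a mpoly)"
    by (simp add: xi_1 sum.lessThan_Suc_shift shift.hom_sum shift.hom_mult Suc_diff_le del: sum.lessThan_Suc)
  then show ?thesis using True by (intro that[of "mvar 0"]) (auto simp: mult.commute add.commute)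
next
  case False
  then have i: "2 \<le> i" using assms by simp
  let ?Q = "q ^ (i - 1)"
  have "?Q = Suc (?Q - 1)" using zero_less_power[OF q_pos, of "i - 1"] by linarith
  then have z: "last_var m ^ ?Q = last_var m * (last_var m :: 'a mpoly) ^ (?Q - 1)" by (metis power_Suc)
  have "xi (Suc m) i = mvar 0 ^ ?Q * last_var m + mvar 0 * last_var m ^ ?Q + shift (xi m i :: 'a mpoly)"
    by (rule xi_Suc_ge_2[OF i])
  also have "\<dots> = shift (xi m i) + last_var m * (mvar 0 ^ ?Q + mvar 0 * last_var m ^ (?Q - 1))"
    unfolding z by (simp add: algebra_simps)
  finally show ?thesis using False by (intro that) auto
qed

lemma reduce_xi: "1 \<le> i \<Longrightarrow> reduce m (xi (Suc m) i) = [:xi m i :: 'a mpoly:]"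
  by (rule xi_Suc[of i m])
    (auto simp: reduce.hom_add reduce.hom_mult reduce_mvar reduce_shift xi_in_polys_in)

subsection \<open>Restriction and extension of group elements\<close>

definition inner_block :: "nat \<Rightarrow> 'a mat \<Rightarrow> 'a mat" where
  "inner_block m g = mat (2 * m) (2 * m) (\<lambda>(i, j). g $$ (Suc i, Suc j))"

definition block_extend :: "nat \<Rightarrow> 'a mat \<Rightarrow> 'a mat" where
  "block_extend m g = mat (2 * Suc m) (2 * Suc m)
    (\<lambda>(i, j). if 1 \<le> i \<and> i \<le> 2 * m \<and> 1 \<le> j \<and> j \<le> 2 * m then g $$ (i - 1, j - 1)
      else if i = j then 1 else 0)"

text \<open>A Siegel transformation: the variable in position i + 1 gains c z, and y compensates by
  losing c times the variable paired with it, which stands at 2m - i in rank m+1.\<close>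

definition elementary :: "nat \<Rightarrow> nat \<Rightarrow> 'a \<Rightarrow> 'a mat" where
  "elementary m i c = mat (2 * Suc m) (2 * Suc m)
    (\<lambda>(k, l). if k = l then 1 else if k = Suc i \<and> l = Suc (2 * m) then c
      else if k = 0 \<and> l = 2 * m - i then - c else 0)"

lemma sum_lessThan_split: "(\<Sum>j<2 * Suc m. f j) = f 0 + (\<Sum>j<2 * m. f (Suc j)) + (f (Suc (2 * m)) :: 'b::comm_monoid_add)"
proof -
  have "{..<2 * Suc m} = {..<Suc (Suc (2 * m))}" by auto
  then show ?thesis
    by (simp only: sum.lessThan_Suc[of f "Suc (2 * m)"] sum.lessThan_Suc_shift[of f "2 * m"])
qed

lemma row_form_split:
  assumes "g \<in> carrier_mat (2 * Suc m) (2 * Suc m)"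
  shows "row_form g i = mconst (g $$ (i, 0)) * mvar 0 + (\<Sum>j<2 * m. mconst (g $$ (i, Suc j)) * mvar (Suc j))
    + mconst (g $$ (i, Suc (2 * m))) * (last_var m :: 'a mpoly)"
proof -
  have "dim_col g = 2 * Suc m" using assms by simp
  then show ?thesis unfolding row_form_def by (simp only: sum_lessThan_split)
qed

lemma P_entry:
  assumes "g \<in> (P m :: 'a mat set)" "i < 2 * m"
  shows "g $$ (i, i) = 1" "j < i \<Longrightarrow> g $$ (i, j) = 0"
  using assms P_carrier[OF assms(1)] by (auto simp: P_iff unitriangular_def upper_triangular_def)

lemma act_last_var:
  assumes "g \<in> (P (Suc m) :: 'a mat set)" shows "act (last_var m) g = last_var m"
  using P_entry[OF assms, of "Suc (2 * m)"] row_form_split[OF P_carrier[OF assms], of "Suc (2 * m)"]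
  by simp

lemma act_first_var:
  assumes "g \<in> (P (Suc m) :: 'a mat set)"
  shows "act (mvar 0) g = mvar 0 + ((\<Sum>j<2 * m. mconst (g $$ (0, Suc j)) * mvar (Suc j))
    + mconst (g $$ (0, Suc (2 * m))) * last_var m)"
  using P_entry(1)[OF assms, of 0] row_form_split[OF P_carrier[OF assms], of 0] by simp

lemma act_inner_var:
  assumes "g \<in> (P (Suc m) :: 'a mat set)" "i < 2 * m"
  shows "act (mvar (Suc i)) g = shift (row_form (inner_block m g) i) + mconst (g $$ (Suc i, Suc (2 * m))) * last_var m"
  using assms(2) P_entry(2)[OF assms(1), of "Suc i" 0] row_form_split[OF P_carrier[OF assms(1)], of "Suc i"]
  by (simp add: row_form_def inner_block_def shift.hom_sum shift.hom_mult)

lemma reduce_act_shift: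
  assumes "g \<in> (P (Suc m) :: 'a mat set)" "f \<in> polys_in {..<2 * m}"
  shows "reduce m (act (shift f) g) = [:act f (inner_block m g):]"
proof (rule hom_eq_on_polys_in[OF comm_ring_hom_comp[OF reduce.comm_ring_hom_axioms
        comm_ring_hom_comp[OF act_hom shift.comm_ring_hom_axioms]]
        comm_ring_hom_comp[OF const_poly_hom act_hom] assms(2)])
  fix i assume i: "i \<in> {..<2 * m}"
  have "row_form (inner_block m g) i \<in> polys_in {..<2 * m}"
    by (rule row_form_in_polys_in) (simp add: inner_block_def)
  then show "reduce m (act (shift (mvar i)) g) = [:act (mvar i) (inner_block m g):]"
    using act_inner_var[OF assms(1), of i] i
    by (simp add: reduce.hom_add reduce.hom_mult reduce_shift reduce_mvar)
qed simp

text \<open>Modulo z the quadratic form of rank m+1 is that of rank m, and z is fixed by g.\<close>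

lemma inner_block_in_P:
  assumes "g \<in> (P (Suc m) :: 'a mat set)" shows "inner_block m g \<in> P m"
proof -
  have "[:act (xi m 1) (inner_block m g):] = reduce m (act (shift (xi m 1)) g)"
    by (simp add: reduce_act_shift[OF assms] xi_in_polys_in)
  also have "\<dots> = reduce m (act (xi (Suc m) 1) g)"
    by (rule xi_Suc[of 1 m])
      (simp_all only: act.hom_add act.hom_mult act_last_var[OF assms] reduce.hom_add reduce.hom_mult,
        simp_all add: reduce_mvar)
  also have "\<dots> = [:xi m 1:]"
    using act_xi[OF assms, of 1] reduce_xi[of 1 m] by simp
  finally have "act (xi m 1) (inner_block m g) = xi m 1" by simp
  moreover have "unitriangular (2 * m) (inner_block m g)"
    using P_entry[OF assms] by (auto simp: unitriangular_def upper_triangular_def inner_block_def)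
  ultimately show ?thesis by (simp add: P_iff)
qed

lemma row_form_block_extend:
  shows "row_form (block_extend m g) 0 = mvar 0" "row_form (block_extend m g) (Suc (2 * m)) = last_var m"
    and "i < 2 * m \<Longrightarrow> g \<in> carrier_mat (2 * m) (2 * m) \<Longrightarrow> row_form (block_extend m g) (Suc i) = shift (row_form g i)"
  by (subst row_form_split[of _ m]; auto simp: block_extend_def row_form_def shift.hom_sum shift.hom_mult)+

lemma act_block_extend_shift:
  assumes "g \<in> carrier_mat (2 * m) (2 * m)" "f \<in> polys_in {..<2 * m}"
  shows "act (shift f) (block_extend m g) = shift (act f g)"
  by (rule hom_eq_on_polys_in[OF comm_ring_hom_comp[OF act_hom shift.comm_ring_hom_axioms]
        comm_ring_hom_comp[OF shift.comm_ring_hom_axioms act_hom] assms(2)])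
    (auto simp: row_form_block_extend(3)[OF _ assms(1)])

lemma act_block_extend_hat:
  assumes "g \<in> carrier_mat (2 * m) (2 * m)" "f \<in> polys_in {..<2 * m}"
  shows "act (hat m f) (block_extend m g) = hat m (act f g)"
  by (rule hom_eq_on_polys_in[OF comm_ring_hom_comp[OF act_hom hat_hom]
        comm_ring_hom_comp[OF hat_hom act_hom] assms(2)])
    (auto simp: act.hom_minus act.hom_power act.hom_mult row_form_block_extend(2) row_form_block_extend(3)[OF _ assms(1)] hat_row_form)

lemma block_extend_in_P:
  assumes "g \<in> (P m :: 'a mat set)" shows "block_extend m g \<in> P (Suc m)"
proof -
  have "act (xi (Suc m) 1) (block_extend m g) = xi (Suc m) 1"
  proof (rule xi_Suc[of 1 m])
    fix u :: "'a mpoly" assume u: "xi (Suc m) 1 = shift (xi m 1) + last_var m * u" "1 = (1::nat) \<Longrightarrow> u = mvar 0"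
    have "act (shift (xi m 1)) (block_extend m g) = shift (xi m 1)"
      using act_block_extend_shift[OF P_carrier[OF assms] xi_in_polys_in, of 1] act_xi[OF assms, of 1] by simp
    then show ?thesis
      by (simp only: u(1) u(2)[OF refl] act.hom_add act.hom_mult act_mvar row_form_block_extend)
  qed simp
  moreover have "unitriangular (2 * Suc m) (block_extend m g)"
    using P_entry[OF assms] P_carrier[OF assms]
    by (auto simp: unitriangular_def upper_triangular_def block_extend_def)
  ultimately show ?thesis unfolding P_iff by simp
qed

lemma row_form_elementary:
  assumes "i < 2 * m"
  shows "row_form (elementary m i c) 0 = mvar 0 - mconst c * mvar (2 * m - i)"
    and "row_form (elementary m i c) (Suc (2 * m)) = last_var m"
    and "k < 2 * m \<Longrightarrow> row_form (elementary m i c) (Suc k) =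
      mvar (Suc k) + (if k = i then mconst c * last_var m else 0)"
proof -
  let ?g = "elementary m i c"
  have g: "?g \<in> carrier_mat (2 * Suc m) (2 * Suc m)" by (simp add: elementary_def)
  note s = row_form_split[OF g]
  have "(\<Sum>j<2 * m. mconst (?g $$ (0, Suc j)) * mvar (Suc j)) =
      (\<Sum>j<2 * m. if j = 2 * m - Suc i then - mconst c * mvar (2 * m - i) else 0)"
    using assms by (intro sum.cong) (auto simp: elementary_def mconst.hom_uminus Suc_diff_Suc)
  then show "row_form ?g 0 = mvar 0 - mconst c * mvar (2 * m - i)"
    using assms by (simp add: s) (simp add: elementary_def)
  show "row_form ?g (Suc (2 * m)) = last_var m"
    using assms by (simp add: s) (simp add: elementary_def)
  show "row_form ?g (Suc k) = mvar (Suc k) + (if k = i then mconst c * last_var m else 0)" if "k < 2 * m"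
  proof -
    have "(\<Sum>j<2 * m. mconst (?g $$ (Suc k, Suc j)) * mvar (Suc j)) =
        (\<Sum>j<2 * m. if j = k then mvar (Suc k) else 0 :: 'a mpoly)"
      using that by (intro sum.cong) (auto simp: elementary_def)
    then show ?thesis using that by (simp add: s) (auto simp: elementary_def)
  qed
qed

text \<open>Exactly one pair of the inner form contains the moved variable. It gains c z times the
  partner, which cancels against the change of y z.\<close>

lemma elementary_in_P:
  assumes "i < 2 * m" shows "elementary m i c \<in> P (Suc m)"
proof -
  let ?g = "elementary m i c" and ?z = "last_var m :: 'a mpoly"
  \<comment> \<open>The index below m of the pair that contains i.\<close>
  define k0 where "k0 = (if i < m then i else 2 * m - 1 - i)"
  have "act (shift (xi m 1)) ?g = (\<Sum>k<m. row_form ?g (Suc k) * row_form ?g (Suc (2 * m - 1 - k)))"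
    by (simp add: xi_1 shift.hom_sum shift.hom_mult act.hom_sum act.hom_mult)
  also have "\<dots> = (\<Sum>k<m. mvar (Suc k) * mvar (Suc (2 * m - 1 - k)) +
      (if k = k0 then mconst c * ?z * mvar (2 * m - i) else 0))"
  proof (rule sum.cong[OF refl])
    fix k assume "k \<in> {..<m}"
    then have k: "k < m" by simp
    then have lt: "2 * m - 1 - k < 2 * m" "k < 2 * m" by auto
    have k0: "k = k0 \<longleftrightarrow> k = i \<or> 2 * m - 1 - k = i" using k assms by (auto simp: k0_def)
    consider "k = i" "k = k0" "2 * m - 1 - k \<noteq> i" "mvar (2 * m - i) = (mvar (Suc (2 * m - 1 - k)) :: 'a mpoly)"
      | "k \<noteq> i" "2 * m - 1 - k = i" "k = k0" "mvar (2 * m - i) = (mvar (Suc k) :: 'a mpoly)"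
      | "k \<noteq> i" "2 * m - 1 - k \<noteq> i" "k \<noteq> k0"
    proof (cases "k = i")
      case True
      then have "2 * m - 1 - k \<noteq> i" "2 * m - i = Suc (2 * m - 1 - k)" using k by auto
      with True k0 that(1) show ?thesis by simp
    next
      case False
      show ?thesis
      proof (cases "2 * m - 1 - k = i")
        case True
        then have "2 * m - i = Suc k" using k by auto
        with True False k0 that(2) show ?thesis by simp
      qed (use False k0 that(3) in simp)
    qed
    then show "row_form ?g (Suc k) * row_form ?g (Suc (2 * m - 1 - k)) =
        mvar (Suc k) * mvar (Suc (2 * m - 1 - k)) + (if k = k0 then mconst c * ?z * mvar (2 * m - i) else 0)"
      unfolding row_form_elementary(3)[OF assms lt(1)] row_form_elementary(3)[OF assms lt(2)]
    proof cases
      case 1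
      show "(mvar (Suc k) + (if k = i then mconst c * ?z else 0)) *
          (mvar (Suc (2 * m - 1 - k)) + (if 2 * m - 1 - k = i then mconst c * ?z else 0)) =
          mvar (Suc k) * mvar (Suc (2 * m - 1 - k)) + (if k = k0 then mconst c * ?z * mvar (2 * m - i) else 0)"
        unfolding 1(4) if_P[OF 1(1)] if_P[OF 1(2)] if_not_P[OF 1(3)] by (simp only: add_0_right distrib_right)
    next
      case 2
      show "(mvar (Suc k) + (if k = i then mconst c * ?z else 0)) *
          (mvar (Suc (2 * m - 1 - k)) + (if 2 * m - 1 - k = i then mconst c * ?z else 0)) =
          mvar (Suc k) * mvar (Suc (2 * m - 1 - k)) + (if k = k0 then mconst c * ?z * mvar (2 * m - i) else 0)"
        unfolding 2(4) if_not_P[OF 2(1)] if_P[OF 2(2)] if_P[OF 2(3)]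
        by (simp only: add_0_right distrib_left mult_ac)
    next
      case 3
      show "(mvar (Suc k) + (if k = i then mconst c * ?z else 0)) *
          (mvar (Suc (2 * m - 1 - k)) + (if 2 * m - 1 - k = i then mconst c * ?z else 0)) =
          mvar (Suc k) * mvar (Suc (2 * m - 1 - k)) + (if k = k0 then mconst c * ?z * mvar (2 * m - i) else 0)"
        unfolding if_not_P[OF 3(1)] if_not_P[OF 3(2)] if_not_P[OF 3(3)] by (simp only: add_0_right)
    qed
  qed
  also have "\<dots> = shift (xi m 1) + mconst c * ?z * mvar (2 * m - i)"
  proof -
    have "k0 < m" using assms by (auto simp: k0_def)
    then show ?thesis by (simp add: sum.distrib xi_1 shift.hom_sum shift.hom_mult)
  qed
  finally have *: "act (shift (xi m 1)) ?g = shift (xi m 1) + mconst c * ?z * mvar (2 * m - i)" .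
  have "act (xi (Suc m) 1) ?g = xi (Suc m) 1"
  proof (rule xi_Suc[of 1 m])
    fix u :: "'a mpoly" assume u: "xi (Suc m) 1 = shift (xi m 1) + ?z * u" "1 = (1::nat) \<Longrightarrow> u = mvar 0"
    show ?thesis
      unfolding u(1) u(2)[OF refl] act.hom_add act.hom_mult * act_mvar row_form_elementary(1,2)[OF assms]
      by (simp add: algebra_simps)
  qed simp
  moreover have "unitriangular (2 * Suc m) ?g"
    using assms by (auto simp: unitriangular_def upper_triangular_def elementary_def)
  ultimately show ?thesis unfolding P_iff by simp
qed

subsection \<open>Orbit products in rank m + 1\<close>

text \<open>The inner block of g determines the part without z. Conversely a block extension
  realizes any such part, and a preceding elementary matrix adds any multiple of z.\<close>

lemma orbit_inner_var:
  assumes "i < 2 * m"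
  shows "act (mvar (Suc i)) ` (P (Suc m) :: 'a mat set) =
    (\<lambda>(x, c). shift x + mconst c * last_var m) ` (act (mvar i) ` P m \<times> UNIV)"
proof (intro equalityI subsetI)
  fix y assume "y \<in> act (mvar (Suc i)) ` (P (Suc m) :: 'a mat set)"
  then obtain g where g: "g \<in> P (Suc m)" "y = act (mvar (Suc i)) g" by blast
  then have "y = shift (act (mvar i) (inner_block m g)) + mconst (g $$ (Suc i, Suc (2 * m))) * last_var m"
    using act_inner_var[OF g(1) assms] by simp
  then show "y \<in> (\<lambda>(x, c). shift x + mconst c * last_var m) ` (act (mvar i) ` P m \<times> UNIV)"
    using inner_block_in_P[OF g(1)] by auto
next
  fix y assume "y \<in> (\<lambda>(x, c). shift x + mconst c * last_var m) ` (act (mvar i) ` (P m :: 'a mat set) \<times> UNIV)"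
  then obtain g c where g: "g \<in> P m" and y: "y = shift (act (mvar i) g) + mconst c * last_var m" by auto
  have el: "elementary m i c \<in> P (Suc m)" and ext: "block_extend m g \<in> P (Suc m)"
    using elementary_in_P[OF assms] block_extend_in_P[OF g] by auto
  have "act (mvar (Suc i)) (elementary m i c * block_extend m g) = act (act (mvar (Suc i)) (elementary m i c)) (block_extend m g)"
    using act_act[OF P_carrier[OF el] P_carrier[OF ext], of "mvar (Suc i)"] assms by simp
  also have "\<dots> = y"
    using assms P_carrier[OF g]
    by (simp add: row_form_elementary(3)[OF assms] act.hom_add act.hom_mult row_form_block_extend y)
  finally show "y \<in> act (mvar (Suc i)) ` P (Suc m)"
    using P_mult[OF el ext] by blast
qed

text \<open>The orbit is a disjoint union of cosets of F_q z, one for each orbit element of rank m,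
  and the product over a coset is the image of that element under \<open>hat\<close>. Reduction
  modulo z separates the cosets.\<close>

lemma N_inner_var:
  assumes "i < 2 * m"
  shows "N (Suc m) (mvar (Suc i)) = hat m (N m (mvar i))"
proof -
  let ?O = "act (mvar i) ` (P m :: 'a mat set)"
  interpret hat: comm_ring_hom "hat m" by (rule hat_hom)
  have inj: "inj_on (\<lambda>(x, c). shift x + mconst c * last_var m) (?O \<times> (UNIV :: 'a set))"
  proof (rule inj_onI, clarsimp)
    fix g h :: "'a mat" and c d :: 'a
    assume gh: "g \<in> P m" "h \<in> P m"
      and eq: "shift (row_form g i) + mconst c * last_var m = shift (row_form h i) + mconst d * last_var m"
    have "row_form k i \<in> polys_in {..<2 * m}" if "k \<in> P m" for k :: "'a mat"
      using P_carrier[OF that] by (intro row_form_in_polys_in) auto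
    then have "[:row_form g i:] = [:row_form h i:]"
      using arg_cong[OF eq, of "reduce m"] gh
      by (simp add: reduce.hom_add reduce.hom_mult reduce_mvar reduce_shift)
    then show "row_form g i = row_form h i \<and> c = d" using eq by simp
  qed
  have "N (Suc m) (mvar (Suc i)) = (\<Prod>(x, c)\<in>?O \<times> UNIV. shift x + mconst c * last_var m)"
    unfolding N_def orbit_inner_var[OF assms] prod.reindex[OF inj] by (simp add: case_prod_unfold)
  also have "\<dots> = (\<Prod>x\<in>?O. shift x ^ q - shift x * last_var m ^ (q - 1))"
    by (simp flip: prod.cartesian_product add: prod_translates)
  also have "\<dots> = (\<Prod>x\<in>?O. hat m x)"
    by (intro prod.cong) (auto simp: hat_row_form)
  finally show ?thesis by (simp only: N_def hat.hom_prod)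
qed

lemma P_nonempty: "1\<^sub>m (2 * m) \<in> (P m :: 'a mat set)"
  unfolding P_iff using act_one[of "xi m 1" "2 * m"] xi_in_polys_in[of 1 m]
  by (auto simp: unitriangular_def)

lemma N_last_var: "N (Suc m) (last_var m) = (last_var m :: 'a mpoly)"
proof -
  have "act (last_var m) ` (P (Suc m) :: 'a mat set) = {last_var m}"
    using act_last_var P_nonempty[of "Suc m"] by fastforce
  then show ?thesis unfolding N_def by simp
qed

lemma first_orbit_form:
  assumes "x \<in> act (mvar 0) ` (P (Suc m) :: 'a mat set)"
  obtains l where "x = mvar 0 + l" "l \<in> polys_in {1..<2 * Suc m}"
proof -
  obtain g where g: "g \<in> P (Suc m)" "x = act (mvar 0) g" using assms by blast
  show thesis
    by (rule that[OF trans[OF g(2) act_first_var[OF g(1)]]])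
      (intro polys_in_add polys_in_mult polys_in_sum, auto)
qed

text \<open>The rows of \<open>g\<close> are isotropic, so in odd characteristic the coefficient of the last variable in the image
  of the first one is determined by the other coefficients.\<close>
lemma card_first_orbit:
  assumes "odd q" shows "card (act (mvar 0) ` (P (Suc m) :: 'a mat set)) \<le> q ^ (2 * m)"
    and "card (act (mvar 0) ` (P (Suc m) :: 'a mat set)) > 0"
proof -
  let ?O = "act (mvar 0) ` (P (Suc m) :: 'a mat set)"
  show "card ?O > 0"
    using finite_orbit[of 0 "Suc m"] P_nonempty[of "Suc m"] by (auto simp: card_gt_0_iff)
  have two: "(2 :: 'a) \<noteq> 0"
  proof
    assume "(2 :: 'a) = 0"
    then have "CHAR('a) dvd 2"
      by (metis of_nat_eq_0_iff_char_dvd of_nat_numeral)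
    then have "CHAR('a) = 2" using prime_CHAR primes_dvd_imp_eq two_is_prime_nat by blast
    then have "q = 2 ^ r" using card_power by simp
    then show False using assms q_gt_1 by (cases r) auto
  qed
  define W where "W g = restrict (\<lambda>j. g $$ (0, Suc j)) {..<2 * m}" for g :: "'a mat"
  \<comment> \<open>In the pairing of row 0 with itself, the first and the last position each
    contribute the last entry, as the diagonal entry is 1.\<close>
  have last: "2 * g $$ (0, Suc (2 * m)) = - (\<Sum>j<2 * m. g $$ (0, Suc j) * g $$ (0, 2 * m - j))"
    if "g \<in> P (Suc m)" for g :: "'a mat"
    using P_orthogonal_rows[OF that, of 0 0] P_entry(1)[OF that, of 0]
    unfolding sum_lessThan_split by (simp add: eq_neg_iff_add_eq_0 algebra_simps Suc_diff_Suc)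
  have "act (mvar 0) g = act (mvar 0) h" if gh: "g \<in> P (Suc m)" "h \<in> P (Suc m)" "W g = W h" for g h :: "'a mat"
  proof -
    have W: "g $$ (0, Suc j) = h $$ (0, Suc j)" if "j < 2 * m" for j
      using fun_cong[OF gh(3), of j] that by (simp add: W_def)
    have "g $$ (0, 2 * m - j) = h $$ (0, 2 * m - j)" if "j < 2 * m" for j
      using W[of "2 * m - Suc j"] that by (simp add: Suc_diff_Suc)
    then have "2 * g $$ (0, Suc (2 * m)) = 2 * h $$ (0, Suc (2 * m))"
      unfolding last[OF gh(1)] last[OF gh(2)] using W by simp
    then have "g $$ (0, Suc (2 * m)) = h $$ (0, Suc (2 * m))" using two by simp
    then show ?thesis unfolding act_first_var[OF gh(1)] act_first_var[OF gh(2)] using W by simp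
  qed
  \<comment> \<open>The image of y depends only on the inner part \<open>W g\<close> of row 0, so
    the orbit is no larger than the set of all possible parts, which has q^(2m) elements.\<close>
  then have "\<exists>F. \<forall>g\<in>P (Suc m). act (mvar 0) g = F (W g)"
    by (intro exI[of _ "\<lambda>w. act (mvar 0) (SOME g. g \<in> P (Suc m) \<and> W g = w)"])
      (metis (mono_tags, lifting) someI)
  then obtain F where F: "\<And>g. g \<in> P (Suc m) \<Longrightarrow> act (mvar 0) g = F (W g)" by blast
  let ?A = "PiE {..<2 * m} (\<lambda>_. UNIV :: 'a set)"
  have "?O \<subseteq> F ` ?A"
  proof
    fix x assume "x \<in> ?O"
    then obtain g where "g \<in> P (Suc m)" "x = F (W g)" using F by auto
    then show "x \<in> F ` ?A" by (auto simp: W_def)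
  qed
  then have "card ?O \<le> card ?A"
    by (intro order_trans[OF card_mono card_image_le] finite_imageI finite_PiE) auto
  then show "card ?O \<le> q ^ (2 * m)" by (simp add: card_PiE card_eq)
qed

end

section \<open>Subalgebras and spans\<close>

lemma is_subalgebraD:
  assumes "is_subalgebra A"
  shows "mconst c \<in> A" "f \<in> A \<Longrightarrow> g \<in> A \<Longrightarrow> f + g \<in> A" "f \<in> A \<Longrightarrow> g \<in> A \<Longrightarrow> f * g \<in> A"
  using assms by (auto simp: is_subalgebra_def)

lemma is_subalgebra_hull: "is_subalgebra (is_subalgebra hull H)"
  by (rule hull_in) (auto simp: is_subalgebra_def subset_iff)

lemma subalgebra_0: "is_subalgebra A \<Longrightarrow> 0 \<in> A"
  using is_subalgebraD(1)[of A 0] by (simp add: mconst.hom_zero)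

lemma subalgebra_1: "is_subalgebra A \<Longrightarrow> 1 \<in> A"
  using is_subalgebraD(1)[of A 1] by (simp add: mconst.hom_one)

lemma subalgebra_uminus: "is_subalgebra A \<Longrightarrow> f \<in> A \<Longrightarrow> - f \<in> A"
  using is_subalgebraD(3)[of A "mconst (- 1)" f] is_subalgebraD(1)[of A "- 1"]
  by (simp add: mconst.hom_uminus mconst.hom_one)

lemma subalgebra_diff: "is_subalgebra A \<Longrightarrow> f \<in> A \<Longrightarrow> g \<in> A \<Longrightarrow> f - g \<in> A"
  using is_subalgebraD(2)[of A f "- g"] subalgebra_uminus[of A g] by simp

lemma subalgebra_sum: "is_subalgebra A \<Longrightarrow> (\<And>i. i \<in> I \<Longrightarrow> f i \<in> A) \<Longrightarrow> (\<Sum>i\<in>I. f i) \<in> A"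
  by (induction I rule: infinite_finite_induct) (auto intro: is_subalgebraD subalgebra_0)

lemma subalgebra_prod: "is_subalgebra A \<Longrightarrow> (\<And>i. i \<in> I \<Longrightarrow> f i \<in> A) \<Longrightarrow> (\<Prod>i\<in>I. f i) \<in> A"
  by (induction I rule: infinite_finite_induct) (auto intro: is_subalgebraD subalgebra_1)

lemma subalgebra_power: "is_subalgebra A \<Longrightarrow> f \<in> A \<Longrightarrow> f ^ k \<in> A"
  by (induction k) (auto intro: is_subalgebraD subalgebra_1)

lemma generated_subalgebra_is_subalgebra: "is_subalgebra (generated_subalgebra H)"
  unfolding generated_subalgebra_def by (rule is_subalgebra_hull)

lemma generated_subalgebra_inc: "h \<in> H \<Longrightarrow> h \<in> generated_subalgebra H"
  unfolding generated_subalgebra_def by (rule hull_inc)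

lemma generated_subalgebra_minimal: "H \<subseteq> A \<Longrightarrow> is_subalgebra A \<Longrightarrow> generated_subalgebra H \<subseteq> A"
  unfolding generated_subalgebra_def by (rule hull_minimal)

definition span_over :: "'r::comm_ring_1 set \<Rightarrow> 'i set \<Rightarrow> ('i \<Rightarrow> 'r) \<Rightarrow> 'r set" where
  "span_over A I b = {f. \<exists>c. (\<forall>i\<in>I. c i \<in> A) \<and> f = (\<Sum>i\<in>I. c i * b i)}"

definition independent_over :: "'r::comm_ring_1 set \<Rightarrow> 'i set \<Rightarrow> ('i \<Rightarrow> 'r) \<Rightarrow> bool" where
  "independent_over A I b \<longleftrightarrow>
    (\<forall>c. (\<forall>i\<in>I. c i \<in> A) \<longrightarrow> (\<Sum>i\<in>I. c i * b i) = 0 \<longrightarrow> (\<forall>i\<in>I. c i = 0))"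

lemma span_over_0: "is_subalgebra A \<Longrightarrow> 0 \<in> span_over A I b"
  unfolding span_over_def by (auto intro!: exI[of _ "\<lambda>_. 0"] simp: subalgebra_0)

lemma span_over_add:
  assumes "is_subalgebra A" "f \<in> span_over A I b" "g \<in> span_over A I b" shows "f + g \<in> span_over A I b"
proof -
  obtain c d where "\<forall>i\<in>I. c i \<in> A" "f = (\<Sum>i\<in>I. c i * b i)" "\<forall>i\<in>I. d i \<in> A" "g = (\<Sum>i\<in>I. d i * b i)"
    using assms(2,3) unfolding span_over_def by auto
  then show ?thesis
    using is_subalgebraD(2)[OF assms(1)] unfolding span_over_def
    by (auto intro!: exI[of _ "\<lambda>i. c i + d i"] simp: algebra_simps sum.distrib)
qed

lemma span_over_mult:
  assumes "is_subalgebra A" "a \<in> A" "f \<in> span_over A I b" shows "a * f \<in> span_over A I b"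
proof -
  obtain c where "\<forall>i\<in>I. c i \<in> A" "f = (\<Sum>i\<in>I. c i * b i)"
    using assms(3) unfolding span_over_def by auto
  moreover from this have "\<forall>i\<in>I. a * c i \<in> A"
    using is_subalgebraD(3)[OF assms(1,2)] by blast
  ultimately show ?thesis
    unfolding span_over_def
    by (intro CollectI exI[of _ "\<lambda>i. a * c i"]) (simp add: mult.assoc sum_distrib_left)
qed

lemma span_over_sum:
  "is_subalgebra A \<Longrightarrow> (\<And>j. j \<in> J \<Longrightarrow> f j \<in> span_over A I b) \<Longrightarrow> (\<Sum>j\<in>J. f j) \<in> span_over A I b"
  by (induction J rule: infinite_finite_induct) (auto intro: span_over_add span_over_0)

lemma span_over_base:
  assumes "is_subalgebra A" "finite I" "i \<in> I" shows "b i \<in> span_over A I b"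
proof -
  have "b i = (\<Sum>j\<in>I. (if j = i then 1 else 0) * b j)"
  proof -
    have "(\<Sum>j\<in>I. (if j = i then 1 else 0) * b j) = (\<Sum>j\<in>I. if j = i then b j else 0)"
      by (rule sum.cong) auto
    then show ?thesis using assms(2,3) by simp
  qed
  then show ?thesis
    using subalgebra_0[OF assms(1)] subalgebra_1[OF assms(1)] unfolding span_over_def
    by (auto intro!: exI[of _ "\<lambda>j. if j = i then 1 else 0"])
qed

text \<open>A relation over a subfamily is extended to all of I by zero coefficients, which have to
  lie in A.\<close>

lemma is_free_basis_finiteI:
  assumes "finite I" "is_submodule A M" "b ` I \<subseteq> M" "0 \<in> A"
    and "M \<subseteq> span_over A I b" "independent_over A I b"
  shows "is_free_basis A M I b"
  unfolding is_free_basis_def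
proof (intro conjI allI impI ballI)
  fix f assume "f \<in> M"
  then obtain c where "\<forall>i\<in>I. c i \<in> A" "f = (\<Sum>i\<in>I. c i * b i)"
    using assms(5) unfolding span_over_def by blast
  then show "\<exists>J c. finite J \<and> J \<subseteq> I \<and> c \<in> J \<rightarrow> A \<and> f = (\<Sum>j\<in>J. c j * b j)"
    using assms(1) by (intro exI[of _ I] exI[of _ c]) auto
next
  fix J c j assume J: "finite J \<and> J \<subseteq> I \<and> c \<in> J \<rightarrow> A \<and> (\<Sum>j\<in>J. c j * b j) = 0" and j: "j \<in> J"
  define d where "d i = (if i \<in> J then c i else 0)" for i
  have "(\<Sum>i\<in>I. d i * b i) = (\<Sum>j\<in>J. c j * b j)"
    by (rule sum.mono_neutral_cong_right) (use J assms(1) in \<open>auto simp: d_def\<close>)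
  moreover have "\<forall>i\<in>I. d i \<in> A" using J assms(4) by (auto simp: d_def)
  ultimately have "\<forall>i\<in>I. d i = 0" using assms(6) J unfolding independent_over_def by auto
  then show "c j = 0" using j J by (auto simp: d_def subset_iff split: if_splits)
qed (use assms in auto)

section \<open>Homogeneous components of invariants\<close>

text \<open>Substituting linear forms commutes with scaling all variables.\<close>

lemma component_substitute:
  fixes \<sigma> :: "nat \<Rightarrow> 'a::comm_ring_1 mpoly"
  assumes "\<And>i. homogeneous_of 1 (\<sigma> i)"
  shows "component d (substitute \<sigma> f) = substitute \<sigma> (component d f)"
proof -
  have "graded (substitute \<sigma> f) = map_poly (substitute \<sigma>) (graded f)"
  proof (rule hom_eq[where f = f])
    show "comm_ring_hom (\<lambda>f. graded (substitute \<sigma> f))"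
      by (rule comm_ring_hom_comp[OF graded.comm_ring_hom_axioms substitute_hom])
    show "comm_ring_hom (\<lambda>f. map_poly (substitute \<sigma>) (graded f))"
      by (rule comm_ring_hom_comp[OF map_poly_hom[OF substitute_hom] graded.comm_ring_hom_axioms])
    show "graded (substitute \<sigma> (mvar i)) = map_poly (substitute \<sigma>) (graded (mvar i))" for i
      using assms[of i] by (simp add: homogeneous_of_def Polynomial.map_poly_pCons monom_altdef)
  qed (simp add: Polynomial.map_poly_pCons)
  then show ?thesis by (simp add: component_def coeff_map_poly)
qed

text \<open>This turns membership into a fixed point equation for a linear substitution, to which
  \<open>component_substitute\<close> applies.\<close>

lemma polys_in_iff_substitute:
  "f \<in> polys_in V \<longleftrightarrow> substitute (\<lambda>i. if i \<in> V then mvar i else 0) f = (f :: 'a::comm_ring_1 mpoly)"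
proof
  assume "f \<in> polys_in V"
  then show "substitute (\<lambda>i. if i \<in> V then mvar i else 0) f = f" by (rule substitute_id[rotated]) simp
next
  assume "substitute (\<lambda>i. if i \<in> V then mvar i else 0) f = f"
  moreover have "substitute (\<lambda>i. if i \<in> V then mvar i else 0) f \<in> polys_in V"
    by (rule substitute_in_polys_in[OF polys_in_UNIV]) auto
  ultimately show "f \<in> polys_in V" by simp
qed

lemma component_in_polys_in:
  assumes "f \<in> polys_in V" shows "component d f \<in> (polys_in V :: 'a::comm_ring_1 mpoly set)"
proof -
  have "homogeneous_of 1 (if i \<in> V then mvar i else 0 :: 'a mpoly)" for i
    using homogeneous_of_mvar homogeneous_of_0 by auto
  then show ?thesis
    using assms component_substitute[of "\<lambda>i. if i \<in> V then mvar i else 0" d f]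
    unfolding polys_in_iff_substitute by simp
qed

lemma homogeneous_of_row_form: "homogeneous_of 1 (row_form g i)"
proof -
  have "homogeneous_of (0 + 1) (mconst (g $$ (i, j)) * mvar j)" for j
    by (rule homogeneous_of_mult[OF homogeneous_of_mconst homogeneous_of_mvar])
  then show ?thesis unfolding row_form_def by (intro homogeneous_of_sum) simp
qed

lemma component_act: "component d (act f g) = act (component d f) g"
  unfolding act_eq by (rule component_substitute[OF homogeneous_of_row_form])

context finite_field_card
begin

lemma invariants_iff: "f \<in> invariants m \<longleftrightarrow> f \<in> polys_in {..<2 * m} \<and> (\<forall>g\<in>P m. act f g = (f :: 'a mpoly))"
  by (simp add: invariants_def S_eq_polys_in)

lemma invariants_subalgebra: "is_subalgebra (invariants m :: 'a mpoly set)"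
  unfolding is_subalgebra_def
  by (auto simp: invariants_iff act.hom_add act.hom_mult intro: polys_in_add polys_in_mult)

lemma component_invariant: "f \<in> invariants m \<Longrightarrow> component d f \<in> (invariants m :: 'a mpoly set)"
  unfolding invariants_iff using component_in_polys_in component_act[of d f, symmetric] by auto

lemma xi_invariant: "1 \<le> i \<Longrightarrow> xi m i \<in> (invariants m :: 'a mpoly set)"
  by (simp add: invariants_iff xi_in_polys_in act_xi)

abbreviation base :: "nat \<Rightarrow> 'a mpoly set" where
  "base m \<equiv> generated_subalgebra (H0 m)"

lemma base_subalgebra: "is_subalgebra (base m)"
  by (rule generated_subalgebra_is_subalgebra)

lemma N_in_base: "i < 2 * m \<Longrightarrow> N m (mvar i) \<in> base m"
  by (rule generated_subalgebra_inc) (auto simp: H0_eq)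

lemma base_subset_invariants: "base m \<subseteq> invariants m"
  by (rule generated_subalgebra_minimal[OF _ invariants_subalgebra])
    (auto simp: H0_eq invariants_iff N_in_polys_in act_N)

lemma homogeneous_of_N:
  "homogeneous_of (\<Sum>x\<in>act (mvar i) ` (P m :: 'a mat set). 1) (N m (mvar i :: 'a mpoly))"
  unfolding N_def by (rule homogeneous_of_prod) (auto intro: homogeneous_of_row_form[simplified])

text \<open>The generators are homogeneous, and the elements whose components all stay in the
  algebra form a subalgebra. The induction on the degree needs homogeneous coefficients.\<close>

lemma component_in_base:
  assumes "b \<in> base m" shows "component d b \<in> base m"
proof -
  have sub: "is_subalgebra {b. \<forall>d. component d b \<in> base m}"
    unfolding is_subalgebra_def
  proof (intro conjI ballI subsetI)
    fix f :: "'a mpoly" assume "f \<in> range mconst"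
    then show "f \<in> {b. \<forall>d. component d b \<in> base m}"
      using is_subalgebraD(1)[OF base_subalgebra] subalgebra_0[OF base_subalgebra]
      by (auto simp: component_homogeneous[OF homogeneous_of_mconst])
  qed (auto simp: component_add component_mult
      intro!: is_subalgebraD(2)[OF base_subalgebra] subalgebra_sum[OF base_subalgebra]
        is_subalgebraD(3)[OF base_subalgebra])
  have "H0 m \<subseteq> {b. \<forall>d. component d b \<in> base m}"
  proof
    fix h :: "'a mpoly" assume "h \<in> H0 m"
    then obtain i where i: "i < 2 * m" "h = N m (mvar i)" by (auto simp: H0_eq)
    then show "h \<in> {b. \<forall>d. component d b \<in> base m}"
      using N_in_base[OF i(1)] subalgebra_0[OF base_subalgebra[of m]]
      by (simp add: component_homogeneous[OF homogeneous_of_N])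
  qed
  then have "base m \<subseteq> {b. \<forall>d. component d b \<in> base m}"
    by (rule generated_subalgebra_minimal[OF _ sub])
  then show ?thesis using assms by blast
qed

section \<open>Polynomials invariant under translations\<close>

definition translation :: "nat \<Rightarrow> nat \<Rightarrow> 'a \<Rightarrow> 'a mpoly \<Rightarrow> 'a mpoly" where
  "translation l j c = substitute (\<lambda>i. mvar i + (if i = j then mconst c * mvar l else 0))"

definition additive_subst :: "nat \<Rightarrow> nat set \<Rightarrow> nat \<Rightarrow> 'a mpoly" where
  "additive_subst l J i = (if i \<in> J then mvar i ^ q - mvar i * mvar l ^ (q - 1) else mvar i)"

lemma as_poly_translation:
  assumes "l \<noteq> j" shows "as_poly j (translation l j c f) = pcompose (as_poly j f) [:mconst c * mvar l, 1:]"
proof (rule hom_eq[where f = f])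
  show "comm_ring_hom (\<lambda>f. as_poly j (translation l j c f))"
    unfolding translation_def by (rule comm_ring_hom_comp[OF as_poly.comm_ring_hom_axioms substitute_hom])
  show "comm_ring_hom (\<lambda>f. pcompose (as_poly j f) [:mconst c * mvar l, 1:])"
    by (rule comm_ring_hom_comp[OF pcompose_hom as_poly.comm_ring_hom_axioms])
qed (use assms in \<open>auto simp: translation_def as_poly_mvar as_poly.hom_add as_poly.hom_mult pcompose_pCons\<close>)

text \<open>The variables of J are removed one at a time. For j, an inner induction on the degree in
  x_j splits off multiples of u = x_j^q - x_j x_l^(q-1): f = f0 + u f1, where f0 is free of x_j, f1
  is zero or of smaller degree, and f0 is invariant under the translations for J, f1 under all of
  them.\<close>

lemma translation_invariant_polynomial:
  assumes "finite J" "l \<notin> J" "\<And>j c. j \<in> J \<Longrightarrow> translation l j c f = f"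
  shows "\<exists>s. f = substitute (additive_subst l J) s"
  using assms
proof (induction J arbitrary: f rule: finite_induct)
  case empty
  have "substitute (additive_subst l {}) f = f"
    by (rule substitute_id[of UNIV]) (auto simp: additive_subst_def)
  then show ?case by metis
next
  case (insert j J)
  let ?\<sigma> = "additive_subst l (insert j J)" and ?u = "mvar j ^ q - mvar j * mvar l ^ (q - 1) :: 'a mpoly"
  have lj: "l \<noteq> j" "l \<notin> J" using insert.prems(1) by auto
  have u: "as_poly j ?u = shifted_power (mvar l)"
    using lj by (simp add: as_poly.hom_minus as_poly.hom_power as_poly.hom_mult as_poly_mvar
        shifted_power_def monom_altdef poly_const_pow)
  have sp: "shifted_power (mvar l :: 'a mpoly) \<noteq> 0"
    by (simp add: shifted_power_eq_prod)
  have u0: "?u \<noteq> 0"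
    using sp unfolding u[symmetric] by auto
  have u_tr: "translation l i c ?u = ?u" if "i \<noteq> j" "i \<noteq> l" for i c
    using that lj by (simp add: translation_def substitute.hom_minus substitute.hom_power substitute.hom_mult)
  show ?case using insert.prems(2)
  proof (induction "degree (as_poly j f)" arbitrary: f rule: less_induct)
    case less
    have inv: "pcompose (as_poly j f) [:mconst c * mvar l, 1:] = as_poly j f" for c
      using less.prems[of j c] as_poly_translation[OF lj(1), of c f] by simp
    obtain p' where p': "as_poly j f = [:coeff (as_poly j f) 0:] + shifted_power (mvar l) * p'"
      and p'_inv: "\<And>c :: 'a. pcompose p' [:mconst c * mvar l, 1:] = p'"
      and p'_deg: "p' \<noteq> 0 \<Longrightarrow> degree p' < degree (as_poly j f)"
      using translation_invariant_polyE[OF mvar_neq_0 inv] by metis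
    define f0 where "f0 = coeff (as_poly j f) 0"
    define f1 where "f1 = poly p' (mvar j)"
    have f0: "f0 = substitute (mvar(j := 0)) f"
      unfolding f0_def poly_as_poly[symmetric] by (simp add: poly_0_coeff_0)
    have "f = poly (as_poly j f) (mvar j)" by simp
    also have "\<dots> = f0 + ?u * f1"
      by (subst p') (simp add: f0_def f1_def shifted_power_def poly_monom mult.commute)
    finally have f: "f = f0 + ?u * f1" .
    have f0_const: "as_poly j f0 = [:f0:]"
      using coeff_as_poly_in_polys_in[OF polys_in_UNIV, where f = f and i = j and k = 0]
      by (intro as_poly_const[of _ "UNIV - {j}"]) (auto simp: f0_def)
    have "as_poly j f = as_poly j (f0 + ?u * f1)" using f by simp
    then have "as_poly j f = [:f0:] + shifted_power (mvar l) * as_poly j f1"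
      unfolding as_poly.hom_add as_poly.hom_mult u f0_const .
    moreover have "as_poly j f = [:f0:] + shifted_power (mvar l) * p'"
      unfolding f0_def by (rule p')
    ultimately have "shifted_power (mvar l) * as_poly j f1 = shifted_power (mvar l) * p'"
      by (metis add_left_cancel)
    then have f1_poly: "as_poly j f1 = p'" using sp by simp
    have tr0: "translation l i c f0 = f0" if "i \<in> J" for i c
    proof -
      have ij: "i \<noteq> j" "i \<noteq> l" using that insert.hyps lj by auto
      have "translation l i c f0 = substitute (mvar(j := 0)) (translation l i c f)"
        unfolding f0 translation_def substitute_substitute
        by (rule arg_cong[where f = "\<lambda>\<sigma>. substitute \<sigma> f"])
          (use ij lj in \<open>auto simp: fun_eq_iff substitute.hom_add substitute.hom_mult\<close>)
      then show ?thesis using less.prems[of i c] that by (simp add: f0)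
    qed
    have tr1: "translation l i c f1 = f1" if "i \<in> insert j J" for i c
    proof (cases "i = j")
      case True
      have "as_poly j (translation l j c f1) = as_poly j f1"
        unfolding as_poly_translation[OF lj(1)] f1_poly by (rule p'_inv)
      then show ?thesis using True by (simp add: as_poly_eq_iff)
    next
      case False
      then have i: "i \<in> J" "i \<noteq> l" using that lj by auto
      have "f = translation l i c (f0 + ?u * f1)"
        unfolding f[symmetric] using less.prems[of i c] that by simp
      also have "\<dots> = translation l i c f0 + translation l i c ?u * translation l i c f1"
        by (simp add: translation_def substitute.hom_add substitute.hom_mult)
      also have "\<dots> = f0 + ?u * translation l i c f1"
        by (simp only: tr0[OF i(1)] u_tr[OF False i(2)])
      finally have "f0 + ?u * translation l i c f1 = f0 + ?u * f1" using f by (simp only:)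
      then have "?u * translation l i c f1 = ?u * f1" by (simp only: add_left_cancel)
      then show ?thesis unfolding mult_left_cancel[OF u0] .
    qed
    obtain s0 where s0: "f0 = substitute (additive_subst l J) s0"
      using insert.IH[OF lj(2) tr0] by blast
    \<comment> \<open>\<open>s0\<close> may contain variable j, which
      \<open>additive_subst l J\<close> leaves alone but \<open>?\<sigma>\<close> does not. Setting
      it to 0 is harmless because f0 is free of it.\<close>
    have "f0 = substitute (mvar(j := 0)) f0"
      unfolding f0 substitute_substitute
      by (rule arg_cong[where f = "\<lambda>\<sigma>. substitute \<sigma> f"]) (auto simp: fun_eq_iff)
    also have "\<dots> = substitute ?\<sigma> (substitute (mvar(j := 0)) s0)"
      unfolding s0 substitute_substitute
      by (rule arg_cong[where f = "\<lambda>\<sigma>. substitute \<sigma> s0"])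
        (use lj insert.hyps in \<open>auto simp: fun_eq_iff additive_subst_def substitute.hom_minus
          substitute.hom_power substitute.hom_mult\<close>)
    finally have s0': "f0 = substitute ?\<sigma> (substitute (mvar(j := 0)) s0)" .
    have "\<exists>s1. f1 = substitute ?\<sigma> s1"
    proof (cases "p' = 0")
      case True
      then show ?thesis by (intro exI[of _ 0]) (simp add: f1_def)
    next
      case False
      show ?thesis
      proof (rule less.hyps)
        show "degree (as_poly j f1) < degree (as_poly j f)" using p'_deg[OF False] by (simp add: f1_poly)
      qed (rule tr1)
    qed
    then obtain s1 where s1: "f1 = substitute ?\<sigma> s1" by blast
    have "?\<sigma> j = ?u" by (simp add: additive_subst_def)
    then have "f = substitute ?\<sigma> (substitute (mvar(j := 0)) s0 + mvar j * s1)"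
      unfolding substitute.hom_add substitute.hom_mult substitute_mvar s0'[symmetric] s1[symmetric]
      using f by simp
    then show ?case by blast
  qed
qed

end

section \<open>The exponents\<close>

lemma nat_ceiling_half: "nat \<lceil>real i / 2\<rceil> = (i + 1) div 2"
proof -
  have "\<lceil>real i / 2\<rceil> = int ((i + 1) div 2)"
    by (cases "even i") (auto elim!: evenE oddE simp: ceiling_eq_iff)
  then show ?thesis by simp
qed

lemma e_eq: "e q m i = q ^ (m - (i + 1) div 2) - 1"
  by (simp add: e_def nat_ceiling_half)

lemma finite_exponents: "finite (PiE {1..k} (\<lambda>i. {0..e q m i}))"
  by (rule finite_PiE) auto

lemma div_mod_digit:
  "c < q \<Longrightarrow> (c + q * a) div q = (a :: nat)" "c < q \<Longrightarrow> (c + q * a) mod q = (c :: nat)"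
  by auto

lemma sum_digits: "1 < q \<Longrightarrow> (\<Sum>i<k. (d div q ^ i) mod q * q ^ i) = (d mod q ^ k :: nat)"
proof (induction k)
  case (Suc k)
  have "d mod (q ^ k * q) = q ^ k * (d div q ^ k mod q) + d mod q ^ k" by (rule mod_mult2_eq)
  then show ?case using Suc by (simp add: mult_ac)
qed simp

context finite_field_card
begin

definition exponents :: "nat \<Rightarrow> (nat \<Rightarrow> nat) set" where
  "exponents m = PiE {1..2 * m - 2} (\<lambda>i. {0..e q m i})"

definition digits :: "nat \<Rightarrow> (nat \<Rightarrow> nat) set" where
  "digits m = PiE {1..2 * m} (\<lambda>_. {..<q})"

definition xi_monomial :: "nat \<Rightarrow> (nat \<Rightarrow> nat) \<Rightarrow> 'a mpoly" where
  "xi_monomial m a = (\<Prod>i=1..2 * m - 2. xi m i ^ a i)"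

text \<open>Low digit c_i plus q times a_i. The indices 2m-1 and 2m do not occur in rank m, so there
  a is padded by 0; the restriction keeps the result extensional.\<close>

definition combine :: "nat \<Rightarrow> (nat \<Rightarrow> nat) \<Rightarrow> (nat \<Rightarrow> nat) \<Rightarrow> nat \<Rightarrow> nat" where
  "combine m a c = (\<lambda>i\<in>{1..2 * m}. c i + q * (if i \<le> 2 * m - 2 then a i else 0))"

lemma e_Suc_less:
  assumes "1 \<le> i" "i \<le> 2 * m - 2" shows "e q (Suc m) i = q * e q m i + (q - 1)"
proof -
  have "Suc m - (i + 1) div 2 = Suc (m - (i + 1) div 2)" using assms by (intro Suc_diff_le) auto
  moreover obtain t where t: "q ^ (m - (i + 1) div 2) = Suc t"
    using zero_less_power[OF q_pos, of "m - (i + 1) div 2"] gr0_implies_Suc by blast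
  ultimately have "e q (Suc m) i = q * Suc t - 1" "e q m i = t"
    unfolding e_eq by (simp_all only: power_Suc t diff_Suc_1)
  then show ?thesis using q_gt_1 by simp
qed

lemma e_Suc_last:
  assumes "1 \<le> i" "i \<le> 2 * m" "\<not> i \<le> 2 * m - 2" shows "e q (Suc m) i = q - 1"
proof -
  have "(i + 1) div 2 = m" using assms by (cases "i = 2 * m") auto
  then show ?thesis by (simp add: e_eq)
qed

lemma combine_in_exponents:
  assumes "a \<in> exponents m" "c \<in> digits m" shows "combine m a c \<in> exponents (Suc m)"
  unfolding exponents_def
proof (rule PiE_I)
  fix i assume "i \<in> {1..2 * Suc m - 2}"
  then have i: "1 \<le> i" "i \<le> 2 * m" by auto
  then have c: "c i \<le> q - 1" using assms(2) by (force simp: digits_def PiE_def Pi_def)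
  have "c i + q * (if i \<le> 2 * m - 2 then a i else 0) \<le> e q (Suc m) i"
  proof (cases "i \<le> 2 * m - 2")
    case True
    then have "a i \<le> e q m i" using assms(1) i(1) by (auto simp: exponents_def PiE_def Pi_def)
    then have "q * a i \<le> q * e q m i" by simp
    with c have "c i + q * a i \<le> (q - 1) + q * e q m i" by (rule add_mono)
    then show ?thesis using e_Suc_less[OF i(1) True] True by simp
  qed (use c e_Suc_last[OF i] in simp)
  then show "combine m a c i \<in> {0..e q (Suc m) i}" using i by (simp add: combine_def)
qed (auto simp: combine_def)

lemma combine_div_mod:
  assumes "c \<in> digits m" "1 \<le> i" "i \<le> 2 * m"
  shows "combine m a c i div q = (if i \<le> 2 * m - 2 then a i else 0)" "combine m a c i mod q = c i"
proof -
  have "c i < q" using assms by (auto simp: digits_def PiE_def Pi_def)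
  then show "combine m a c i div q = (if i \<le> 2 * m - 2 then a i else 0)" "combine m a c i mod q = c i"
    using assms(2,3) by (simp_all add: combine_def div_mod_digit)
qed

lemma combine_inject:
  assumes "a \<in> exponents m" "c \<in> digits m" "a' \<in> exponents m" "c' \<in> digits m"
    and eq: "combine m a c = combine m a' c'"
  shows "a = a' \<and> c = c'"
proof
  show "a = a'"
  proof (rule PiE_ext)
    show "a \<in> PiE {1..2 * m - 2} (\<lambda>i. {0..e q m i})" "a' \<in> PiE {1..2 * m - 2} (\<lambda>i. {0..e q m i})"
      using assms by (auto simp: exponents_def)
    show "a i = a' i" if "i \<in> {1..2 * m - 2}" for i
      using combine_div_mod(1)[OF assms(2), of i a] combine_div_mod(1)[OF assms(4), of i a'] that eq by auto
  qed
  show "c = c'"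
  proof (rule PiE_ext)
    show "c \<in> PiE {1..2 * m} (\<lambda>_. {..<q})" "c' \<in> PiE {1..2 * m} (\<lambda>_. {..<q})"
      using assms by (auto simp: digits_def)
    show "c i = c' i" if "i \<in> {1..2 * m}" for i
      using combine_div_mod(2)[OF assms(2), of i a] combine_div_mod(2)[OF assms(4), of i a'] that eq by auto
  qed
qed

lemma combine_surj:
  assumes "b \<in> exponents (Suc m)"
  obtains a c where "a \<in> exponents m" "c \<in> digits m" "b = combine m a c"
proof
  let ?a = "\<lambda>i\<in>{1..2 * m - 2}. b i div q" and ?c = "\<lambda>i\<in>{1..2 * m}. b i mod q"
  have b: "b i \<le> e q (Suc m) i" if "1 \<le> i" "i \<le> 2 * m" for i
    using assms that by (auto simp: exponents_def PiE_def Pi_def)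
  show "?a \<in> exponents m"
    unfolding exponents_def
  proof (rule PiE_I)
    fix i assume "i \<in> {1..2 * m - 2}"
    then have i: "1 \<le> i" "i \<le> 2 * m - 2" "i \<le> 2 * m" by auto
    have "b i \<le> (q - 1) + q * e q m i" using b[OF i(1,3)] e_Suc_less[OF i(1,2)] by simp
    then have "b i div q \<le> ((q - 1) + q * e q m i) div q" by (rule div_le_mono)
    also have "\<dots> = e q m i" by (rule div_mod_digit) simp
    finally show "?a i \<in> {0..e q m i}" using i by simp
  qed auto
  show "?c \<in> digits m" by (auto simp: digits_def)
  show "b = combine m ?a ?c"
  proof
    fix i
    show "b i = combine m ?a ?c i"
    proof (cases "1 \<le> i \<and> i \<le> 2 * m")
      case True
      show ?thesis
      proof (cases "i \<le> 2 * m - 2")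
        case False
        then have "b i < q" using b[of i] e_Suc_last[of i m] True q_gt_1 by auto
        then show ?thesis using True False by (simp add: combine_def)
      qed (use True in \<open>simp add: combine_def\<close>)
    next
      case False
      then have "b i = undefined" using assms by (auto simp: exponents_def PiE_def extensional_def)
      then show ?thesis using False by (simp add: combine_def)
    qed
  qed
qed

lemma bij_combine: "bij_betw (\<lambda>(a, c). combine m a c) (exponents m \<times> digits m) (exponents (Suc m))"
  unfolding bij_betw_def
proof
  show "inj_on (\<lambda>(a, c). combine m a c) (exponents m \<times> digits m)"
    by (rule inj_onI) (use combine_inject in auto)
  show "(\<lambda>(a, c). combine m a c) ` (exponents m \<times> digits m) = exponents (Suc m)"
    using combine_in_exponents by (fastforce elim: combine_surj)
qed

lemma sum_combine:
  "(\<Sum>b\<in>exponents (Suc m). f b) = (\<Sum>c\<in>digits m. \<Sum>a\<in>exponents m. f (combine m a c))"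
proof -
  have "(\<Sum>b\<in>exponents (Suc m). f b) = (\<Sum>(a, c)\<in>exponents m \<times> digits m. f (combine m a c))"
    using sum.reindex_bij_betw[OF bij_combine, of f] by (simp add: case_prod_unfold)
  also have "\<dots> = (\<Sum>a\<in>exponents m. \<Sum>c\<in>digits m. f (combine m a c))"
    by (rule sum.cartesian_product[symmetric])
  finally show ?thesis by (subst sum.swap)
qed

text \<open>Stated for arbitrary g and h because it is used twice: with g the images of the forms
  under \<open>hat\<close>, and with g their q-th powers.\<close>

lemma prod_combine:
  fixes g h :: "nat \<Rightarrow> 'b::comm_monoid_mult"
  assumes "c \<in> digits m"
  shows "(\<Prod>i=1..2 * m. g i ^ (combine m a c i div q) * h i ^ (combine m a c i mod q)) =
    (\<Prod>i=1..2 * m - 2. g i ^ a i) * (\<Prod>i=1..2 * m. h i ^ c i)"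
proof -
  have "(\<Prod>i=1..2 * m. g i ^ (combine m a c i div q) * h i ^ (combine m a c i mod q)) =
      (\<Prod>i=1..2 * m. g i ^ (if i \<le> 2 * m - 2 then a i else 0)) * (\<Prod>i=1..2 * m. h i ^ c i)"
    unfolding prod.distrib[symmetric] by (rule prod.cong) (auto simp: combine_div_mod[OF assms])
  also have "(\<Prod>i=1..2 * m. g i ^ (if i \<le> 2 * m - 2 then a i else 0)) = (\<Prod>i=1..2 * m - 2. g i ^ a i)"
    by (rule prod.mono_neutral_cong_right) auto
  finally show ?thesis .
qed

text \<open>Congruent to \<open>\<Prod>\<xi>\<^sub>i\<^bsup>b\<^sub>i\<^esup>\<close> modulo the last variable, but adapted to the expansion in powers of the first one.\<close>
definition zeta :: "nat \<Rightarrow> (nat \<Rightarrow> nat) \<Rightarrow> 'a mpoly" where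
  "zeta m b = (\<Prod>i=1..2 * m. hat m (xi m i) ^ (b i div q) * xi (Suc m) i ^ (b i mod q))"

lemma zeta_combine:
  assumes "c \<in> digits m"
  shows "zeta m (combine m a c) = hat m (xi_monomial m a) * (\<Prod>i=1..2 * m. xi (Suc m) i ^ c i)"
proof -
  interpret hat: comm_ring_hom "hat m" by (rule hat_hom)
  show ?thesis
    unfolding zeta_def prod_combine[OF assms] by (simp add: xi_monomial_def hat.hom_prod hat.hom_power)
qed

lemma xi_monomial_combine:
  assumes "c \<in> digits m"
  shows "(\<Prod>i=1..2 * m. xi m i ^ combine m a c i) = xi_monomial m a ^ q * (\<Prod>i=1..2 * m. (xi m i :: 'a mpoly) ^ c i)"
proof -
  have "(\<Prod>i=1..2 * m. xi m i ^ combine m a c i) =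
      (\<Prod>i=1..2 * m. (xi m i ^ q) ^ (combine m a c i div q) * (xi m i :: 'a mpoly) ^ (combine m a c i mod q))"
    by (rule prod.cong) (simp_all flip: power_mult power_add)
  also have "\<dots> = (\<Prod>i=1..2 * m - 2. (xi m i ^ q) ^ a i) * (\<Prod>i=1..2 * m. xi m i ^ c i)"
    by (rule prod_combine[OF assms])
  also have "(\<Prod>i=1..2 * m - 2. (xi m i ^ q) ^ a i) = (xi_monomial m a :: 'a mpoly) ^ q"
    by (simp add: xi_monomial_def prod_power_distrib power_mult[symmetric] mult.commute)
  finally show ?thesis .
qed

lemma prod_const_poly: "(\<Prod>i\<in>I. [:f i:]) = [:\<Prod>i\<in>I. f i :: 'a mpoly:]"
  by (induction I rule: infinite_finite_induct) auto

lemma reduce_zeta: "reduce m (zeta m b) = [:\<Prod>i=1..2 * m. xi m i ^ b i:]"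
proof -
  have "reduce m (zeta m b) = (\<Prod>i=1..2 * m. [:(xi m i ^ q) ^ (b i div q) * xi m i ^ (b i mod q):])"
    unfolding zeta_def reduce.hom_prod reduce.hom_mult reduce.hom_power
    by (rule prod.cong) (auto simp: reduce_hat xi_in_polys_in reduce_xi poly_const_pow)
  also have "\<dots> = (\<Prod>i=1..2 * m. [:xi m i ^ b i:])"
    by (rule prod.cong) (simp_all flip: power_mult power_add)
  finally show ?thesis by (simp add: prod_const_poly)
qed

lemma reduce_xi_monomial: "reduce m (xi_monomial (Suc m) b) = [:\<Prod>i=1..2 * m. xi m i ^ b i:]"
  by (simp add: xi_monomial_def reduce.hom_prod reduce.hom_power reduce_xi poly_const_pow prod_const_poly)

section \<open>The images of the invariants of rank m\<close>

lemma hat_in_base: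
  assumes "b \<in> base m" shows "hat m b \<in> base (Suc m)"
proof -
  interpret hat: comm_ring_hom "hat m" by (rule hat_hom)
  have "H0 m \<subseteq> {b. hat m b \<in> base (Suc m)}"
    using N_in_base[of "Suc _" "Suc m"] by (auto simp: H0_eq N_inner_var[symmetric])
  moreover have "is_subalgebra {b. hat m b \<in> base (Suc m)}"
    using is_subalgebraD[OF base_subalgebra[of "Suc m"]]
    by (auto simp: is_subalgebra_def hat.hom_add hat.hom_mult)
  ultimately have "base m \<subseteq> {b. hat m b \<in> base (Suc m)}" by (rule generated_subalgebra_minimal)
  then show ?thesis using assms by blast
qed

lemma last_var_in_base: "last_var m \<in> base (Suc m)"
  using N_in_base[of "Suc (2 * m)" "Suc m"] by (simp add: N_last_var)

text \<open>The last column of g adds a multiple c z, a root of T^q - z^(q-1) T, so only the inner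
  block is seen.\<close>

lemma act_hat:
  assumes "g \<in> (P (Suc m) :: 'a mat set)" "f \<in> polys_in {..<2 * m}"
  shows "act (hat m f) g = hat m (act f (inner_block m g))"
proof (rule hom_eq_on_polys_in[OF comm_ring_hom_comp[OF act_hom hat_hom]
        comm_ring_hom_comp[OF hat_hom act_hom] assms(2)])
  fix i assume "i \<in> {..<2 * m}"
  then have i: "i < 2 * m" by simp
  let ?z = "last_var m :: 'a mpoly"
  define l where "l = shift (row_form (inner_block m g) i)"
  define c where "c = g $$ (Suc i, Suc (2 * m))"
  have v: "row_form g (Suc i) = l + mconst c * ?z"
    using act_inner_var[OF assms(1) i] by (simp add: l_def c_def)
  have z: "row_form g (Suc (2 * m)) = ?z"
    using act_last_var[OF assms(1)] by simp
  have zq: "?z ^ q = ?z * ?z ^ (q - 1)" by (metis power_Suc Suc_diff_1 q_pos)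
  have "act (hat m (mvar i)) g = (l + mconst c * ?z) ^ q - (l + mconst c * ?z) * ?z ^ (q - 1)"
    by (simp only: hat_mvar act.hom_minus act.hom_power act.hom_mult act_mvar v z)
  also have "(l + mconst c * ?z) ^ q = l ^ q + mconst c * ?z ^ q"
    using frobenius_add[of l "mconst c * ?z" 1] mconst_power_q[of c 1] by (simp add: power_mult_distrib)
  also have "l ^ q + mconst c * ?z ^ q - (l + mconst c * ?z) * ?z ^ (q - 1) = l ^ q - l * ?z ^ (q - 1)"
  proof -
    have "a + b * (d * u) - (l + b * d) * u = a - l * u" for a b d u :: "'a mpoly"
      by (simp add: algebra_simps)
    then show ?thesis unfolding zq .
  qed
  finally show "act (hat m (mvar i)) g = hat m (act (mvar i) (inner_block m g))"
    by (simp add: hat_row_form l_def)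
qed simp

lemma hat_invariant:
  assumes "f \<in> invariants m" shows "hat m f \<in> invariants (Suc m)"
proof -
  have f: "f \<in> polys_in {..<2 * m}" "\<And>g. g \<in> P m \<Longrightarrow> act f g = f"
    using assms by (auto simp: invariants_iff)
  have "{1..<2 * Suc m} \<subseteq> {..<2 * Suc m}" by auto
  then have "hat m f \<in> polys_in {..<2 * Suc m}" using hat_in_polys_in[OF f(1)] by (rule polys_in_mono)
  then show ?thesis by (simp add: invariants_iff act_hat[OF _ f(1)] f(2) inner_block_in_P)
qed

text \<open>z is transcendental over the image of \<open>hat\<close>: modulo z the constant
  coefficient becomes its q-th power, hence is 0, and then z can be cancelled.\<close>

lemma poly_map_hat_eq_0:
  assumes "\<forall>k. coeff p k \<in> polys_in {..<2 * m}" "poly (map_poly (hat m) p) (last_var m) = 0"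
  shows "p = 0"
  using assms
proof (induction p)
  case (pCons a p)
  interpret hat: comm_ring_hom "hat m" by (rule hat_hom)
  have a: "a \<in> polys_in {..<2 * m}" using pCons.prems(1)[rule_format, of 0] by simp
  have p: "\<forall>k. coeff p k \<in> polys_in {..<2 * m}"
    using pCons.prems(1) by (metis coeff_pCons_Suc)
  have eq: "hat m a + last_var m * poly (map_poly (hat m) p) (last_var m) = 0"
    using pCons.prems(2) by (simp add: Polynomial.map_poly_pCons)
  then have "reduce m (hat m a + last_var m * poly (map_poly (hat m) p) (last_var m)) = 0" by simp
  then have "a ^ q = 0"
    unfolding reduce.hom_add reduce.hom_mult reduce_hat[OF a] by (simp add: reduce_mvar)
  then have "a = 0" by simp
  then have "p = 0" using eq pCons.IH[OF p] by simp
  then show ?case using \<open>a = 0\<close> by simp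
qed simp

text \<open>As h is free of y, elementary matrices act on it as translations by multiples of z, so h
  is a polynomial in z and the products of translates. By \<open>poly_map_hat_eq_0\<close> its
  coefficients as a polynomial in z are unique, so invariance under block extensions passes to each
  of them.\<close>

lemma inner_invariantsE:
  assumes h: "h \<in> invariants (Suc m)" "h \<in> polys_in {1..<2 * Suc m}"
  obtains p where "\<forall>k. coeff p k \<in> invariants m" "h = poly (map_poly (hat m) p) (last_var m)"
proof -
  let ?l = "Suc (2 * m)" and ?J = "{1..2 * m}" and ?V = "{1..<2 * Suc m}"
  have "translation ?l j c h = h" if j: "j \<in> ?J" for j c
  proof -
    obtain i where i: "j = Suc i" "i < 2 * m" using j by (cases j) auto
    have "translation ?l j c h = act h (elementary m i c)"
      unfolding act_eq translation_def
    proof (rule substitute_cong[OF h(2)])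
      fix k assume "k \<in> ?V"
      then consider "k = Suc (2 * m)" | k' where "k = Suc k'" "k' < 2 * m" by (cases k) force+
      then show "mvar k + (if k = j then mconst c * last_var m else 0) = row_form (elementary m i c) k"
        by cases (use i row_form_elementary[OF i(2)] in auto)
    qed
    then show ?thesis using h(1) elementary_in_P[OF i(2), of c] by (simp add: invariants_iff)
  qed
  then obtain s0 where s0: "h = substitute (additive_subst ?l ?J) s0"
    using translation_invariant_polynomial[of ?J ?l h] by auto
  define \<sigma> where "\<sigma> = (additive_subst ?l ?J :: nat \<Rightarrow> 'a mpoly)"
  \<comment> \<open>\<open>s0\<close> may involve variables outside \<open>?V\<close>; they can be
    set to 0 because h does not contain them.\<close>
  define \<pi> where "\<pi> = (\<lambda>i. if i \<in> ?V then mvar i else 0 :: 'a mpoly)"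
  define s where "s = substitute \<pi> s0"
  have s: "s \<in> polys_in ?V"
    unfolding s_def \<pi>_def by (rule substitute_in_polys_in[OF polys_in_UNIV]) auto
  have "h = substitute \<pi> h" using h(2) unfolding polys_in_iff_substitute \<pi>_def by simp
  also have "\<dots> = substitute \<sigma> s"
    unfolding s_def s0 substitute_substitute \<sigma>_def
    by (rule arg_cong[where f = "\<lambda>\<sigma>. substitute \<sigma> s0"])
      (auto simp: fun_eq_iff additive_subst_def \<pi>_def substitute.hom_minus substitute.hom_power substitute.hom_mult)
  finally have rs: "h = substitute \<sigma> s" .
  define unshift where "unshift = substitute (\<lambda>i. mvar (i - 1) :: 'a mpoly)"
  define p where "p = map_poly unshift (as_poly ?l s)"
  have unshift: "comm_ring_hom unshift" unfolding unshift_def by (rule substitute_hom)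
  interpret unshift: comm_ring_hom unshift by (rule unshift)
  interpret hat: comm_ring_hom "hat m" by (rule hat_hom)
  have cs: "coeff (as_poly ?l s) k \<in> polys_in {1..2 * m}" for k
  proof (rule polys_in_mono)
    show "coeff (as_poly ?l s) k \<in> polys_in (?V - {?l})" by (rule coeff_as_poly_in_polys_in[OF s])
  qed auto
  have cp: "coeff p k \<in> polys_in {..<2 * m}" for k
  proof -
    have "coeff p k = unshift (coeff (as_poly ?l s) k)" by (simp add: p_def coeff_map_poly)
    also have "\<dots> \<in> polys_in {..<2 * m}"
      unfolding unshift_def by (rule substitute_in_polys_in[OF cs]) auto
    finally show ?thesis .
  qed
  have hu: "hat m (unshift f) = substitute \<sigma> f" if "f \<in> polys_in {1..2 * m}" for f
    by (rule hom_eq_on_polys_in[OF comm_ring_hom_comp[OF hat_hom unshift] substitute_hom that])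
      (auto simp: unshift_def \<sigma>_def additive_subst_def)
  have "map_poly (hat m) p = map_poly (substitute \<sigma>) (as_poly ?l s)"
    by (rule poly_eqI) (simp add: p_def coeff_map_poly hu[OF cs])
  then have "poly (map_poly (hat m) p) (last_var m) = substitute (\<sigma>(?l := last_var m)) s"
    by (simp add: poly_map_poly_as_poly)
  also have "\<sigma>(?l := last_var m) = \<sigma>" by (auto simp: \<sigma>_def additive_subst_def)
  finally have rp: "h = poly (map_poly (hat m) p) (last_var m)" using rs by simp
  have "act (coeff p k) g = coeff p k" if g: "g \<in> P m" for k and g :: "'a mat"
  proof -
    have g': "g \<in> carrier_mat (2 * m) (2 * m)" by (rule P_carrier[OF g])
    \<comment> \<open>The defect of invariance of all coefficients at once; it vanishes because its
      image under \<open>hat\<close>, evaluated at z, does.\<close>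
    define p' where "p' = map_poly (\<lambda>f. act f g) p - p"
    have "act h (block_extend m g) = poly (map_poly (\<lambda>f. act f (block_extend m g)) (map_poly (hat m) p)) (last_var m)"
      unfolding rp act.poly_map_poly[symmetric] act_mvar row_form_block_extend(2) ..
    also have "map_poly (\<lambda>f. act f (block_extend m g)) (map_poly (hat m) p) = map_poly (hat m) (map_poly (\<lambda>f. act f g) p)"
      by (rule poly_eqI) (simp add: coeff_map_poly act_block_extend_hat[OF g' cp])
    finally have "poly (map_poly (hat m) (map_poly (\<lambda>f. act f g) p)) (last_var m) = poly (map_poly (hat m) p) (last_var m)"
      using h(1) block_extend_in_P[OF g] rp by (simp add: invariants_iff)
    moreover have "map_poly (hat m) p' = map_poly (hat m) (map_poly (\<lambda>f. act f g) p) - map_poly (hat m) p"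
      unfolding p'_def by (rule poly_eqI) (simp add: coeff_map_poly hat.hom_minus)
    ultimately have "poly (map_poly (hat m) p') (last_var m) = 0" by simp
    moreover have "coeff p' k \<in> polys_in {..<2 * m}" for k
      using act_in_S[OF g', of "coeff p k"] cp[of k]
      by (simp add: p'_def coeff_map_poly S_eq_polys_in polys_in_diff)
    ultimately have "p' = 0" by (intro poly_map_hat_eq_0) auto
    then have "coeff p' k = 0" by simp
    then show ?thesis by (simp add: p'_def coeff_map_poly)
  qed
  then have "\<forall>k. coeff p k \<in> invariants m" using cp by (auto simp: invariants_iff)
  then show thesis using rp by (rule that)
qed

text \<open>Each coefficient of a power of z is expanded in rank m and carried over by
  \<open>hat\<close>; the powers of z are absorbed by the base algebra.\<close>

lemma inner_invariants_span:
  assumes span: "invariants m \<subseteq> span_over (base m) (exponents m) (xi_monomial m)"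
    and "h \<in> invariants (Suc m)" "h \<in> polys_in {1..<2 * Suc m}"
  shows "h \<in> span_over (base (Suc m)) (exponents m) (\<lambda>a. hat m (xi_monomial m a))"
proof -
  interpret hat: comm_ring_hom "hat m" by (rule hat_hom)
  obtain p where p: "\<forall>k. coeff p k \<in> invariants m" "h = poly (map_poly (hat m) p) (last_var m)"
    using inner_invariantsE[OF assms(2,3)] by blast
  have hat: "hat m f \<in> span_over (base (Suc m)) (exponents m) (\<lambda>a. hat m (xi_monomial m a))"
    if f: "f \<in> invariants m" for f
  proof -
    obtain c where "\<forall>a\<in>exponents m. c a \<in> base m" "f = (\<Sum>a\<in>exponents m. c a * xi_monomial m a)"
      using span f unfolding span_over_def by blast
    then show ?thesis unfolding span_over_def
      by (auto intro!: exI[of _ "\<lambda>a. hat m (c a)"] hat_in_base simp: hat.hom_sum hat.hom_mult)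
  qed
  have "h = (\<Sum>k\<le>degree (map_poly (hat m) p). last_var m ^ k * hat m (coeff p k))"
    unfolding p(2) by (simp add: poly_altdef coeff_map_poly mult.commute)
  then show ?thesis
    using p(1) hat
    by (simp only:) (intro span_over_sum[OF base_subalgebra] span_over_mult[OF base_subalgebra]
        subalgebra_power[OF base_subalgebra] last_var_in_base, blast)
qed

section \<open>Relations modulo the last variable\<close>

lemma frobenius_independent:
  assumes indep: "independent_over (base m) (exponents m) (xi_monomial m)"
    and b: "\<forall>a\<in>exponents (Suc m). b a \<in> base m"
    and rel: "(\<Sum>a\<in>exponents (Suc m). b a ^ q * (\<Prod>i=1..2 * m. xi m i ^ a i)) = 0"
  shows "\<forall>a\<in>exponents (Suc m). b a = 0"
proof -
  interpret frob: comm_ring_hom "\<lambda>f :: 'a mpoly. f ^ q" by (rule frobenius_hom_1)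
  \<comment> \<open>By additivity of q-th powers, the relation collects into digit monomials with
    coefficients the q-th powers of the \<open>f c\<close>.\<close>
  define f where "f c = (\<Sum>a\<in>exponents m. b (combine m a c) * xi_monomial m a)" for c
  have "(\<Sum>c\<in>digits m. f c ^ q * (\<Prod>i=1..2 * m. xi m i ^ c i)) = 0"
  proof -
    have "(\<Sum>c\<in>digits m. f c ^ q * (\<Prod>i=1..2 * m. xi m i ^ c i)) =
        (\<Sum>c\<in>digits m. \<Sum>a\<in>exponents m. b (combine m a c) ^ q * (\<Prod>i=1..2 * m. xi m i ^ combine m a c i))"
      unfolding f_def frob.hom_sum frob.hom_mult sum_distrib_right
      by (intro sum.cong refl) (simp only: xi_monomial_combine mult.assoc)
    then show ?thesis using rel by (simp add: sum_combine)
  qed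
  moreover have "{0<..2 * m} = {1..2 * m}" by auto
  ultimately have f: "f c = 0" if "c \<in> digits m" for c
    using xi_monomials_independent[of 0 m f c] that by (simp add: digits_def)
  show ?thesis
  proof
    fix a assume "a \<in> exponents (Suc m)"
    then obtain a' c where ac: "a' \<in> exponents m" "c \<in> digits m" "a = combine m a' c"
      by (rule combine_surj)
    have "\<forall>a'\<in>exponents m. b (combine m a' c) \<in> base m"
      using b combine_in_exponents[OF _ ac(2)] by blast
    then have "\<forall>a'\<in>exponents m. b (combine m a' c) = 0"
      using f[OF ac(2)] spec[OF indep[unfolded independent_over_def], of "\<lambda>a'. b (combine m a' c)"]
      unfolding f_def by blast
    then show "b a = 0" using ac by blast
  qed
qed

lemma poly_hat_in_base:
  assumes "\<forall>k. coeff p k \<in> base m" "x \<in> base (Suc m)" shows "poly (map_poly (hat m) p) x \<in> base (Suc m)"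
proof -
  interpret hat: comm_ring_hom "hat m" by (rule hat_hom)
  show ?thesis
    unfolding poly_altdef
    by (intro subalgebra_sum[OF base_subalgebra] is_subalgebraD(3)[OF base_subalgebra]
        subalgebra_power[OF base_subalgebra] assms(2))
      (simp add: coeff_map_poly hat_in_base assms(1))
qed

text \<open>The generators of \<open>base (Suc m)\<close> are N(y), z, and the images under
  \<open>hat\<close> of the generators of rank m. The elements of this shape form a subalgebra,
  since all cross terms with z can be moved into b'.\<close>

lemma base_decompose:
  assumes "b \<in> base (Suc m)"
  shows "\<exists>p b'. (\<forall>k. coeff p k \<in> base m) \<and> b' \<in> base (Suc m) \<and>
    b = poly (map_poly (hat m) p) (N (Suc m) (mvar 0)) + last_var m * b'"
proof -
  interpret hat: comm_ring_hom "hat m" by (rule hat_hom)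
  interpret mh: comm_ring_hom "map_poly (hat m)" by (rule map_poly_hom[OF hat_hom])
  let ?N = "N (Suc m) (mvar 0) :: 'a mpoly" and ?z = "last_var m :: 'a mpoly"
  let ?Q = "\<lambda>b p b'. (\<forall>k. coeff p k \<in> base m) \<and> b' \<in> base (Suc m) \<and>
    b = poly (map_poly (hat m) p) ?N + ?z * b'"
  note sub = base_subalgebra[of m] and sub' = base_subalgebra[of "Suc m"]
  note D = is_subalgebraD[OF sub] is_subalgebraD[OF sub'] subalgebra_0[OF sub] subalgebra_0[OF sub']
    subalgebra_1[OF sub] subalgebra_1[OF sub']
  have N: "?N \<in> base (Suc m)" by (rule N_in_base) simp
  have const: "?Q (hat m a) [:a:] 0" if "a \<in> base m" for a
    using that D by (auto simp: Polynomial.map_poly_pCons coeff_pCons split: nat.splits)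
  have "is_subalgebra {b. \<exists>p b'. ?Q b p b'}"
    unfolding is_subalgebra_def
  proof (intro conjI ballI subsetI)
    fix f :: "'a mpoly" assume "f \<in> range mconst"
    then obtain c where c: "f = hat m (mconst c)" by auto
    show "f \<in> {b. \<exists>p b'. ?Q b p b'}"
      unfolding c using const[OF D(1)] by blast
  next
    fix f g assume "f \<in> {b. \<exists>p b'. ?Q b p b'}" "g \<in> {b. \<exists>p b'. ?Q b p b'}"
    then obtain p f' s g' where f: "?Q f p f'" and g: "?Q g s g'" by blast
    have "?Q (f + g) (p + s) (f' + g')"
      using f g D by (auto simp: mh.hom_add algebra_simps)
    then show "f + g \<in> {b. \<exists>p b'. ?Q b p b'}" by blast
    define u where "u = poly (map_poly (hat m) p) ?N"
    define v where "v = poly (map_poly (hat m) s) ?N"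
    have uv: "u \<in> base (Suc m)" "v \<in> base (Suc m)"
      unfolding u_def v_def using f g N by (auto intro: poly_hat_in_base)
    have "f * g = u * v + ?z * (u * g' + f' * v + ?z * f' * g')"
      using f g by (simp add: u_def v_def algebra_simps)
    moreover have "u * g' + f' * v + ?z * f' * g' \<in> base (Suc m)"
      using uv f g last_var_in_base by (intro D) auto
    moreover have "coeff (p * s) k \<in> base m" for k
      using f g unfolding coeff_mult by (intro subalgebra_sum[OF sub] D) auto
    ultimately have "?Q (f * g) (p * s) (u * g' + f' * v + ?z * f' * g')"
      by (simp add: mh.hom_mult u_def v_def)
    then show "f * g \<in> {b. \<exists>p b'. ?Q b p b'}" by blast
  qed
  moreover have "H0 (Suc m) \<subseteq> {b. \<exists>p b'. ?Q b p b'}"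
  proof
    fix h :: "'a mpoly" assume "h \<in> H0 (Suc m)"
    then obtain i where i: "i < 2 * Suc m" "h = N (Suc m) (mvar i)" by (auto simp: H0_eq)
    then consider "i = 0" | j where "i = Suc j" "j < 2 * m" | "i = Suc (2 * m)" by (cases i) force+
    then show "h \<in> {b. \<exists>p b'. ?Q b p b'}"
    proof cases
      case 1
      then have "?Q h [:0, 1:] 0"
        using D i by (auto simp: Polynomial.map_poly_pCons coeff_pCons split: nat.splits)
      then show ?thesis by blast
    next
      case 2
      then have "?Q h [:N m (mvar j):] 0"
        using const[OF N_in_base[OF 2(2)]] i by (simp add: N_inner_var)
      then show ?thesis by blast
    next
      case 3
      then have "?Q h 0 1" using D i by (simp add: N_last_var)
      then show ?thesis by blast
    qed
  qed
  ultimately have "base (Suc m) \<subseteq> {b. \<exists>p b'. ?Q b p b'}" by (rule generated_subalgebra_minimal[rotated])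
  then show ?thesis using assms by blast
qed

lemma reduce_first_form:
  assumes "l \<in> polys_in {1..<2 * Suc m}" shows "reduce m (mvar 0 + l) = [:poly (reduce m l) 0, 1:]"
proof -
  define c where "c = poly (reduce m l) 0"
  have "reduce m l = [:poly (reduce m l) 0:]"
    by (rule hom_eq_on_polys_in[OF reduce.comm_ring_hom_axioms
          comm_ring_hom_comp[OF const_poly_hom comm_ring_hom_comp[OF poly_hom reduce.comm_ring_hom_axioms]] assms])
      (auto simp: reduce_mvar)
  then have "reduce m l = [:c:]" unfolding c_def .
  then show ?thesis unfolding c_def[symmetric] by (simp add: reduce.hom_add reduce_mvar)
qed

lemma degree_prod_monic_linear:
  fixes f :: "'i \<Rightarrow> 'a mpoly poly"
  assumes "\<And>x. x \<in> I \<Longrightarrow> \<exists>l. f x = [:l, 1:]"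
  shows "degree (\<Prod>x\<in>I. f x) = card I" "lead_coeff (\<Prod>x\<in>I. f x) = 1"
proof -
  have f: "degree (f x) = 1" "lead_coeff (f x) = 1" "f x \<noteq> 0" if "x \<in> I" for x
    using assms[OF that] by auto
  then show "degree (\<Prod>x\<in>I. f x) = card I"
    by (subst degree_prod_eq_sum_degree) auto
  show "lead_coeff (\<Prod>x\<in>I. f x) = 1"
    unfolding lead_coeff_prod using f by (intro prod.neutral) auto
qed

abbreviation first_orbit :: "nat \<Rightarrow> 'a mpoly set" where
  "first_orbit m \<equiv> act (mvar 0) ` P (Suc m)"

lemma degree_reduce_N: "degree (reduce m (N (Suc m) (mvar 0 :: 'a mpoly))) = card (first_orbit m)"
  unfolding N_def reduce.hom_prod
proof (rule degree_prod_monic_linear(1))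
  fix x assume "x \<in> first_orbit m"
  then show "\<exists>l. reduce m x = [:l, 1:]"
    by (rule first_orbit_form) (auto simp only: reduce_first_form)
qed

lemma as_poly_N:
  "degree (as_poly 0 (N (Suc m) (mvar 0 :: 'a mpoly))) = card (first_orbit m)"
  "lead_coeff (as_poly 0 (N (Suc m) (mvar 0 :: 'a mpoly))) = 1"
proof -
  have "\<exists>l. as_poly 0 x = [:l, 1:]" if x: "x \<in> first_orbit m" for x
  proof -
    obtain l where l: "x = mvar 0 + l" "l \<in> polys_in {1..<2 * Suc m}"
      using first_orbit_form[OF x] by blast
    then have "as_poly 0 x = [:l, 1:]"
      using as_poly_const[OF l(2), of 0] by (simp add: as_poly.hom_add as_poly_mvar)
    then show ?thesis by blast
  qed
  then show "degree (as_poly 0 (N (Suc m) (mvar 0 :: 'a mpoly))) = card (first_orbit m)"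
    "lead_coeff (as_poly 0 (N (Suc m) (mvar 0 :: 'a mpoly))) = 1"
    unfolding N_def as_poly.hom_prod by (rule degree_prod_monic_linear; blast)+
qed

text \<open>Modulo z each coefficient becomes a polynomial in R, the reduction of N(y), whose
  coefficients are q-th powers from rank m. R has positive degree in y, so coefficients of powers of
  R can be compared, and \<open>frobenius_independent\<close> kills each of them. The family \<zeta>
  is left open to serve both \<open>zeta\<close> and the monomials in the forms.\<close>

lemma relation_mod_last_var:
  assumes odd: "odd q" and indep: "independent_over (base m) (exponents m) (xi_monomial m)"
    and b: "\<forall>a\<in>exponents (Suc m). b a \<in> base (Suc m)"
    and \<zeta>: "\<And>a. reduce m (\<zeta> a) = [:\<Prod>i=1..2 * m. xi m i ^ a i:]"
    and rel: "reduce m (\<Sum>a\<in>exponents (Suc m). b a * \<zeta> a) = 0"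
  shows "\<exists>b'. \<forall>a\<in>exponents (Suc m). b' a \<in> base (Suc m) \<and> b a = last_var m * b' a"
proof -
  let ?N = "N (Suc m) (mvar 0) :: 'a mpoly" and ?E = "exponents (Suc m)"
  define R where "R = reduce m ?N"
  define xm where "xm a = (\<Prod>i=1..2 * m. xi m i ^ a i :: 'a mpoly)" for a
  have "\<forall>a\<in>?E. \<exists>p b'. (\<forall>k. coeff p k \<in> base m) \<and> b' \<in> base (Suc m) \<and>
      b a = poly (map_poly (hat m) p) ?N + last_var m * b'"
    using b base_decompose by blast
  then obtain p b' where p: "\<And>a k. a \<in> ?E \<Longrightarrow> coeff (p a) k \<in> base m"
    and b': "\<And>a. a \<in> ?E \<Longrightarrow> b' a \<in> base (Suc m)"
    and eq: "\<And>a. a \<in> ?E \<Longrightarrow> b a = poly (map_poly (hat m) (p a)) ?N + last_var m * b' a"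
    by metis
  have base_polys: "f \<in> polys_in {..<2 * m}" if "f \<in> base m" for f
    using that base_subset_invariants[of m] by (auto simp: invariants_iff)
  have zero_pow: "(0 :: 'a mpoly) ^ q = 0" by (simp add: zero_power)
  have red: "reduce m (poly (map_poly (hat m) s) ?N) = pcompose (map_poly (\<lambda>f. f ^ q) s) R"
    if "\<forall>k. coeff s k \<in> base m" for s
    using that
  proof (induction s)
    case (pCons f s)
    interpret hat: comm_ring_hom "hat m" by (rule hat_hom)
    have f: "f \<in> base m" using pCons.prems[rule_format, of 0] by simp
    have s: "\<forall>k. coeff s k \<in> base m" using pCons.prems by (metis coeff_pCons_Suc)
    show ?case
      using pCons.IH[OF s] reduce_hat[OF base_polys[OF f]] zero_pow
      by (simp add: Polynomial.map_poly_pCons reduce.hom_add reduce.hom_mult pcompose_pCons R_def)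
  qed simp
  have "reduce m (\<Sum>a\<in>?E. b a * \<zeta> a) = (\<Sum>a\<in>?E. pcompose (map_poly (\<lambda>f. f ^ q) (p a)) R * [:xm a:])"
    unfolding reduce.hom_sum
  proof (rule sum.cong[OF refl])
    fix a assume a: "a \<in> ?E"
    show "reduce m (b a * \<zeta> a) = pcompose (map_poly (\<lambda>f. f ^ q) (p a)) R * [:xm a:]"
      using red[of "p a"] p[OF a]
      by (simp add: eq[OF a] reduce.hom_mult reduce.hom_add \<zeta> reduce_mvar xm_def)
  qed
  also have "\<dots> = pcompose (\<Sum>a\<in>?E. map_poly (\<lambda>f. f ^ q) (p a) * [:xm a:]) R"
    by (simp only: pcompose_hom.hom_sum pcompose_mult pcompose_const)
  finally have "pcompose (\<Sum>a\<in>?E. map_poly (\<lambda>f. f ^ q) (p a) * [:xm a:]) R = 0" using rel by simp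
  moreover have "degree R > 0"
    unfolding R_def degree_reduce_N using card_first_orbit(2)[OF odd] .
  ultimately have 0: "(\<Sum>a\<in>?E. map_poly (\<lambda>f. f ^ q) (p a) * [:xm a:]) = 0" by (rule pcompose_eq_0)
  have "(\<Sum>a\<in>?E. coeff (p a) k ^ q * xm a) = 0" for k
  proof -
    have "coeff (\<Sum>a\<in>?E. map_poly (\<lambda>f. f ^ q) (p a) * [:xm a:]) k = (\<Sum>a\<in>?E. coeff (p a) k ^ q * xm a)"
      by (simp add: coeff_sum coeff_map_poly zero_pow mult.commute)
    then show ?thesis unfolding 0 by simp
  qed
  then have "coeff (p a) k = 0" if "a \<in> ?E" for a k
    using frobenius_independent[OF indep, of "\<lambda>a. coeff (p a) k"] p that by (auto simp: xm_def)
  then have "p a = 0" if "a \<in> ?E" for a using that by (simp add: poly_eq_iff)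
  then show ?thesis using eq b' by (intro exI[of _ b']) simp
qed

section \<open>Leading coefficients with respect to the first variable\<close>

lemma as_poly_first_shift: "f \<in> polys_in {..<2 * m} \<Longrightarrow> as_poly 0 (shift f) = [:shift f:]"
  by (rule as_poly_const[OF shift_in_polys_in]) auto

text \<open>These degrees are the place values of base q, which lets products of the forms reach
  prescribed degrees in y. The price is the leading coefficient z, to be cancelled later.\<close>

lemma as_poly_xi:
  assumes "1 \<le> i"
  shows "degree (as_poly 0 (xi (Suc m) i :: 'a mpoly)) = q ^ (i - 1)"
    and "lead_coeff (as_poly 0 (xi (Suc m) i)) = (last_var m :: 'a mpoly)"
proof -
  have shift: "as_poly 0 (shift (xi m i)) = [:shift (xi m i) :: 'a mpoly:]"
    by (rule as_poly_first_shift[OF xi_in_polys_in[OF assms]])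
  have "degree (as_poly 0 (xi (Suc m) i :: 'a mpoly)) = q ^ (i - 1) \<and>
    lead_coeff (as_poly 0 (xi (Suc m) i)) = (last_var m :: 'a mpoly)"
  proof (cases "i = 1")
    case True
    have "as_poly 0 (xi (Suc m) 1) = [:shift (xi m 1), last_var m :: 'a mpoly:]"
      by (rule xi_Suc[of 1 m])
        (use shift True in \<open>simp_all add: as_poly.hom_add as_poly.hom_mult as_poly_mvar\<close>)
    then show ?thesis using True by simp
  next
    case False
    then have i: "2 \<le> i" using assms by simp
    let ?Q = "q ^ (i - 1)" and ?p = "as_poly 0 (xi (Suc m) i :: 'a mpoly)"
    have "q ^ 1 \<le> ?Q" using i q_gt_1 by (intro power_increasing) auto
    then have Q: "1 < ?Q" using q_gt_1 by simp
    have "as_poly 0 (last_var m) = [:last_var m :: 'a mpoly:]" by (simp add: as_poly_mvar)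
    then have p: "?p = monom (last_var m) ?Q + monom (last_var m ^ ?Q) 1 + [:shift (xi m i):]"
      unfolding xi_Suc_ge_2[OF i] as_poly.hom_add as_poly.hom_mult as_poly.hom_power shift
      by (simp add: as_poly_mvar monom_altdef poly_const_pow)
    have c: "coeff ?p ?Q = last_var m"
      unfolding p using Q q_gt_1 by (simp add: coeff_pCons split: nat.splits)
    have "degree ?p \<le> ?Q"
      unfolding p using Q
      by (intro degree_add_le order_trans[OF degree_monom_le]) auto
    moreover have "?Q \<le> degree ?p" using c by (intro le_degree) simp
    ultimately show ?thesis using c by simp
  qed
  then show "degree (as_poly 0 (xi (Suc m) i :: 'a mpoly)) = q ^ (i - 1)"
    and "lead_coeff (as_poly 0 (xi (Suc m) i)) = (last_var m :: 'a mpoly)" by auto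
qed

lemma act_in_polys_in:
  assumes g: "g \<in> (P (Suc m) :: 'a mat set)" and f: "f \<in> polys_in {1..<2 * Suc m}"
  shows "act f g \<in> polys_in {1..<2 * Suc m}"
  unfolding act_eq
proof (rule substitute_in_polys_in[OF f])
  fix k assume "k \<in> {1..<2 * Suc m}"
  then consider "k = Suc (2 * m)" | i where "k = Suc i" "i < 2 * m" by (cases k) force+
  then show "row_form g k \<in> polys_in {1..<2 * Suc m}"
  proof cases
    case 1
    then show ?thesis using act_last_var[OF g] by simp
  next
    case 2
    have "row_form (inner_block m g) i \<in> polys_in {..<2 * m}"
      by (rule row_form_in_polys_in) (simp add: inner_block_def)
    then have "shift (row_form (inner_block m g) i) \<in> polys_in {1..2 * m}" by (rule shift_in_polys_in)
    then have "shift (row_form (inner_block m g) i) \<in> polys_in {1..<2 * Suc m}"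
      by (rule polys_in_mono[rotated]) auto
    then show ?thesis
      using act_inner_var[OF g 2(2)] 2(1) by (auto intro!: polys_in_add polys_in_mult)
  qed
qed

text \<open>An element g sends y to y + l with l free of y, and sends the other variables to forms
  free of y. Replacing y by y + l preserves the leading coefficient, so g must fix it.\<close>

lemma lead_coeff_invariant:
  assumes "f \<in> invariants (Suc m)"
  shows "lead_coeff (as_poly 0 f) \<in> invariants (Suc m)"
    and "lead_coeff (as_poly 0 f) \<in> (polys_in {1..<2 * Suc m} :: 'a mpoly set)"
proof -
  let ?h = "lead_coeff (as_poly 0 f)"
  have f: "f \<in> polys_in {..<2 * Suc m}" "\<And>g. g \<in> P (Suc m) \<Longrightarrow> act f g = f"
    using assms by (auto simp: invariants_iff)
  have "{..<2 * Suc m} - {0} \<subseteq> {1..<2 * Suc m}" by auto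
  then show h: "?h \<in> polys_in {1..<2 * Suc m}"
    by (rule polys_in_mono) (rule coeff_as_poly_in_polys_in[OF f(1)])
  have "act ?h g = ?h" if g: "g \<in> P (Suc m)" for g
  proof -
    obtain l where l: "act (mvar 0) g = mvar 0 + l" "l \<in> polys_in {1..<2 * Suc m}"
      using first_orbit_form[of "act (mvar 0) g" m] g by blast
    define p where "p = map_poly (\<lambda>f. act f g) (as_poly 0 f)"
    have "as_poly 0 (act f g) = pcompose (map_poly (\<lambda>f. act f g) (as_poly 0 f)) [:l, 1:]"
    proof (rule hom_eq_on_polys_in[OF _ _ f(1)])
      show "comm_ring_hom (\<lambda>f. as_poly 0 (act f g))"
        by (rule comm_ring_hom_comp[OF as_poly.comm_ring_hom_axioms act_hom])
      show "comm_ring_hom (\<lambda>f. pcompose (map_poly (\<lambda>f. act f g) (as_poly 0 f)) [:l, 1:])"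
        by (rule comm_ring_hom_comp[OF pcompose_hom comm_ring_hom_comp[OF map_poly_hom[OF act_hom]
                as_poly.comm_ring_hom_axioms]])
      fix i assume i: "i \<in> {..<2 * Suc m}"
      show "as_poly 0 (act (mvar i) g) = pcompose (map_poly (\<lambda>f. act f g) (as_poly 0 (mvar i))) [:l, 1:]"
      proof (cases "i = 0")
        case True
        have "as_poly 0 (act (mvar 0) g) = [:l, 1:]"
          using as_poly_const[OF l(2), of 0] unfolding l(1) by (simp add: as_poly.hom_add as_poly_mvar)
        then show ?thesis
          using True by (simp add: as_poly_mvar Polynomial.map_poly_pCons pcompose_pCons)
      next
        case False
        then have "act (mvar i) g \<in> polys_in {1..<2 * Suc m}"
          using i by (intro act_in_polys_in[OF g]) auto
        then have "as_poly 0 (act (mvar i) g) = [:act (mvar i) g:]" by (rule as_poly_const) simp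
        then show ?thesis using False by (simp add: as_poly_mvar Polynomial.map_poly_pCons)
      qed
    qed (simp add: Polynomial.map_poly_pCons)
    then have eq: "as_poly 0 f = pcompose p [:l, 1:]" unfolding f(2)[OF g] p_def .
    have "degree (as_poly 0 f) = degree p" unfolding eq by (simp add: degree_pcompose)
    moreover have "lead_coeff (as_poly 0 f) = lead_coeff p" unfolding eq by (subst lead_coeff_comp) auto
    ultimately have "?h = coeff p (degree (as_poly 0 f))" by simp
    then show ?thesis by (simp add: p_def coeff_map_poly)
  qed
  moreover have "?h \<in> polys_in {..<2 * Suc m}"
    by (rule polys_in_mono[OF _ h]) auto
  ultimately show "?h \<in> invariants (Suc m)" by (simp add: invariants_iff)
qed

section \<open>The invariants are spanned\<close>

lemma zeta_invariant: "zeta m b \<in> invariants (Suc m)"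
  unfolding zeta_def
  by (intro subalgebra_prod[OF invariants_subalgebra] is_subalgebraD(3)[OF invariants_subalgebra]
      subalgebra_power[OF invariants_subalgebra] hat_invariant xi_invariant) auto

lemma xi_monomial_invariant: "xi_monomial m b \<in> invariants m"
  unfolding xi_monomial_def
  by (intro subalgebra_prod[OF invariants_subalgebra] subalgebra_power[OF invariants_subalgebra]
      xi_invariant) auto

lemma finite_exponents': "finite (exponents m)"
  unfolding exponents_def by (rule finite_exponents)

abbreviation zeta_span :: "nat \<Rightarrow> 'a mpoly set" where
  "zeta_span m \<equiv> span_over (base (Suc m)) (exponents (Suc m)) (zeta m)"

lemma last_var_power_mult_in_zeta_span:
  assumes odd: "odd q" and span: "invariants m \<subseteq> span_over (base m) (exponents m) (xi_monomial m)"
    and "f \<in> invariants (Suc m)"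
  shows "\<exists>k. last_var m ^ k * f \<in> zeta_span m"
  using assms(3)
proof (induction "degree (as_poly 0 f)" arbitrary: f rule: less_induct)
  case less
  note sub = base_subalgebra[of "Suc m"] and inv = invariants_subalgebra[of "Suc m"]
  define d where "d = degree (as_poly 0 f)"
  define h where "h = lead_coeff (as_poly 0 f)"
  define orb where "orb = card (first_orbit m)"
  \<comment> \<open>The degree d is divided by the degree of N(y). The remainder j is below q^(2m)
    and is written with 2m digits in base q, so that t below has degree exactly d in y.\<close>
  define k where "k = d div orb"
  define j where "j = d mod orb"
  define c where "c = (\<lambda>i\<in>{1..2 * m}. j div q ^ (i - 1) mod q)"
  define s where "s = (\<Sum>i=1..2 * m. c i)"
  define t where "t = N (Suc m) (mvar 0) ^ k * (\<Prod>i=1..2 * m. xi (Suc m) i ^ c i :: 'a mpoly)"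
  have orb: "0 < orb" "orb \<le> q ^ (2 * m)" using card_first_orbit[OF odd] by (auto simp: orb_def)
  have c: "c \<in> digits m" by (auto simp: c_def digits_def)
  have "j < orb" using orb by (simp add: j_def)
  then have "j < q ^ (2 * m)" using orb(2) by (rule less_le_trans)
  then have "(\<Sum>i<2 * m. (j div q ^ i) mod q * q ^ i) = j"
    using sum_digits[OF q_gt_1, of j "2 * m"] by simp
  moreover have "(\<Sum>i=1..2 * m. c i * q ^ (i - 1)) = (\<Sum>i<2 * m. (j div q ^ i) mod q * q ^ i)"
    by (simp add: sum.atLeast1_atMost_eq c_def)
  ultimately have j: "(\<Sum>i=1..2 * m. c i * q ^ (i - 1)) = j" by simp
  have xi0: "as_poly 0 (xi (Suc m) i :: 'a mpoly) \<noteq> 0" if "1 \<le> i" for i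
    using as_poly_xi(2)[OF that, of m] by auto
  have N0: "as_poly 0 (N (Suc m) (mvar 0 :: 'a mpoly)) \<noteq> 0" using as_poly_N(2)[of m] by auto
  have t: "degree (as_poly 0 t) = d" "lead_coeff (as_poly 0 t) = last_var m ^ s"
  proof -
    let ?x = "\<Prod>i=1..2 * m. as_poly 0 (xi (Suc m) i :: 'a mpoly) ^ c i"
    have at: "as_poly 0 t = as_poly 0 (N (Suc m) (mvar 0)) ^ k * ?x"
      by (simp add: t_def as_poly.hom_mult as_poly.hom_power as_poly.hom_prod)
    have x0: "?x \<noteq> 0" using xi0 by auto
    have "degree ?x = (\<Sum>i=1..2 * m. degree (as_poly 0 (xi (Suc m) i :: 'a mpoly) ^ c i))"
      using xi0 by (intro degree_prod_eq_sum_degree) auto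
    also have "\<dots> = (\<Sum>i=1..2 * m. c i * q ^ (i - 1))"
      by (intro sum.cong refl) (simp add: degree_power_eq xi0 as_poly_xi)
    finally have "degree ?x = j" by (simp only: j)
    have "degree (as_poly 0 t) = degree (as_poly 0 (N (Suc m) (mvar 0 :: 'a mpoly)) ^ k) + degree ?x"
      unfolding at using N0 x0 by (intro degree_mult_eq) auto
    also have "\<dots> = k * orb + j"
      unfolding degree_power_eq[OF N0] as_poly_N(1) orb_def \<open>degree ?x = j\<close>
      by (simp only: mult.commute)
    also have "\<dots> = d" unfolding k_def j_def by (rule div_mult_mod_eq)
    finally show "degree (as_poly 0 t) = d" .
    have "lead_coeff ?x = (\<Prod>i=1..2 * m. last_var m ^ c i)"
      unfolding lead_coeff_prod lead_coeff_power by (intro prod.cong refl) (simp only: as_poly_xi(2) atLeastAtMost_iff)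
    then show "lead_coeff (as_poly 0 t) = last_var m ^ s"
      unfolding at lead_coeff_mult lead_coeff_power as_poly_N(2) by (simp add: s_def power_sum)
  qed
  have h: "h \<in> invariants (Suc m)" "h \<in> polys_in {1..<2 * Suc m}"
    unfolding h_def using lead_coeff_invariant[OF less.prems] by auto
  have N_base: "N (Suc m) (mvar 0) \<in> base (Suc m)" by (rule N_in_base) simp
  have N_inv: "N (Suc m) (mvar 0) \<in> (invariants (Suc m) :: 'a mpoly set)"
    and z_inv: "last_var m \<in> (invariants (Suc m) :: 'a mpoly set)"
    using N_base last_var_in_base base_subset_invariants[of "Suc m"] by auto
  have ht: "h * t \<in> zeta_span m"
  proof -
    obtain b where b: "\<forall>a\<in>exponents m. b a \<in> base (Suc m)"
      "h = (\<Sum>a\<in>exponents m. b a * hat m (xi_monomial m a))"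
      using inner_invariants_span[OF span h] unfolding span_over_def by blast
    \<comment> \<open>The image of a monomial of rank m times the digit monomial of t is exactly one
      of the \<open>zeta\<close>.\<close>
    have "h * t = (\<Sum>a\<in>exponents m. (b a * N (Suc m) (mvar 0) ^ k) * zeta m (combine m a c))"
      unfolding b(2) t_def zeta_combine[OF c] sum_distrib_right by (simp add: mult_ac)
    also have "\<dots> \<in> zeta_span m"
      using b(1) combine_in_exponents[OF _ c] N_base finite_exponents'
      by (intro span_over_sum[OF sub] span_over_mult[OF sub] is_subalgebraD(3)[OF sub]
          subalgebra_power[OF sub] span_over_base[OF sub]) auto
    finally show ?thesis .
  qed
  \<comment> \<open>Both products have the leading term z^s h y^d, which cancels.\<close>
  define f' where "f' = last_var m ^ s * f - h * t"
  have "t \<in> invariants (Suc m)"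
    unfolding t_def
    by (intro is_subalgebraD(3)[OF inv] subalgebra_power[OF inv] subalgebra_prod[OF inv] N_inv xi_invariant) auto
  then have f'_inv: "f' \<in> invariants (Suc m)"
    unfolding f'_def using less.prems h(1) z_inv
    by (intro subalgebra_diff[OF inv] is_subalgebraD(3)[OF inv] subalgebra_power[OF inv])
  have "\<exists>k. last_var m ^ k * f' \<in> zeta_span m"
  \<comment> \<open>The zero polynomial has degree 0, so for d = 0 the degree does not drop; this
    case is settled directly.\<close>
  proof (cases "f' = 0")
    case True
    then show ?thesis using span_over_0[OF sub] by auto
  next
    case False
    have hc: "as_poly 0 h = [:h:]" by (rule as_poly_const[OF h(2)]) simp
    have zc: "as_poly 0 (last_var m ^ s) = [:last_var m ^ s :: 'a mpoly:]"
      by (simp add: as_poly.hom_power as_poly_mvar poly_const_pow)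
    have af': "as_poly 0 f' = smult (last_var m ^ s) (as_poly 0 f) - smult h (as_poly 0 t)"
      unfolding f'_def as_poly.hom_minus as_poly.hom_mult hc zc by simp
    have "degree (as_poly 0 f') \<le> d"
      unfolding af' using t(1) by (intro degree_diff_le order_trans[OF degree_smult_le]) (auto simp: d_def)
    moreover have "coeff (as_poly 0 f') d = 0"
      unfolding af' using t by (simp add: d_def h_def mult.commute)
    moreover have "as_poly 0 f' \<noteq> 0" using False by (metis as_poly.hom_zero as_poly_eq_iff)
    ultimately have "degree (as_poly 0 f') < d"
      by (metis leading_coeff_0_iff nat_less_le)
    then show ?thesis using less.hyps[of f'] f'_inv by (simp add: d_def)
  qed
  then obtain k' where k': "last_var m ^ k' * f' \<in> zeta_span m" by blast
  have "last_var m ^ (k' + s) * f = last_var m ^ k' * f' + last_var m ^ k' * (h * t)"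
    by (simp add: f'_def power_add algebra_simps)
  also have "\<dots> \<in> zeta_span m"
    by (rule span_over_add[OF sub k' span_over_mult[OF sub subalgebra_power[OF sub last_var_in_base] ht]])
  finally show ?case by blast
qed

text \<open>The left side of the expansion vanishes modulo z, so by
  \<open>relation_mod_last_var\<close> every coefficient is divisible by z, and one factor z can be
  removed.\<close>

lemma zeta_span_cancel:
  assumes odd: "odd q" and indep: "independent_over (base m) (exponents m) (xi_monomial m)"
    and "last_var m ^ k * f \<in> zeta_span m"
  shows "f \<in> zeta_span m"
  using assms(3)
proof (induction k)
  case (Suc k)
  obtain b where b: "\<forall>a\<in>exponents (Suc m). b a \<in> base (Suc m)"
    "last_var m ^ Suc k * f = (\<Sum>a\<in>exponents (Suc m). b a * zeta m a)"
    using Suc.prems unfolding span_over_def by blast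
  have "reduce m (\<Sum>a\<in>exponents (Suc m). b a * zeta m a) = 0"
    unfolding b(2)[symmetric] by (simp add: reduce.hom_mult reduce_mvar)
  then obtain b' where b': "\<forall>a\<in>exponents (Suc m). b' a \<in> base (Suc m) \<and> b a = last_var m * b' a"
    using relation_mod_last_var[OF odd indep b(1), of "zeta m"] reduce_zeta by blast
  have "last_var m * (last_var m ^ k * f) = last_var m * (\<Sum>a\<in>exponents (Suc m). b' a * zeta m a)"
    using b(2) b' by (simp add: sum_distrib_left mult.assoc)
  then have "last_var m ^ k * f = (\<Sum>a\<in>exponents (Suc m). b' a * zeta m a)" by simp
  then have "last_var m ^ k * f \<in> zeta_span m"
    using b' unfolding span_over_def by blast
  then show ?case by (rule Suc.IH)
qed simp

section \<open>From \<open>zeta\<close> to monomials in the forms, degree by degree\<close>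

lemma homogeneous_of_xi:
  assumes "1 \<le> i"
  shows "homogeneous_of (q ^ (i - 1) + 1) (xi m i :: 'a mpoly)"
    and "homogeneous_of (q * (q ^ (i - 1) + 1)) (hat m (xi m i))"
proof -
  interpret hat: comm_ring_hom "hat m" by (rule hat_hom)
  have "homogeneous_of (1 + (q - 1) * 1) (mvar (Suc k) * last_var m ^ (q - 1) :: 'a mpoly)" for k
    by (intro homogeneous_of_mult homogeneous_of_power homogeneous_of_mvar)
  then have hat: "homogeneous_of q (hat m (mvar k))" for k
    using homogeneous_of_power[OF homogeneous_of_mvar, where 'a = 'a, of q "Suc k"] q_gt_1
    by (auto intro!: homogeneous_of_diff)
  show "homogeneous_of (q ^ (i - 1) + 1) (xi m i :: 'a mpoly)"
  proof (cases "i = 1")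
    case True
    have "homogeneous_of (1 + 1) (mvar k * mvar (2 * m - 1 - k) :: 'a mpoly)" for k
      by (intro homogeneous_of_mult homogeneous_of_mvar)
    then show ?thesis using True by (auto simp: xi_1 intro!: homogeneous_of_sum)
  next
    case False
    then have i: "2 \<le> i" using assms by simp
    have "homogeneous_of (q ^ (i - 1) * 1 + 1) (mvar k ^ (q ^ (i - 1)) * mvar (2 * m - 1 - k) :: 'a mpoly)"
      "homogeneous_of (1 + q ^ (i - 1) * 1) (mvar k * mvar (2 * m - 1 - k) ^ (q ^ (i - 1)) :: 'a mpoly)" for k
      by (intro homogeneous_of_mult homogeneous_of_power homogeneous_of_mvar)+
    then show ?thesis unfolding xi_ge_2[OF i] by (auto intro!: homogeneous_of_sum homogeneous_of_add)
  qed
  show "homogeneous_of (q * (q ^ (i - 1) + 1)) (hat m (xi m i))"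
  proof (cases "i = 1")
    case True
    have "homogeneous_of (q + q) (hat m (mvar k) * hat m (mvar (2 * m - 1 - k)))" for k
      by (intro homogeneous_of_mult hat)
    then show ?thesis
      using True by (simp add: xi_1 hat.hom_sum hat.hom_mult mult_2_right homogeneous_of_sum del: hat_mvar)
  next
    case False
    then have i: "2 \<le> i" using assms by simp
    have "homogeneous_of (q ^ (i - 1) * q + q) (hat m (mvar k) ^ (q ^ (i - 1)) * hat m (mvar (2 * m - 1 - k)))"
      "homogeneous_of (q + q ^ (i - 1) * q) (hat m (mvar k) * hat m (mvar (2 * m - 1 - k)) ^ (q ^ (i - 1)))" for k
      by (intro homogeneous_of_mult homogeneous_of_power hat)+
    moreover have "q * (q ^ (i - 1) + 1) = q ^ (i - 1) * q + q" by simp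
    ultimately show ?thesis
      unfolding xi_ge_2[OF i] hat.hom_sum hat.hom_add hat.hom_mult hat.hom_power
      by (metis (no_types, lifting) add.commute homogeneous_of_add homogeneous_of_sum)
  qed
qed

text \<open>The common degree of \<open>zeta m b\<close> and \<open>xi_monomial (Suc m) b\<close>:
  \<open>hat\<close> multiplies degrees by q, just as the q-th power does.\<close>

definition weight :: "nat \<Rightarrow> (nat \<Rightarrow> nat) \<Rightarrow> nat" where
  "weight m b = (\<Sum>i=1..2 * m. b i * (q ^ (i - 1) + 1))"

lemma homogeneous_of_zeta: "homogeneous_of (weight m b) (zeta m b)"
  unfolding zeta_def weight_def
proof (rule homogeneous_of_prod)
  fix i assume "i \<in> {1..2 * m}"
  then have i: "1 \<le> i" by simp
  let ?w = "q ^ (i - 1) + 1"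
  have "homogeneous_of ((b i div q) * (q * ?w) + (b i mod q) * ?w)
      (hat m (xi m i) ^ (b i div q) * xi (Suc m) i ^ (b i mod q))"
    by (intro homogeneous_of_mult homogeneous_of_power homogeneous_of_xi i)
  moreover have "(b i div q) * (q * ?w) + (b i mod q) * ?w = ((b i div q) * q + b i mod q) * ?w"
    by (simp only: distrib_right mult.assoc)
  ultimately show "homogeneous_of (b i * ?w) (hat m (xi m i) ^ (b i div q) * xi (Suc m) i ^ (b i mod q))"
    by simp
qed

lemma homogeneous_of_xi_monomial: "homogeneous_of (weight m b) (xi_monomial (Suc m) b)"
proof -
  have "homogeneous_of (\<Sum>i=1..2 * m. b i * (q ^ (i - 1) + 1)) (\<Prod>i=1..2 * m. xi (Suc m) i ^ b i :: 'a mpoly)"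
    by (intro homogeneous_of_prod homogeneous_of_power homogeneous_of_xi(1)) auto
  then show ?thesis unfolding xi_monomial_def weight_def by simp
qed

lemma homogeneous_of_mvar_mult_cancel:
  assumes "homogeneous_of d (mvar i * f)" "(f :: 'a mpoly) \<noteq> 0"
  obtains d' where "d = Suc d'" "homogeneous_of d' f"
proof -
  have eq: "pCons 0 (smult (mvar i) (graded f)) = monom (mvar i * f) d"
    using assms(1) by (simp add: homogeneous_of_def graded.hom_mult)
  show thesis
  proof (cases d)
    case 0
    then show ?thesis using eq assms(2) by (simp add: monom_0)
  next
    case (Suc d')
    then have "smult (mvar i) (graded f) = smult (mvar i) (monom f d')"
      using eq by (simp add: monom_Suc smult_monom)
    then have "smult (mvar i) (graded f - monom f d') = 0" by (simp add: smult_diff_right)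
    then have "graded f = monom f d'" by simp
    then show ?thesis using Suc that by (simp add: homogeneous_of_def)
  qed
qed

text \<open>z is itself invariant and not a zero divisor.\<close>

lemma last_var_mult_invariant:
  assumes "last_var m * f \<in> invariants (Suc m)" shows "(f :: 'a mpoly) \<in> invariants (Suc m)"
proof -
  have "act f g = f" if g: "g \<in> P (Suc m)" for g
  proof -
    have "act (last_var m * f) g = last_var m * f" using assms g by (simp add: invariants_iff)
    then have "last_var m * act f g = last_var m * f"
      unfolding act.hom_mult act_last_var[OF g] .
    then show ?thesis by simp
  qed
  then show ?thesis
    using assms mvar_mult_in_polys_in[of "Suc (2 * m)" f] by (auto simp: invariants_iff)
qed

text \<open>When each \<open>zeta\<close> is replaced by the corresponding monomial, the error is z
  v with v invariant and either zero or homogeneous of degree d - 1, so the induction applies to v.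
  The factor z lies in the base algebra.\<close>

lemma homogeneous_invariant_in_span:
  assumes zeta: "invariants (Suc m) \<subseteq> zeta_span m"
    and "f \<in> invariants (Suc m)" "homogeneous_of d (f :: 'a mpoly)"
  shows "f \<in> span_over (base (Suc m)) (exponents (Suc m)) (xi_monomial (Suc m))"
  using assms(2,3)
proof (induction d arbitrary: f rule: less_induct)
  case (less d f)
  note f = less.prems
  let ?E = "exponents (Suc m)" and ?W = "span_over (base (Suc m)) (exponents (Suc m)) (xi_monomial (Suc m))"
  note sub = base_subalgebra[of "Suc m"] and inv = invariants_subalgebra[of "Suc m"]
  obtain b where b: "\<forall>a\<in>?E. b a \<in> base (Suc m)" "f = (\<Sum>a\<in>?E. b a * zeta m a)"
    using zeta f(1) unfolding span_over_def by blast
  \<comment> \<open>Since f and the \<open>zeta m a\<close> are homogeneous, the coefficients may be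
    replaced by their parts of complementary degree; terms of weight above d drop out.\<close>
  define b' where "b' a = (if weight m a \<le> d then component (d - weight m a) (b a) else 0)" for a
  have b': "b' a \<in> base (Suc m)" if "a \<in> ?E" for a
    using b(1) that component_in_base subalgebra_0[OF sub] by (auto simp: b'_def)
  have b'_hom: "homogeneous_of d (b' a * u)" if "homogeneous_of (weight m a) u" for a u
  proof (cases "weight m a \<le> d")
    case True
    have "homogeneous_of (d - weight m a + weight m a) (b' a * u)"
      using True that by (intro homogeneous_of_mult) (auto simp: b'_def homogeneous_component)
    then show ?thesis using True by simp
  qed (simp add: b'_def homogeneous_of_0)
  have "f = component d f" using component_homogeneous[OF f(2), of d] by simp
  also have "\<dots> = (\<Sum>a\<in>?E. component d (b a * zeta m a))" unfolding b(2) by (rule component_sum)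
  also have "\<dots> = (\<Sum>a\<in>?E. b' a * zeta m a)"
    by (rule sum.cong) (auto simp: component_mult_homogeneous[OF homogeneous_of_zeta] b'_def)
  finally have f_eq: "f = (\<Sum>a\<in>?E. b' a * zeta m a)" .
  have "\<forall>a. \<exists>u. zeta m a - xi_monomial (Suc m) a = last_var m * u"
  proof
    fix a
    have "reduce m (zeta m a - xi_monomial (Suc m) a) = 0"
      by (simp only: reduce.hom_minus reduce_zeta reduce_xi_monomial) simp
    then show "\<exists>u. zeta m a - xi_monomial (Suc m) a = last_var m * u" by (rule reduce_eq_0E) blast
  qed
  then have "\<exists>u. \<forall>a. zeta m a - xi_monomial (Suc m) a = last_var m * u a" by (rule choice)
  then obtain u where u: "\<And>a. zeta m a - xi_monomial (Suc m) a = last_var m * u a" by blast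
  have u_inv: "u a \<in> invariants (Suc m)" for a
    using subalgebra_diff[OF inv zeta_invariant xi_monomial_invariant, of a a]
    unfolding u by (rule last_var_mult_invariant)
  define v where "v = (\<Sum>a\<in>?E. b' a * u a)"
  define w where "w = (\<Sum>a\<in>?E. b' a * xi_monomial (Suc m) a)"
  have w: "w \<in> ?W" unfolding w_def span_over_def using b' by blast
  have "last_var m * v = (\<Sum>a\<in>?E. b' a * (zeta m a - xi_monomial (Suc m) a))"
    unfolding v_def u sum_distrib_left by (simp add: mult_ac)
  also have "\<dots> = f - w"
    by (simp add: f_eq w_def right_diff_distrib sum_subtractf)
  finally have fw: "last_var m * v = f - w" .
  have "v \<in> ?W"
  \<comment> \<open>Only for nonzero v does homogeneity of z v force d to be positive.\<close>
  proof (cases "v = 0")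
    case True
    then show ?thesis using span_over_0[OF sub] by simp
  next
    case False
    have "homogeneous_of d w"
      unfolding w_def by (intro homogeneous_of_sum b'_hom homogeneous_of_xi_monomial)
    then have "homogeneous_of d (last_var m * v)" unfolding fw by (rule homogeneous_of_diff[OF f(2)])
    then obtain d' where d': "d = Suc d'" "homogeneous_of d' v"
      using False by (rule homogeneous_of_mvar_mult_cancel)
    moreover have "v \<in> invariants (Suc m)"
      unfolding v_def using b' u_inv base_subset_invariants[of "Suc m"]
      by (intro subalgebra_sum[OF inv] is_subalgebraD(3)[OF inv]) auto
    ultimately show ?thesis using less.IH[of d' v] by simp
  qed
  then have "w + last_var m * v \<in> ?W"
    using w last_var_in_base by (intro span_over_add[OF sub] span_over_mult[OF sub])
  then show ?case using fw by simp
qed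

lemma span_step:
  assumes odd: "odd q" and span: "invariants m \<subseteq> span_over (base m) (exponents m) (xi_monomial m)"
    and indep: "independent_over (base m) (exponents m) (xi_monomial m)"
  shows "invariants (Suc m) \<subseteq> span_over (base (Suc m)) (exponents (Suc m)) (xi_monomial (Suc m))"
proof
  fix f :: "'a mpoly" assume f: "f \<in> invariants (Suc m)"
  have zeta: "invariants (Suc m) \<subseteq> zeta_span m"
    using last_var_power_mult_in_zeta_span[OF odd span] zeta_span_cancel[OF odd indep] by blast
  have "component d f \<in> span_over (base (Suc m)) (exponents (Suc m)) (xi_monomial (Suc m))" for d
    by (rule homogeneous_invariant_in_span[OF zeta component_invariant[OF f] homogeneous_component])
  then have "(\<Sum>d\<le>degree (graded f). component d f)
      \<in> span_over (base (Suc m)) (exponents (Suc m)) (xi_monomial (Suc m))"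
    by (intro span_over_sum[OF base_subalgebra])
  then show "f \<in> span_over (base (Suc m)) (exponents (Suc m)) (xi_monomial (Suc m))"
    by (simp only: sum_component)
qed

section \<open>Independence of the monomials\<close>

lemma eq_0_if_divisible_by_powers:
  assumes "\<And>k. \<exists>g. f = mvar i ^ k * (g :: 'a mpoly)" shows "f = 0"
proof (rule ccontr)
  assume f: "f \<noteq> 0"
  \<comment> \<open>One factor more than the degree of f allows.\<close>
  obtain g where g: "f = mvar i ^ Suc (degree (graded f)) * g" using assms by blast
  have nz: "graded h \<noteq> 0" if "h \<noteq> 0" for h :: "'a mpoly"
    using that poly_graded_1[of h] by (metis poly_0)
  have "g \<noteq> 0" using f g by auto
  have "graded f = [:0, mvar i:] ^ Suc (degree (graded f)) * graded g"
    using arg_cong[OF g, of graded] by (simp only: graded.hom_mult graded.hom_power graded_mvar)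
  then have "degree (graded f) = degree ([:0, mvar i:] ^ Suc (degree (graded f)) * graded g)" by simp
  also have "\<dots> = Suc (degree (graded f)) + degree (graded g)"
    using nz[OF \<open>g \<noteq> 0\<close>] by (subst degree_mult_eq) (simp_all add: degree_power_eq del: power_Suc)
  finally show False by simp
qed

text \<open>A relation vanishes modulo z, so all its coefficients are divisible by z, and dividing
  leaves a relation of the same kind. By iteration each coefficient is divisible by every power of
  z.\<close>

lemma independent_step:
  assumes odd: "odd q" and indep: "independent_over (base m) (exponents m) (xi_monomial m)"
  shows "independent_over (base (Suc m)) (exponents (Suc m)) (xi_monomial (Suc m))"
  unfolding independent_over_def
proof (intro allI impI ballI)
  fix b and a
  let ?E = "exponents (Suc m)"
  assume b: "\<forall>a\<in>?E. b a \<in> base (Suc m)" and rel: "(\<Sum>a\<in>?E. b a * xi_monomial (Suc m) a) = 0" and a: "a \<in> ?E"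
  have "\<exists>c. (\<forall>a\<in>?E. c a \<in> base (Suc m) \<and> b a = last_var m ^ k * c a) \<and>
      (\<Sum>a\<in>?E. c a * xi_monomial (Suc m) a) = 0" for k
  proof (induction k)
    case 0
    then show ?case using b rel by (intro exI[of _ b]) simp
  next
    case (Suc k)
    then obtain c where c: "\<forall>a\<in>?E. c a \<in> base (Suc m)" "\<forall>a\<in>?E. b a = last_var m ^ k * c a"
      and c_rel: "(\<Sum>a\<in>?E. c a * xi_monomial (Suc m) a) = 0" by blast
    obtain c' where c': "\<forall>a\<in>?E. c' a \<in> base (Suc m) \<and> c a = last_var m * c' a"
      using relation_mod_last_var[OF odd indep c(1), of "xi_monomial (Suc m)"] reduce_xi_monomial c_rel
      by auto
    have "last_var m * (\<Sum>a\<in>?E. c' a * xi_monomial (Suc m) a) = (\<Sum>a\<in>?E. c a * xi_monomial (Suc m) a)"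
      using c' by (simp add: sum_distrib_left mult.assoc)
    then have "(\<Sum>a\<in>?E. c' a * xi_monomial (Suc m) a) = 0" using c_rel by simp
    then show ?case using c' c(2) by (intro exI[of _ c']) (simp add: mult.assoc power_Suc2 del: power_Suc)
  qed
  then have "\<exists>g. b a = last_var m ^ k * g" for k using a by blast
  then show "b a = 0" by (rule eq_0_if_divisible_by_powers)
qed

section \<open>Rank 0 and the induction on the rank\<close>

lemma exponents_0: "exponents 0 = {\<lambda>_. undefined}"
  by (simp add: exponents_def)

lemma invariants_0: "(f :: 'a mpoly) \<in> invariants 0 \<Longrightarrow> \<exists>c. f = mconst c"
proof -
  assume "f \<in> invariants 0"
  then have "Poly_Mapping.keys f \<subseteq> {0}"
    by (auto simp: invariants_iff polys_in_def)
  then have "f = (\<Sum>t\<in>{0}. Poly_Mapping.single t (Poly_Mapping.lookup f t))"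
    by (subst poly_mapping_sum_single[of f, symmetric], intro sum.mono_neutral_left) (auto simp: in_keys_iff)
  then show ?thesis by (auto simp: mconst_def)
qed

lemma xi_monomials_basis:
  assumes "odd q"
  shows "invariants m \<subseteq> span_over (base m) (exponents m) (xi_monomial m) \<and>
    independent_over (base m) (exponents m) (xi_monomial m)"
proof (induction m)
  case 0
  \<comment> \<open>In rank 0 there are no variables: the invariants are the constants and the only
    monomial is the empty product.\<close>
  have one: "xi_monomial 0 a = 1" for a by (simp add: xi_monomial_def)
  have "f \<in> span_over (base 0) (exponents 0) (xi_monomial 0)" if "f \<in> invariants 0" for f
  proof -
    obtain c where "f = mconst c" using invariants_0[OF \<open>f \<in> invariants 0\<close>] by blast
    then show ?thesis
      using is_subalgebraD(1)[OF base_subalgebra[of 0], of c] unfolding span_over_def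
      by (intro CollectI exI[of _ "\<lambda>_. f"]) (simp add: exponents_0 one)
  qed
  then have "invariants 0 \<subseteq> span_over (base 0) (exponents 0) (xi_monomial 0)" by blast
  moreover have "independent_over (base 0) (exponents 0) (xi_monomial 0)"
    by (auto simp: independent_over_def exponents_0 one)
  ultimately show ?case by blast
next
  case (Suc m)
  then show ?case using span_step[OF assms] independent_step[OF assms] by blast
qed

theorem xi_monomials_free_basis:
  assumes "odd q"
  shows "is_free_basis (base m) (invariants m) (exponents m) (xi_monomial m)"
proof (rule is_free_basis_finiteI)
  show "finite (exponents m)" by (rule finite_exponents')
  show "is_submodule (base m) (invariants m)"
    using subalgebra_0[OF invariants_subalgebra[of m]] is_subalgebraD[OF invariants_subalgebra[of m]]
      base_subset_invariants[of m]
    by (auto simp: is_submodule_def subset_iff)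
  show "0 \<in> base m" by (rule subalgebra_0[OF base_subalgebra])
qed (use xi_monomials_basis[OF assms] xi_monomial_invariant in auto)

end

text \<open>Translation by 1 permutes the field, so it leaves the sum of all elements unchanged,
  while it adds \<open>CARD('a)\<close> times 1.\<close>

lemma CHAR_dvd_card: "CHAR('a::{field,finite}) dvd CARD('a)"
proof -
  have "(\<Sum>x\<in>(UNIV :: 'a set). x + 1) = (\<Sum>x\<in>UNIV. x)"
    by (rule sum.reindex_bij_witness[of _ "\<lambda>x. x - 1" "\<lambda>x. x + 1"]) auto
  then have "of_nat CARD('a) = (0 :: 'a)" by (simp add: sum.distrib)
  then show ?thesis by (simp add: of_nat_eq_0_iff_char_dvd)
qed

theorem corollary5p17:
  fixes p r q m n :: nat
  assumes "prime p" and "odd p" and "r \<ge> 1" and "q = p ^ r"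
    and "CARD('a::{field,finite}) = q"
    and "m \<ge> 1" and "n = 2 * m"
  shows "is_free_basis (generated_subalgebra (H0 m)) (invariants m :: 'a mpoly set)
           (\<Pi>\<^sub>E i\<in>{1..n - 2}. {0..e q m i})
           (\<lambda>a. \<Prod>i=1..n - 2. xi m i ^ a i)"
proof -
  have "prime CHAR('a)" by (rule prime_CHAR_semidom) (simp add: finite_imp_CHAR_pos)
  moreover have "CHAR('a) dvd p ^ r" using CHAR_dvd_card[where 'a = 'a] assms(4,5) by simp
  ultimately have "CHAR('a) = p" using assms(1) prime_dvd_power primes_dvd_imp_eq by blast
  then interpret finite_field_card "TYPE('a)" q r
    using assms(4,5) by unfold_locales auto
  have "odd q" using assms(2,4) by simp
  show ?thesis
    using xi_monomials_free_basis[OF \<open>odd q\<close>, of m] unfolding exponents_def xi_monomial_def[abs_def] assms(7) .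
qed

end
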